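(* Let $K\ge -1$ be an integer and let $n_1,n_2$ be integers with $0<n_1,n_2<2(K+3)$ and $n_1\not\equiv n_2 \pmod 2$ (that is, $\Lambda^{[K]}_{n_1,n_2}$ is an admissible weight of type $S^\vee_{(1)}$ and level $K$). The character of the $C_2^{(1)}$-module $L(\Lambda^{[K]}_{n_1,n_2})$ and its modular transformation are given by the following formulas. 1) $$ {\rm ch}_{L(\Lambda^{[K]}_{n_1,n_2})}(\tau,z_1,z_2,t):=\frac{A'^{[K]}_{n_1,n_2}(\tau,z_1,z_2,t)}{R(\tau,z_1,z_2,t)}=\frac{\widetilde\eta(\tau,t)^2\,\big[\widetilde\theta_{n_1,2(K+3)}-\widetilde\theta_{-n_1,2(K+3)}\big](\tau,z_1,t)\cdot\big[\widetilde\theta_{n_2,2(K+3)}-\widetilde\theta_{-n_2,2(K+3)}\big](\tau,z_2,t)}{\widetilde\vartheta_{11}(\tau,z_1,t)\,\widetilde\vartheta_{11}(\tau,z_2,t)\,\widetilde\vartheta_{11}(\tau,z_1-z_2,t)\,\widetilde\vartheta_{11}(\tau,z_1+z_2,t)} .$$ 2) $$ {\rm ch}_{L(\Lambda^{[K]}_{n_1,n_2})}\big|_{ST^2S}(\tau,z_1,z_2,t)=-\frac{(\gamma_{2(K+3)})^2}{4(K+3)^2}\,e^{\frac{\pi i}{3}}\,e^{-\frac{\pi i}{8(K+3)}(n_1^2+n_2^2)}\sum_{\substack{0<k_1,k_2<2(K+3)\\ k_1\equiv n_1\ {\rm mod}\ 2\\ k_2\equiv n_2\ {\rm mod}\ 2}}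 e^{-\frac{\pi i}{8(K+3)}(k_1^2+k_2^2)}\Big(\sin\frac{\pi n_1k_1}{4(K+3)}\Big)\Big(\sin\frac{\pi n_2k_2}{4(K+3)}\Big)\,{\rm ch}_{L(\Lambda^{[K]}_{k_1,k_2})}(\tau,z_1,z_2,t) .$$ 3) $$ {\rm ch}_{L(\Lambda^{[K]}_{n_1,n_2})}\big|_{T}(\tau,z_1,z_2,t)=-\,e^{\frac{\pi i}{6}}\,e^{\frac{\pi i}{4(K+3)}(n_1^2+n_2^2)}\;{\rm ch}_{L(\Lambda^{[K]}_{n_1,n_2})}(\tau,z_1,z_2,t) .$$
   Context: Lie algebra data. $\mathfrak g$ is the affine Lie algebra $C_2^{(1)}$. Its Cartan subalgebra, identified with its dual via the invariant form $(\cdot|\cdot)$, is $\mathfrak h=\mathbf C\Lambda_0\oplus\overline{\mathfrak h}\oplus\mathbf C\delta$, $\overline{\mathfrak h}=\mathbf C\alpha_1\oplus\mathbf C\alpha_2$, with $(\alpha_1|\alpha_1)=1$, $(\alpha_1|\alpha_2)=-1$, $(\alpha_2|\alpha_2)=2$, $(\Lambda_0|\delta)=1$, $(\Lambda_0|\Lambda_0)=(\delta|\delta)=0$, $(\Lambda_0|\alpha_i)=(\delta|\alpha_i)=0$ for $i=1,2$. The finite positive roots are $\overline\Delta_+=\{\alpha_1,\alpha_2,\alpha_1+\alpha_2,2\alpha_1+\alpha_2\}$; $\rho=3\Lambda_0+2\alpha_1+\frac32\alpha_2$, $|\rho|^2=\frac52$, dual Coxeter number $h^\vee=3$. $\overline\lambda$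 is the $\overline{\mathfrak h}$-component of $\lambda$. Weights. $\Lambda^{[K]}_{n_1,n_2}:=K\Lambda_0+\frac{n_1-1}{2}\alpha_1+\frac{n_2-3}{2}(\alpha_1+\alpha_2)$, so $\Lambda^{[K]}_{n_1,n_2}+\rho=(K+3)\Lambda_0+\frac{n_1}{2}\alpha_1+\frac{n_2}{2}(\alpha_1+\alpha_2)$. $S^\vee_{(1)}=\{2\delta-\alpha_1^\vee,\alpha_1^\vee\}\cup\{2\delta-(\alpha_1^\vee+2\alpha_2^\vee),\alpha_1^\vee+2\alpha_2^\vee\}$ with $\alpha_1^\vee=2\alpha_1$, $\alpha_2^\vee=\alpha_2$. Coordinates. For $\tau\in\mathbf C$, ${\rm Im}\,\tau>0$, $q=e^{2\pi i\tau}$ and $z_1,z_2,t\in\mathbf C$, put $h=(\tau,z_1,z_2,t)=2\pi i\{-\tau\Lambda_0+z_1\alpha_1+z_2(\alpha_1+\alpha_2)+t\delta\}$; $e^\lambda$ is the function $h\mapsto e^{(\lambda|h)}$ (so $e^{-\delta}=q$). Numerator. With $t_\alpha(\lambda)=\lambda+(\lambda|\delta)\alpha-\{\frac{|\alpha|^2}{2}(\lambda|\delta)+(\lambda|\alpha)\}\delta$ and $W_{(1)}=\langle r_{\alpha_1},r_{\alpha_1+\alpha_2}\rangle\ltimes\{t_{2j\alpha_1+2k(\alpha_1+\alpha_2)};\ j,k\in\mathbf Z\}$ ($r_\alpha$ = reflection, $\varepsilon$ = sign character), put, for $\Lambda=\Lambda^{[K]}_{n_1,n_2}$, $$A^{[K]}_{n_1,n_2}:=q^{\frac{|\overline{\Lambda+\rho}|^2}{2(K+3)}}\sum_{w\in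 W_{(1)}}\varepsilon(w)e^{w(\Lambda+\rho)},\qquad A'^{[K]}_{n_1,n_2}(\tau,z_1,z_2,t):=A^{[K]}_{n_1,n_2}(\tau,z_1,z_2,2t).$$ Denominator. $R:=q^{\frac{|\rho|^2}{2h^\vee}}e^{\rho}\prod_{n\ge1}\Big[(1-q^n)^2\prod_{\alpha\in\overline\Delta_+}(1-q^{n-1}e^{-\alpha})(1-q^ne^{\alpha})\Big]$. Special functions. $\widetilde\eta(\tau,t)=e^{\pi it}\eta(\tau)$ ($\eta$ = Dedekind eta function); $\widetilde\theta_{j,m}(\tau,z,t)=e^{\pi imt}\sum_{n\in\mathbf Z}e^{2\pi im(n+\frac{j}{2m})z}q^{m(n+\frac{j}{2m})^2}$; $\widetilde\vartheta_{11}(\tau,z,t)=e^{2\pi it}\,q^{\frac18}e^{-\pi i(z+\frac12)}\prod_{n\ge1}(1-q^n)(1-e^{2\pi iz}q^{n-1})(1-e^{-2\pi iz}q^{n})$. Also $\gamma_m:=\sum_{k\in\mathbf Z/2m\mathbf Z}e^{\frac{\pi i}{m}k^2}$ for $m$ a positive even integer. Modular action. $S=\begin{pmatrix}0&-1\\1&0\end{pmatrix}$, $T=\begin{pmatrix}1&1\\0&1\end{pmatrix}$, $ST^2S=\begin{pmatrix}-1&0\\2&-1\end{pmatrix}$. $SL_2(\mathbf Z)$ acts on functions $F(\tau,z,t)$, where ${\rm Im}\,\tau>0$, $t\in\mathbf C$ and $z$ ranges over an $\ell$-dimensional complex space $V$ with inner product $(\cdot|\cdot)$, by $$F|_M(\tau,z,t)=(c\tau+d)^{-\frac{\ell}{2}}F\Big(\frac{a\tau+b}{c\tau+d},\frac{z}{c\tau+d},t-\frac{c(z|z)}{2(c\tau+d)}\Big),\qquad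 M=\begin{pmatrix}a&b\\c&d\end{pmatrix}\in SL_2(\mathbf Z).$$ Here $V=\overline{\mathfrak h}$, with $z=z_1\alpha_1+z_2(\alpha_1+\alpha_2)$.
   Formalization: In 1) the right-hand side carries an extra minus sign; in 2) and 3) ch|_M means (A|_M with t replaced by 2t)/(R|_M), since the printed action applied to ch itself differs by the factor (cτ+d)e^{πi(K+3)c(z|z)/(cτ+d)} (for T the two agree). *)

theory Defs
  imports "HOL-Analysis.Analysis" "HOL-Number_Theory.Cong"
begin

subsection \<open>The Cartan subalgebra of the affine Lie algebra of type \<open>C\<^sub>2\<^sup>(\<^sup>1\<^sup>)\<close>\<close>

text \<open>
  The components of a vector are its coordinates with respect to the basis
  \<open>\<Lambda>\<^sub>0, \<alpha>\<^sub>1, \<alpha>\<^sub>2, \<delta>\<close>, in this order.  The Cartan subalgebra is identified with its dual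
  through the invariant form, which is complex bilinear (not Hermitian).
\<close>

type_synonym cartan = "complex ^ 4"

definition Lambda0 :: cartan where "Lambda0 = vector [1, 0, 0, 0]"
definition alpha1 :: cartan where "alpha1 = vector [0, 1, 0, 0]"
definition alpha2 :: cartan where "alpha2 = vector [0, 0, 1, 0]"
definition delta :: cartan where "delta = vector [0, 0, 0, 1]"

definition form :: "cartan \<Rightarrow> cartan \<Rightarrow> complex" where
  "form u v = u$1 * v$4 + u$4 * v$1
     + u$2 * v$2 - u$2 * v$3 - u$3 * v$2 + 2 * (u$3 * v$3)"

definition finite_part :: "cartan \<Rightarrow> cartan" where
  "finite_part u = u$2 *s alpha1 + u$3 *s alpha2"

definition finite_pos_roots :: "cartan set" where
  "finite_pos_roots = {alpha1, alpha2, alpha1 + alpha2, 2 *s alpha1 + alpha2}"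

definition rho :: cartan where
  "rho = 3 *s Lambda0 + 2 *s alpha1 + (3/2) *s alpha2"

definition dual_coxeter :: complex where "dual_coxeter = 3"

definition weight :: "int \<Rightarrow> int \<Rightarrow> int \<Rightarrow> cartan" where
  "weight K n1 n2 = of_int K *s Lambda0 + ((of_int n1 - 1) / 2) *s alpha1
     + ((of_int n2 - 3) / 2) *s (alpha1 + alpha2)"

subsection \<open>The group \<open>W\<^sub>(\<^sub>1\<^sub>)\<close>\<close>

definition root_refl :: "cartan \<Rightarrow> cartan \<Rightarrow> cartan" where
  "root_refl \<alpha> u = u - (2 * form u \<alpha> / form \<alpha> \<alpha>) *s \<alpha>"

definition transl :: "cartan \<Rightarrow> cartan \<Rightarrow> cartan" where
  "transl \<alpha> u = u + form u delta *s \<alpha>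
     - (form \<alpha> \<alpha> / 2 * form u delta + form u \<alpha>) *s delta"

text \<open>The generators are involutions, so closure under composition gives the generated group.\<close>

inductive_set finite_W1 :: "(cartan \<Rightarrow> cartan) set" where
  finite_W1_id: "id \<in> finite_W1"
| finite_W1_refl1: "w \<in> finite_W1 \<Longrightarrow> root_refl alpha1 \<circ> w \<in> finite_W1"
| finite_W1_refl2: "w \<in> finite_W1 \<Longrightarrow> root_refl (alpha1 + alpha2) \<circ> w \<in> finite_W1"

definition lattice_W1 :: "cartan set" where
  "lattice_W1 = {(2 * of_int j) *s alpha1 + (2 * of_int k) *s (alpha1 + alpha2) | j k :: int. True}"

definition W1 :: "(cartan \<Rightarrow> cartan) set" where
  "W1 = {w \<circ> transl \<beta> | w \<beta>. w \<in> finite_W1 \<and> \<beta> \<in> lattice_W1}"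

text \<open>The sign character of the Weyl group is the determinant on the Cartan subalgebra.\<close>

definition weyl_sign :: "(cartan \<Rightarrow> cartan) \<Rightarrow> complex" where
  "weyl_sign w = det (matrix w)"

subsection \<open>Coordinates, numerator and denominator\<close>

definition coord :: "complex \<Rightarrow> complex \<Rightarrow> complex \<Rightarrow> complex \<Rightarrow> cartan" where
  "coord \<tau> z1 z2 t = (2 * of_real pi * \<i>) *s
     (- \<tau> *s Lambda0 + z1 *s alpha1 + z2 *s (alpha1 + alpha2) + t *s delta)"

definition expw :: "cartan \<Rightarrow> cartan \<Rightarrow> complex" where
  "expw u h = exp (form u h)"

definition qpow :: "complex \<Rightarrow> complex \<Rightarrow> complex" where
  "qpow \<tau> x = exp (2 * of_real pi * \<i> * \<tau> * x)"

definition numer :: "int \<Rightarrow> int \<Rightarrow> int \<Rightarrow> complex \<Rightarrow> complex \<Rightarrow> complex \<Rightarrow> complex \<Rightarrow> complex" where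
  "numer K n1 n2 \<tau> z1 z2 t =
     (let \<mu> = weight K n1 n2 + rho in
      qpow \<tau> (form (finite_part \<mu>) (finite_part \<mu>) / (2 * (of_int K + 3)))
      * (\<Sum>\<^sub>\<infinity>w\<in>W1. weyl_sign w * expw (w \<mu>) (coord \<tau> z1 z2 t)))"

definition numer' :: "int \<Rightarrow> int \<Rightarrow> int \<Rightarrow> complex \<Rightarrow> complex \<Rightarrow> complex \<Rightarrow> complex \<Rightarrow> complex" where
  "numer' K n1 n2 \<tau> z1 z2 t = numer K n1 n2 \<tau> z1 z2 (2 * t)"

definition denom :: "complex \<Rightarrow> complex \<Rightarrow> complex \<Rightarrow> complex \<Rightarrow> complex" where
  "denom \<tau> z1 z2 t =
     (let h = coord \<tau> z1 z2 t; q = qpow \<tau> 1 in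
      qpow \<tau> (form rho rho / (2 * dual_coxeter)) * expw rho h
      * (\<Prod>n. (1 - q ^ Suc n)\<^sup>2
           * (\<Prod>\<alpha>\<in>finite_pos_roots. (1 - q ^ n * expw (- \<alpha>) h) * (1 - q ^ Suc n * expw \<alpha> h))))"

text \<open>
  At the zeros of \<open>denom\<close> the quotient has the value 0 by the convention \<open>x / 0 = 0\<close>; elsewhere
  it is the value of the meromorphic function.
\<close>

definition ch :: "int \<Rightarrow> int \<Rightarrow> int \<Rightarrow> complex \<Rightarrow> complex \<Rightarrow> complex \<Rightarrow> complex \<Rightarrow> complex" where
  "ch K n1 n2 \<tau> z1 z2 t = numer' K n1 n2 \<tau> z1 z2 t / denom \<tau> z1 z2 t"

subsection \<open>Special functions\<close>

definition dedekind_eta :: "complex \<Rightarrow> complex" where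
  "dedekind_eta \<tau> = qpow \<tau> (1/24) * (\<Prod>n. 1 - qpow \<tau> 1 ^ Suc n)"

definition eta_t :: "complex \<Rightarrow> complex \<Rightarrow> complex" where
  "eta_t \<tau> t = exp (of_real pi * \<i> * t) * dedekind_eta \<tau>"

definition theta_t :: "int \<Rightarrow> int \<Rightarrow> complex \<Rightarrow> complex \<Rightarrow> complex \<Rightarrow> complex" where
  "theta_t j m \<tau> z t = exp (of_real pi * \<i> * of_int m * t)
     * (\<Sum>\<^sub>\<infinity>n\<in>(UNIV :: int set).
          exp (2 * of_real pi * \<i> * of_int m * (of_int n + of_int j / (2 * of_int m)) * z)
          * qpow \<tau> (of_int m * (of_int n + of_int j / (2 * of_int m))\<^sup>2))"

text \<open>
  In this normalisation \<open>vartheta11_t\<close> is odd in \<open>z\<close>, with value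
  \<open>- 2 sin (\<pi> z) q\<^sup>1\<^sup>/\<^sup>8 exp (2\<pi>\<i>t)\<close> to leading order.  Since \<open>\<alpha>\<^sub>2\<close> takes the value
  \<open>z2 - z1\<close>, not \<open>z1 - z2\<close>, the product of the functions at \<open>z1\<close>, \<open>z2\<close>, \<open>z1 - z2\<close> and
  \<open>z1 + z2\<close> is \<open>- (eta_t \<tau> t)\<^sup>2 * denom \<tau> z1 z2 t\<close>, with a minus sign.
\<close>

definition vartheta11_t :: "complex \<Rightarrow> complex \<Rightarrow> complex \<Rightarrow> complex" where
  "vartheta11_t \<tau> z t = exp (2 * of_real pi * \<i> * t) * qpow \<tau> (1/8)
     * exp (- of_real pi * \<i> * (z + 1/2))
     * (\<Prod>n. (1 - qpow \<tau> 1 ^ Suc n)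
          * (1 - exp (2 * of_real pi * \<i> * z) * qpow \<tau> 1 ^ n)
          * (1 - exp (- 2 * of_real pi * \<i> * z) * qpow \<tau> 1 ^ Suc n))"

definition gauss_gamma :: "int \<Rightarrow> complex" where
  "gauss_gamma m = (\<Sum>k\<in>{0..<2 * m}. exp (of_real pi * \<i> / of_int m * (of_int k)\<^sup>2))"

subsection \<open>The modular action\<close>

definition S_mat :: "int ^ 2 ^ 2" where "S_mat = vector [vector [0, -1], vector [1, 0]]"
definition T_mat :: "int ^ 2 ^ 2" where "T_mat = vector [vector [1, 1], vector [0, 1]]"

lemma STTS: "S_mat ** T_mat ** T_mat ** S_mat = vector [vector [-1, 0], vector [2, -1]]"
  by (simp add: S_mat_def T_mat_def matrix_matrix_mult_def vec_eq_iff forall_2 sum_2)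

definition zvec :: "complex \<Rightarrow> complex \<Rightarrow> cartan" where
  "zvec z1 z2 = z1 *s alpha1 + z2 *s (alpha1 + alpha2)"

text \<open>The variable \<open>z\<close> ranges over a space of dimension 2, so the weight is \<open>2/2 = 1\<close>.\<close>

definition slash ::
  "(complex \<Rightarrow> complex \<Rightarrow> complex \<Rightarrow> complex \<Rightarrow> complex) \<Rightarrow> int ^ 2 ^ 2
    \<Rightarrow> complex \<Rightarrow> complex \<Rightarrow> complex \<Rightarrow> complex \<Rightarrow> complex" where
  "slash F M \<tau> z1 z2 t =
     (let a = of_int (M$1$1); b = of_int (M$1$2); c = of_int (M$2$1); d = of_int (M$2$2);
          j = c * \<tau> + d
      in inverse j * F ((a * \<tau> + b) / j) (z1 / j) (z2 / j)
           (t - c * form (zvec z1 z2) (zvec z1 z2) / (2 * j)))"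

text \<open>
  The character is a quotient, and the action on it is the one induced by the action on its
  numerator and denominator, both of which have weight 1; the doubling of \<open>t\<close> in the
  numerator is applied after the action.  This is not \<open>slash (ch K n1 n2)\<close>: that would give the
  quotient, which has weight 0, an additional factor \<open>inverse (c * \<tau> + d)\<close>, and would double
  the translation of \<open>t\<close> in the numerator.  The exact relation is \<open>ch_slash_eq\<close> below; for
  \<open>T\<close> the two agree (\<open>ch_slash_T\<close>).
\<close>

definition ch_slash :: "int \<Rightarrow> int \<Rightarrow> int \<Rightarrow> int ^ 2 ^ 2
    \<Rightarrow> complex \<Rightarrow> complex \<Rightarrow> complex \<Rightarrow> complex \<Rightarrow> complex" where
  "ch_slash K n1 n2 M \<tau> z1 z2 t =
     slash (numer K n1 n2) M \<tau> z1 z2 (2 * t) / slash denom M \<tau> z1 z2 t"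

lemma level_refl: "\<alpha>$1 = 0 \<Longrightarrow> root_refl \<alpha> u $ 1 = u $ 1"
  by (simp add: root_refl_def)

lemma level_transl: "\<alpha>$1 = 0 \<Longrightarrow> transl \<alpha> u $ 1 = u $ 1"
  by (simp add: transl_def delta_def vector_def)

lemma level_finite_W1: "w \<in> finite_W1 \<Longrightarrow> w u $ 1 = u $ 1"
  by (induction arbitrary: u rule: finite_W1.induct)
     (simp_all add: level_refl alpha1_def alpha2_def vector_def)

lemma level_W1: "w \<in> W1 \<Longrightarrow> w u $ 1 = u $ 1"
  by (auto simp: W1_def lattice_W1_def level_finite_W1 level_transl alpha1_def alpha2_def vector_def)

lemma numer_shift:
  "numer K n1 n2 \<tau> z1 z2 (t + s) =
     exp (2 * of_real pi * \<i> * (of_int K + 3) * s) * numer K n1 n2 \<tau> z1 z2 t"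
proof -
  define \<mu> where "\<mu> = weight K n1 n2 + rho"
  define E where "E = exp (2 * of_real pi * \<i> * (of_int K + 3) * s)"
  have mu1: "\<mu> $ 1 = of_int K + 3"
    by (simp add: \<mu>_def weight_def rho_def Lambda0_def alpha1_def alpha2_def vector_def)
  have *: "expw (w \<mu>) (coord \<tau> z1 z2 (t + s)) = E * expw (w \<mu>) (coord \<tau> z1 z2 t)"
    if "w \<in> W1" for w
  proof -
    have "coord \<tau> z1 z2 (t + s) = coord \<tau> z1 z2 t + (2 * of_real pi * \<i> * s) *s delta"
      by (simp add: coord_def vec_eq_iff algebra_simps)
    moreover have "form u (v + c *s delta) = c * u $ 1 + form u v" for u v c
      by (simp add: form_def delta_def vector_def algebra_simps)
    ultimately show ?thesis
      using level_W1[OF that, of \<mu>] mu1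
      by (simp add: expw_def E_def exp_add [symmetric] algebra_simps)
  qed
  have "(\<Sum>\<^sub>\<infinity>w\<in>W1. weyl_sign w * expw (w \<mu>) (coord \<tau> z1 z2 (t + s)))
      = (\<Sum>\<^sub>\<infinity>w\<in>W1. E * (weyl_sign w * expw (w \<mu>) (coord \<tau> z1 z2 t)))"
    by (intro infsum_cong) (simp add: *)
  also have "\<dots> = E * (\<Sum>\<^sub>\<infinity>w\<in>W1. weyl_sign w * expw (w \<mu>) (coord \<tau> z1 z2 t))"
    by (rule infsum_cmult_right')
  finally show ?thesis
    by (simp add: numer_def Let_def \<mu>_def [symmetric] E_def [symmetric])
qed

lemma ch_slash_eq:
  fixes M :: "int ^ 2 ^ 2"
  defines "c \<equiv> complex_of_int (M$2$1)" and "d \<equiv> complex_of_int (M$2$2)"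
  assumes "c * \<tau> + d \<noteq> 0"
  shows "ch_slash K n1 n2 M \<tau> z1 z2 t =
     (c * \<tau> + d)
     * exp (of_real pi * \<i> * (of_int K + 3) * c * form (zvec z1 z2) (zvec z1 z2) / (c * \<tau> + d))
     * slash (ch K n1 n2) M \<tau> z1 z2 t"
proof -
  define j where "j = c * \<tau> + d"
  define s where "s = c * form (zvec z1 z2) (zvec z1 z2) / (2 * j)"
  have "2 * t - s = 2 * (t - s) + s" by simp
  note shift = numer_shift[of K n1 n2 _ _ _ "2 * (t - s)" s, folded this]
  have e: "of_real pi * \<i> * (of_int K + 3) * c * form (zvec z1 z2) (zvec z1 z2) / j
      = 2 * of_real pi * \<i> * (of_int K + 3) * s"
    by (simp add: s_def)
  have "j \<noteq> 0" using assms by (simp add: j_def)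
  then show ?thesis
    unfolding ch_slash_def slash_def ch_def numer'_def Let_def
      c_def [symmetric] d_def [symmetric] j_def [symmetric] s_def [symmetric] e shift
    by (simp add: field_simps)
qed

lemma ch_slash_T: "ch_slash K n1 n2 T_mat = slash (ch K n1 n2) T_mat"
proof -
  have T: "T_mat $ 2 $ 1 = 0" "T_mat $ 2 $ 2 = 1"
    by (simp_all add: T_mat_def vector_2)
  show ?thesis
    by (intro ext) (subst ch_slash_eq; simp add: T)
qed

end

theory Submission
  imports Defs "HOL-Complex_Analysis.Conformal_Mappings"
begin

text \<open>
  The proof separates the two halves of the character.

  \<^emph>\<open>Numerator.\<close>  The vectors \<open>\<alpha>\<^sub>1\<close> and \<open>\<alpha>\<^sub>1 + \<alpha>\<^sub>2\<close> are orthonormal, and in these coordinates \<open>W1\<close> is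
  a product of two groups, each consisting of the sign changes of one coordinate and the
  translations along it.  The alternating sum over \<open>W1\<close> is therefore a product of two
  one-dimensional sums, each of which is an antisymmetrised theta function
  (\<open>numer_eq_theta_diff\<close>).

  \<^emph>\<open>Denominator.\<close>  The four finite positive roots take the values \<open>z1\<close>, \<open>z2\<close>, \<open>z2 - z1\<close> and
  \<open>z1 + z2\<close>, so up to a power of \<open>dedekind_eta\<close> the product is one of four values of
  \<open>vartheta11_t\<close> (\<open>vartheta11_product_eq_denom\<close>).  With the factorisation of the numerator this
  is the first formula.

  \<^emph>\<open>Modularity.\<close>  The translation \<open>T\<close> can be read off the definitions.  Everything else rests on the
  inversion formula of one series, \<open>jtheta \<tau> z = \<Sum>\<^sub>n exp (\<pi>\<i> (\<tau>n\<^sup>2 + 2nz))\<close>.  An entire function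
  with the two quasi-periods of \<open>jtheta \<tau>\<close> is determined by a single Fourier coefficient, hence is
  a multiple of it (\<open>quasi_periodic_eq_jtheta\<close>); the inverted series, multiplied by a Gaussian, is
  such a function (\<open>jtheta_inversion\<close>).  The multiplier \<open>jfactor \<tau>\<close> is found without any integral:
  averaging the formula over the \<open>M\<close>-torsion points gives \<open>jfactor (M\<^sup>2\<tau>) = M * jfactor \<tau>\<close>, and
  together with the trivial value at the fixed point \<open>\<i>\<close> and analytic continuation this yields
  \<open>(jfactor \<tau>)\<^sup>2 = - \<i>\<tau>\<close> (\<open>jfactor_square\<close>).  The square is all that is needed, because every
  multiplier enters the character in even degree, so no branch of the square root has to be chosen.

  Jacobi's triple product (\<open>jacobi_triple_product\<close>) gives \<open>jtheta \<tau> 0 \<noteq> 0\<close> and writes \<open>vartheta11_t\<close>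
  as a value of \<open>jtheta\<close>, so that \<open>vartheta11_t\<close> can be inverted.  Two evaluations of its product, at
  \<open>z = \<sigma>\<close> for the modulus \<open>3\<sigma>\<close> and at \<open>z = - 1/3\<close> for the modulus \<open>\<tau>/3\<close>, then give the
  inversion of \<open>(dedekind_eta \<tau>)\<^sup>2\<close>.

  For \<open>ST\<^sup>2S\<close> the theta functions are inverted, shifted by \<open>T\<^sup>2\<close> and inverted again.  The double sum
  over residues modulo \<open>4(K + 3)\<close> that arises contains, after completing the square, the Gauss sum
  \<open>gauss_gamma\<close> as it stands in the formula; its value is never computed.
\<close>

section \<open>A theta series\<close>

definition jterm :: "complex \<Rightarrow> complex \<Rightarrow> int \<Rightarrow> complex" where
  "jterm \<tau> z n = exp (of_real pi * \<i> * (\<tau> * (of_int n)\<^sup>2 + 2 * of_int n * z))"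

definition jtheta :: "complex \<Rightarrow> complex \<Rightarrow> complex" where
  "jtheta \<tau> z = (\<Sum>\<^sub>\<infinity>n\<in>UNIV. jterm \<tau> z n)"

lemma summable_on_int_geometric:
  fixes r :: real
  assumes "0 \<le> r" "r < 1"
  shows "(\<lambda>n::int. r ^ nat \<bar>n\<bar>) summable_on UNIV"
proof -
  have geo: "(\<lambda>n::nat. r ^ n) summable_on UNIV"
    using assms by (intro norm_summable_imp_summable_on) (auto intro!: summable_geometric)
  have 1: "(\<lambda>n::int. r ^ nat \<bar>n\<bar>) summable_on range int"
    by (subst summable_on_reindex) (use geo in \<open>auto simp: o_def\<close>)
  have 2: "(\<lambda>n::int. r ^ nat \<bar>n\<bar>) summable_on range (\<lambda>n. - int n)"
    by (subst summable_on_reindex) (use geo in \<open>auto simp: o_def inj_def\<close>)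
  have "(UNIV :: int set) = range int \<union> range (\<lambda>n. - int n)"
    by (auto simp: image_iff) (metis int_cases2)
  then show ?thesis
    using summable_on_union[OF 1 2] by simp
qed

text \<open>
  The Gaussian decay of the terms beats every exponential: completing the square in
  \<open>y n\<^sup>2 + 2 b n - \<bar>n\<bar>\<close> shows that the sum is dominated by a geometric series.
\<close>

lemma jterm_abs_summable:
  assumes "Im \<tau> > 0"
  shows "(\<lambda>n. norm (jterm \<tau> z n)) summable_on UNIV"
proof -
  define y b where "y = Im \<tau>" and "b = 2 * \<bar>Im z\<bar> + 1"
  have y: "y > 0" using assms by (simp add: y_def)
  \<comment> \<open>\<open>b\<^sup>2/(4y)\<close> is the maximum of \<open>b a - y a\<^sup>2\<close> over all real \<open>a\<close>\<close>
  define C where "C = exp (pi * (b\<^sup>2 / (4 * y)))"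
  define r where "r = exp (- pi)"
  have bound: "norm (jterm \<tau> z n) \<le> C * r ^ nat \<bar>n\<bar>" for n
  proof -
    define a where "a = \<bar>real_of_int n\<bar>"
    have "0 \<le> (2 * y * a - b)\<^sup>2 / (4 * y)" using y by simp
    also have "\<dots> = y * a\<^sup>2 - b * a + b\<^sup>2 / (4 * y)"
      using y by (simp add: field_simps power2_eq_square)
    finally have "- (y * a\<^sup>2) + (b - 1) * a \<le> b\<^sup>2 / (4 * y) - a"
      by (simp add: algebra_simps)
    moreover have "- (2 * of_int n * Im z) \<le> (b - 1) * a"
    proof -
      have "- (2 * of_int n * Im z) \<le> \<bar>2 * of_int n * Im z\<bar>" by linarith
      then show ?thesis by (simp add: b_def a_def abs_mult algebra_simps)
    qed
    moreover have "a\<^sup>2 = (of_int n)\<^sup>2" by (simp add: a_def)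
    ultimately have le: "- (y * (of_int n)\<^sup>2) - 2 * of_int n * Im z \<le> b\<^sup>2 / (4 * y) - a"
      by simp
    have "norm (jterm \<tau> z n) = exp (pi * (- (y * (of_int n)\<^sup>2) - 2 * of_int n * Im z))"
      by (simp add: jterm_def y_def power2_eq_square algebra_simps flip: of_int_mult)
    also have "\<dots> \<le> exp (pi * (b\<^sup>2 / (4 * y) - a))"
      using le by simp
    also have "\<dots> = C * r ^ nat \<bar>n\<bar>"
      by (simp add: C_def r_def a_def right_diff_distrib exp_diff exp_minus field_simps
          flip: exp_of_nat_mult exp_add)
    finally show ?thesis .
  qed
  have "(\<lambda>n. C * r ^ nat \<bar>n\<bar>) summable_on UNIV"
    by (intro summable_on_cmult_right summable_on_int_geometric) (auto simp: r_def)
  then show ?thesis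
    by (rule summable_on_comparison_test) (use bound in auto)
qed

lemma jterm_summable: "Im \<tau> > 0 \<Longrightarrow> jterm \<tau> z summable_on UNIV"
  using abs_summable_summable[OF jterm_abs_summable] by (simp add: eta_contract_eq)

lemma jtheta_has_sum: "Im \<tau> > 0 \<Longrightarrow> (jterm \<tau> z has_sum jtheta \<tau> z) UNIV"
  unfolding jtheta_def by (rule has_sum_infsum[OF jterm_summable])

lemma has_sum_int_halves:
  fixes f :: "int \<Rightarrow> 'a :: real_normed_vector"
  assumes "(f \<circ> int has_sum a) UNIV" "(f \<circ> (\<lambda>n. - int n) has_sum b) UNIV"
  shows "(f has_sum (a + (b - f 0))) UNIV"
proof -
  have 1: "(f has_sum a) (range int)"
    using assms(1) by (simp only: has_sum_reindex[OF inj_of_nat])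
  have "(f \<circ> (\<lambda>n. - int n) has_sum (b - f 0)) (UNIV - {0})"
    by (rule has_sum_Diff[OF assms(2)]) (auto intro: has_sum_finiteI)
  then have 2: "(f has_sum (b - f 0)) ((\<lambda>n. - int n) ` (UNIV - {0}))"
    by (subst has_sum_reindex) (simp_all add: inj_on_def)
  have "n \<in> range int \<union> (\<lambda>n. - int n) ` (UNIV - {0})" for n
    by (cases n rule: int_cases3) auto
  from UNIV_eq_I[OF this] have "UNIV = range int \<union> (\<lambda>n. - int n) ` (UNIV - {0})" .
  moreover have "range int \<inter> (\<lambda>n. - int n) ` (UNIV - {0}) = {}"
    by auto
  ultimately show ?thesis
    using has_sum_Un_disjoint[OF 1 2] by simp
qed

lemma exp_2pi_int: "exp (2 * of_real pi * \<i> * of_int n) = 1"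
  using exp_integer_2pi[of "of_int n"] by (simp add: mult_ac)

lemma exp_add_2pi_int: "exp (z + 2 * of_real pi * \<i> * of_int n) = exp z"
  by (simp add: exp_add exp_2pi_int)

lemma exp_eqI: "x = y + 2 * of_real pi * \<i> * of_int n \<Longrightarrow> exp x = exp y"
  by (simp add: exp_add_2pi_int)

lemma jtheta_add_1: "jtheta \<tau> (z + 1) = jtheta \<tau> z"
  unfolding jtheta_def jterm_def
  by (intro infsum_cong exp_eqI[where n = "_ :: int"]) (simp add: algebra_simps)

lemma jtheta_minus: "jtheta \<tau> (- z) = jtheta \<tau> z"
  unfolding jtheta_def
  by (rule infsum_reindex_bij_witness[of _ uminus uminus]) (auto simp: jterm_def)

lemma jtheta_add_period:
  "jtheta \<tau> (z + \<tau>) = exp (- of_real pi * \<i> * (\<tau> + 2 * z)) * jtheta \<tau> z"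
proof -
  have "jtheta \<tau> (z + \<tau>)
      = (\<Sum>\<^sub>\<infinity>n\<in>UNIV. exp (- of_real pi * \<i> * (\<tau> + 2 * z)) * jterm \<tau> z n)"
    unfolding jtheta_def
    by (rule infsum_reindex_bij_witness[of _ "\<lambda>n. n - 1" "\<lambda>n. n + 1"])
       (auto simp: jterm_def power2_eq_square algebra_simps simp flip: exp_add)
  also have "\<dots> = exp (- of_real pi * \<i> * (\<tau> + 2 * z)) * jtheta \<tau> z"
    unfolding jtheta_def by (rule infsum_cmult_right')
  finally show ?thesis .
qed

text \<open>
  In the variable \<open>w = exp (2\<pi>\<i>z)\<close> the positive and the negative part of the series are power
  series, in \<open>w\<close> and in \<open>1/w\<close>, with infinite radius of convergence.
\<close>

lemma jtheta_holomorphic: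
  assumes "Im \<tau> > 0"
  shows "jtheta \<tau> holomorphic_on UNIV"
proof -
  define a where "a n = exp (of_real pi * \<i> * (\<tau> * (of_nat n)\<^sup>2))" for n :: nat
  define A where "A w = (\<Sum>n. a n * w ^ n)" for w
  have summ: "(\<lambda>n. a n * exp (2 * of_real pi * \<i> * z) ^ n) summable_on UNIV" for z
  proof -
    have "jterm \<tau> z summable_on range int"
      by (rule summable_on_subset_banach[OF jterm_summable[OF assms]]) simp
    then have "(jterm \<tau> z \<circ> int) summable_on UNIV"
      by (subst (asm) summable_on_reindex) auto
    moreover have "(jterm \<tau> z \<circ> int) = (\<lambda>n. a n * exp (2 * of_real pi * \<i> * z) ^ n)"
      by (simp add: fun_eq_iff jterm_def a_def algebra_simps
          flip: exp_of_nat_mult exp_add)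
    ultimately show ?thesis by simp
  qed
  have hsum: "((\<lambda>n. a n * w ^ n) has_sum A w) UNIV" for w
  proof (cases "w = 0")
    case True
    have "((\<lambda>n. a n * w ^ n) has_sum a 0) UNIV"
      by (rule has_sum_finite_neutralI[of "{0}"]) (auto simp: True power_0_left)
    moreover from this have "A w = a 0"
      unfolding A_def by (simp add: has_sum_imp_sums sums_unique[symmetric])
    ultimately show ?thesis by simp
  next
    case False
    define z where "z = Ln w / (2 * of_real pi * \<i>)"
    have "exp (2 * of_real pi * \<i> * z) = w" using False by (simp add: z_def)
    with summ[of z] have s: "(\<lambda>n. a n * w ^ n) summable_on UNIV" by simp
    from has_sum_infsum[OF this] show ?thesis
      unfolding A_def using has_sum_imp_sums sums_unique by fastforce
  qed
  have "A holomorphic_on ball 0 r" for r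
    by (rule power_series_holomorphic[of _ _ a]) (use has_sum_imp_sums[OF hsum] in simp)
  then have "A field_differentiable at w" for w
    by (rule holomorphic_on_imp_differentiable_at[of _ "ball 0 (norm w + 1)"]) auto
  then have hA: "A holomorphic_on UNIV"
    by (simp add: holomorphic_on_def field_differentiable_at_within)
  have eq: "jtheta \<tau> z = A (exp (2 * of_real pi * \<i> * z))
      + A (exp (- (2 * of_real pi * \<i> * z))) - a 0" for z
  proof -
    have "(jterm \<tau> z \<circ> int has_sum A (exp (2 * of_real pi * \<i> * z))) UNIV"
      using hsum[of "exp (2 * of_real pi * \<i> * z)"]
      by (simp add: o_def a_def jterm_def algebra_simps flip: exp_of_nat_mult exp_add)
    moreover have "(jterm \<tau> z \<circ> (\<lambda>n. - int n)
        has_sum A (exp (- (2 * of_real pi * \<i> * z)))) UNIV"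
      using hsum[of "exp (- (2 * of_real pi * \<i> * z))"]
      by (simp add: o_def a_def jterm_def algebra_simps flip: exp_of_nat_mult exp_add)
    ultimately have "(jterm \<tau> z has_sum (A (exp (2 * of_real pi * \<i> * z))
       + (A (exp (- (2 * of_real pi * \<i> * z))) - jterm \<tau> z 0))) UNIV"
      by (rule has_sum_int_halves)
    moreover have "jterm \<tau> z 0 = a 0" by (simp add: jterm_def a_def)
    ultimately show ?thesis
      unfolding jtheta_def by (simp add: infsumI)
  qed
  have "(\<lambda>z. A (exp (2 * of_real pi * \<i> * z))
      + A (exp (- (2 * of_real pi * \<i> * z))) - a 0) holomorphic_on UNIV"
    by (intro holomorphic_intros holomorphic_on_compose_gen[OF _ hA, unfolded o_def]) auto
  then show ?thesis
    by (simp add: eq[abs_def])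
qed

section \<open>Entire functions of period 1 and their Fourier coefficients\<close>

inductive trig_poly :: "(real \<Rightarrow> complex) \<Rightarrow> bool" where
  trig_poly_monom: "trig_poly (\<lambda>x. c * exp (2 * of_real pi * \<i> * of_int k * of_real x))"
| trig_poly_add: "trig_poly p \<Longrightarrow> trig_poly r \<Longrightarrow> trig_poly (\<lambda>x. p x + r x)"

lemma trig_poly_mult:
  assumes "trig_poly p" "trig_poly r"
  shows "trig_poly (\<lambda>x. p x * r x)"
  using assms
proof (induction rule: trig_poly.induct)
  case (trig_poly_monom c k)
  from trig_poly_monom show ?case
  proof (induction rule: trig_poly.induct)
    case (trig_poly_monom d l)
    have eq: "c * exp (2 * of_real pi * \<i> * of_int k * of_real x)
        * (d * exp (2 * of_real pi * \<i> * of_int l * of_real x))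
      = (c * d) * exp (2 * of_real pi * \<i> * of_int (k + l) * of_real x)" for x :: real
      by (simp add: algebra_simps exp_add)
    show ?case unfolding eq by (rule trig_poly.trig_poly_monom)
  next
    case (trig_poly_add p r)
    then show ?case
      by (simp only: distrib_left) (rule trig_poly.trig_poly_add)
  qed
next
  case (trig_poly_add p s)
  then show ?case
    by (simp only: distrib_right) (rule trig_poly.trig_poly_add; simp)
qed

lemma trig_poly_const: "trig_poly (\<lambda>x. c)"
  using trig_poly_monom[of c 0] by simp

lemma periodic_int:
  fixes f :: "complex \<Rightarrow> 'a"
  assumes "\<And>z. f (z + 1) = f z"
  shows "f (z + of_int n) = f z"
proof (induction n rule: int_induct[where k = 0])
  case (step1 i)
  then show ?case using assms[of "z + of_int i"] by (simp add: add_ac)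
next
  case (step2 i)
  then show ?case using assms[of "z + of_int (i - 1)"] by simp
qed simp

lemma periodic_exp_cong:
  fixes f :: "complex \<Rightarrow> 'a"
  assumes "\<And>z. f (z + 1) = f z"
    and "exp (2 * of_real pi * \<i> * a) = exp (2 * of_real pi * \<i> * b)"
  shows "f a = f b"
proof -
  obtain n :: int where "2 * of_real pi * \<i> * a = 2 * of_real pi * \<i> * b + of_int (2 * n) * pi * \<i>"
    using assms(2) unfolding exp_eq by blast
  then have "2 * of_real pi * \<i> * a = 2 * of_real pi * \<i> * (b + of_int n)"
    by (simp add: algebra_simps)
  then have "a = b + of_int n" by simp
  then show ?thesis using periodic_int[of f, OF assms(1)] by simp
qed

text \<open>
  A continuous function of period 1 is a continuous function on the unit circle; at a negative
  number, where the principal logarithm jumps, a shifted branch is used instead.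
\<close>

lemma periodic_on_circle:
  fixes f :: "complex \<Rightarrow> complex"
  assumes cont: "continuous_on UNIV f" and per: "\<And>z. f (z + 1) = f z"
  obtains g where "continuous_on (sphere 0 1) g"
    "\<And>z. g (exp (2 * of_real pi * \<i> * z)) = f z"
proof
  define g where "g w = f (Ln w / (2 * of_real pi * \<i>))" for w
  show gf: "g (exp (2 * of_real pi * \<i> * z)) = f z" for z
    unfolding g_def by (rule periodic_exp_cong[of f, OF per]) simp
  have g2: "g w = f (Ln (- w) / (2 * of_real pi * \<i>) + 1/2)" if "w \<noteq> 0" for w
    unfolding g_def
  proof (rule periodic_exp_cong[of f, OF per])
    have "exp (2 * of_real pi * \<i> * (Ln (- w) / (2 * of_real pi * \<i>) + 1/2))
        = exp (Ln (- w)) * exp (of_real pi * \<i>)"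
      by (simp add: distrib_left exp_add)
    then show "exp (2 * of_real pi * \<i> * (Ln w / (2 * of_real pi * \<i>)))
      = exp (2 * of_real pi * \<i> * (Ln (- w) / (2 * of_real pi * \<i>) + 1/2))"
      using that by simp
  qed
  have isf: "isCont f z" for z
    using cont by (simp add: continuous_on_eq_continuous_at)
  have "isCont g w" if "w \<noteq> 0" for w
  proof (cases "w \<in> \<real>\<^sub>\<le>\<^sub>0")
    case False
    then show ?thesis
      unfolding g_def by (intro continuous_intros isCont_o2[OF _ isf]) auto
  next
    case True
    with that have "- w \<notin> \<real>\<^sub>\<le>\<^sub>0" by (auto elim!: nonpos_Reals_cases)
    then have "isCont (\<lambda>w. f (Ln (- w) / (2 * of_real pi * \<i>) + 1/2)) w"
      by (intro continuous_intros isCont_o2[OF _ isf]) auto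
    moreover have "eventually (\<lambda>w. g w = f (Ln (- w) / (2 * of_real pi * \<i>) + 1/2)) (nhds w)"
      using t1_space_nhds[OF that] by eventually_elim (rule g2)
    ultimately show ?thesis by (simp add: isCont_cong)
  qed
  moreover have "w \<noteq> 0" if "w \<in> sphere 0 1" for w :: complex
    using that by auto
  ultimately show "continuous_on (sphere 0 1) g"
    by (intro continuous_at_imp_continuous_on ballI) blast
qed

lemma trig_poly_Re_Im:
  "trig_poly (\<lambda>x. of_real (Re (exp (2 * of_real pi * \<i> * of_real x))))"
  "trig_poly (\<lambda>x. of_real (Im (exp (2 * of_real pi * \<i> * of_real x))))"
proof -
  have m: "trig_poly (\<lambda>x. c * exp (2 * of_real pi * \<i> * of_real x)
      + d * exp (- (2 * of_real pi * \<i> * of_real x)))" for c d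
    using trig_poly_add[OF trig_poly_monom[of c 1] trig_poly_monom[of d "-1"]] by simp
  have e: "exp (2 * of_real pi * \<i> * of_real x) = cis (2 * pi * x)"
    "exp (- (2 * of_real pi * \<i> * of_real x)) = cis (- (2 * pi * x))" for x :: real
    by (simp_all add: cis_conv_exp mult_ac)
  have "(\<lambda>x. complex_of_real (Re (exp (2 * of_real pi * \<i> * of_real x))))
      = (\<lambda>x. 1/2 * exp (2 * of_real pi * \<i> * of_real x)
          + 1/2 * exp (- (2 * of_real pi * \<i> * of_real x)))"
    unfolding e by (simp add: fun_eq_iff complex_eq_iff)
  with m[of "1/2" "1/2"] show "trig_poly (\<lambda>x. of_real (Re (exp (2 * of_real pi * \<i> * of_real x))))"
    by simp
  have "(\<lambda>x. complex_of_real (Im (exp (2 * of_real pi * \<i> * of_real x))))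
      = (\<lambda>x. - \<i>/2 * exp (2 * of_real pi * \<i> * of_real x)
          + \<i>/2 * exp (- (2 * of_real pi * \<i> * of_real x)))"
    unfolding e by (simp add: fun_eq_iff complex_eq_iff)
  with m[of "-\<i>/2" "\<i>/2"] show "trig_poly (\<lambda>x. of_real (Im (exp (2 * of_real pi * \<i> * of_real x))))"
    by simp
qed

text \<open>
  Stone--Weierstrass on the unit circle, whose points are separated by their real and imaginary
  parts.  The approximated function is real-valued; complex functions are treated componentwise.
\<close>

lemma trig_poly_dense:
  fixes u :: "complex \<Rightarrow> real"
  assumes "continuous_on (sphere 0 1) u" "e > 0"
  shows "\<exists>p. trig_poly (\<lambda>x. of_real (p (exp (2 * of_real pi * \<i> * of_real x))))
      \<and> (\<forall>w\<in>sphere 0 1. \<bar>u w - p w\<bar> < e)"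
proof -
  define P where "P p \<longleftrightarrow> continuous_on (sphere 0 1) p
    \<and> trig_poly (\<lambda>x. of_real (p (exp (2 * of_real pi * \<i> * of_real x))))" for p :: "complex \<Rightarrow> real"
  have "\<exists>p. P p \<and> (\<forall>w\<in>sphere 0 1. \<bar>u w - p w\<bar> < e)"
  proof (rule Stone_Weierstrass_HOL[of "sphere 0 1" P u e])
    show "compact (sphere (0::complex) 1)" by simp
    show "P (\<lambda>x. c)" for c by (simp add: P_def trig_poly_const)
    show "P (\<lambda>x. p x + r x)" "P (\<lambda>x. p x * r x)" if "P p \<and> P r" for p r
      using that by (auto simp: P_def intro!: continuous_intros trig_poly_add trig_poly_mult)
    show "\<exists>p. P p \<and> p x \<noteq> p y" if "x \<in> sphere 0 1 \<and> y \<in> sphere 0 1 \<and> x \<noteq> y" for x y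
    proof -
      have "P Re" "P Im"
        by (auto simp: P_def trig_poly_Re_Im intro!: continuous_intros)
      moreover have "Re x \<noteq> Re y \<or> Im x \<noteq> Im y" using that by (auto simp: complex_eq_iff)
      ultimately show ?thesis by blast
    qed
  qed (use assms in \<open>auto simp: P_def\<close>)
  then show ?thesis by (auto simp: P_def)
qed

text \<open>
  If the Fourier coefficients vanish, then \<open>f\<close> is orthogonal to every trigonometric polynomial,
  hence, by density, to itself.
\<close>

lemma entire_periodic_eq_0:
  fixes f :: "complex \<Rightarrow> complex"
  assumes hol: "f holomorphic_on UNIV" and per: "\<And>z. f (z + 1) = f z"
    and coeff: "\<And>k::int. integral {0..1} (\<lambda>x. f (of_real x)
        * exp (2 * of_real pi * \<i> * of_int k * of_real x)) = 0"
  shows "f z = 0"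
proof -
  have cont: "continuous_on UNIV f" by (rule holomorphic_on_imp_continuous_on[OF hol])
  define u where "u x = f (of_real x)" for x :: real
  have cu: "continuous_on S u" for S
    unfolding u_def by (intro continuous_on_compose2[OF cont] continuous_intros) auto
  have orth: "integral {0..1} (\<lambda>x. u x * p x) = 0 \<and> continuous_on {0..1} p" if "trig_poly p" for p
    using that
  proof (induction rule: trig_poly.induct)
    case (trig_poly_monom c k)
    have "integral {0..1} (\<lambda>x. c * (f (of_real x)
        * exp (2 * of_real pi * \<i> * of_int k * of_real x))) = 0"
      by (simp only: integral_mult_right coeff mult_zero_right)
    then show ?case
      by (auto simp: u_def mult_ac intro!: continuous_intros)
  next
    case (trig_poly_add p r)
    have "integral {0..1} (\<lambda>x. u x * p x + u x * r x) =
        integral {0..1} (\<lambda>x. u x * p x) + integral {0..1} (\<lambda>x. u x * r x)"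
      by (rule Henstock_Kurzweil_Integration.integral_add)
         (use trig_poly_add in \<open>auto intro!: integrable_continuous_real continuous_intros cu\<close>)
    then show ?case
      using trig_poly_add by (auto simp: distrib_left intro!: continuous_intros)
  qed
  obtain g where cg: "continuous_on (sphere 0 1) g"
    and g: "\<And>z. g (exp (2 * of_real pi * \<i> * z)) = f z"
    using periodic_on_circle[of f] cont per by blast
  obtain B where B: "\<And>x. x \<in> {0..1} \<Longrightarrow> norm (u x) \<le> B"
    using compact_continuous_image[OF cu[of "{0..1}"]] by (metis bounded_iff compact_Icc compact_imp_bounded imageI)
  have B0: "B \<ge> 0" using B[of 0] by (simp add: order_trans[OF norm_ge_zero])
  define I where "I = integral {0..1} (\<lambda>x. u x * cnj (u x))"
  have bound: "norm I \<le> B * (2 * e)" if "e > 0" for e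
  proof -
    have "continuous_on (sphere 0 1) (\<lambda>w. Re (g w))" "continuous_on (sphere 0 1) (\<lambda>w. Im (g w))"
      using cg by (auto intro!: continuous_intros)
    from trig_poly_dense[OF this(1) that] trig_poly_dense[OF this(2) that]
    obtain p r where
      p: "trig_poly (\<lambda>x. of_real (p (exp (2 * of_real pi * \<i> * of_real x))))"
        "\<forall>w\<in>sphere 0 1. \<bar>Re (g w) - p w\<bar> < e" and
      r: "trig_poly (\<lambda>x. of_real (r (exp (2 * of_real pi * \<i> * of_real x))))"
        "\<forall>w\<in>sphere 0 1. \<bar>Im (g w) - r w\<bar> < e"
      by blast
    define s where "s x = complex_of_real (p (exp (2 * of_real pi * \<i> * of_real x)))
        + (- \<i>) * of_real (r (exp (2 * of_real pi * \<i> * of_real x)))" for x :: real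
    have "trig_poly s"
      unfolding s_def by (intro trig_poly_add trig_poly_mult trig_poly_const p r)
    note s = orth[OF this]
    have close: "norm (cnj (u x) - s x) \<le> 2 * e" for x
    proof -
      let ?w = "exp (2 * of_real pi * \<i> * of_real x)"
      have "?w \<in> sphere 0 1" by simp
      with p r have *: "\<bar>Re (g ?w) - p ?w\<bar> < e" "\<bar>Im (g ?w) - r ?w\<bar> < e" by blast+
      have "g ?w = u x" by (simp add: g u_def)
      with * have *: "\<bar>Re (u x) - p ?w\<bar> < e" "\<bar>Im (u x) - r ?w\<bar> < e" by simp_all
      have "norm (cnj (u x) - s x) \<le> \<bar>Re (cnj (u x) - s x)\<bar> + \<bar>Im (cnj (u x) - s x)\<bar>"
        by (rule cmod_le)
      also have "\<dots> = \<bar>Re (u x) - p ?w\<bar> + \<bar>Im (u x) - r ?w\<bar>"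
        by (simp add: s_def abs_minus_commute)
      finally show ?thesis using * by linarith
    qed
    have i1: "(\<lambda>x. u x * cnj (u x)) integrable_on {0..1}"
      by (intro integrable_continuous_real continuous_intros cu)
    have i2: "(\<lambda>x. u x * s x) integrable_on {0..1}"
      using s by (intro integrable_continuous_real continuous_intros cu) auto
    have "I = integral {0..1} (\<lambda>x. u x * cnj (u x) - u x * s x)"
      using s by (simp add: I_def Henstock_Kurzweil_Integration.integral_diff[OF i1 i2])
    also have "\<dots> = integral {0..1} (\<lambda>x. u x * (cnj (u x) - s x))"
      by (simp add: right_diff_distrib)
    finally have "norm I \<le> B * (2 * e) * (1 - 0)"
      using s B close B0
      by (simp only:) (intro integral_bound;
           auto intro!: continuous_intros cu mult_mono simp: norm_mult simp del: complex_cnj_diff)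
    then show ?thesis by simp
  qed
  have "I = 0"
  proof (rule ccontr)
    assume "I \<noteq> 0"
    then have pos: "norm I > 0" by simp
    have "norm I \<le> B * (2 * (norm I / (4 * (B + 1))))"
      using B0 pos by (intro bound) auto
    also have "\<dots> = norm I * (B / (2 * (B + 1)))" using B0 by (simp add: field_simps)
    also have "\<dots> < norm I * 1" using B0 pos by (intro mult_strict_left_mono) (auto simp: field_simps)
    finally show False by simp
  qed
  have cn: "continuous_on {0..1} (\<lambda>x. (norm (u x))\<^sup>2)"
    by (intro continuous_intros cu)
  have "I = integral {0..1} (\<lambda>x. of_real ((norm (u x))\<^sup>2))"
    unfolding I_def complex_norm_square ..
  also have "\<dots> = of_real (integral {0..1} (\<lambda>x. (norm (u x))\<^sup>2))"
    using integral_linear[OF integrable_continuous_real[OF cn] bounded_linear_of_real[where 'a = complex]]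
    by (simp add: o_def)
  finally have "integral {0..1} (\<lambda>x. (norm (u x))\<^sup>2) = 0"
    using \<open>I = 0\<close> by simp
  then have zero: "u x = 0" if "x \<in> {0..1}" for x
    using integral_cbox_eq_0_iff[of 0 1 "\<lambda>x. (norm (u x))\<^sup>2"] cn that by auto
  show "f z = 0"
  proof (rule analytic_continuation[OF hol, where U = "of_real ` {0..1::real}" and \<xi> = 0])
    show "(0::complex) islimpt of_real ` {0..1::real}"
      unfolding islimpt_approachable
    proof (intro allI impI)
      fix e :: real assume "e > 0"
      then show "\<exists>x'\<in>complex_of_real ` {0..1}. x' \<noteq> 0 \<and> dist x' 0 < e"
        by (intro bexI[of _ "of_real (min 1 (e/2))"]) auto
    qed
  qed (use zero in \<open>auto simp: u_def\<close>)
qed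

text \<open>
  The integral of an entire function of period 1 over a horizontal unit segment does not depend on
  the segment: its derivative with respect to the starting point is the difference of the end values.
\<close>

lemma integral_entire_periodic_shift:
  fixes h :: "complex \<Rightarrow> complex"
  assumes hol: "h holomorphic_on UNIV" and per: "\<And>z. h (z + 1) = h z"
  shows "integral {0..1} (\<lambda>x. h (of_real x + s)) = integral {0..1} (\<lambda>x. h (of_real x))"
proof -
  obtain H where H: "\<And>z. (H has_field_derivative h z) (at z)"
    using holomorphic_convex_primitive'[of UNIV h] hol by auto
  have int: "integral {0..1} (\<lambda>x. h (of_real x + s)) = H (1 + s) - H s" for s
  proof -
    have "((\<lambda>x. h (of_real x + s)) has_integral (H (of_real 1 + s) - H (of_real 0 + s))) {0..1}"
    proof (rule fundamental_theorem_of_calculus)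
      show "((\<lambda>x. H (of_real x + s)) has_vector_derivative h (of_real x + s)) (at x within {0..1})"
        for x :: real
      proof -
        have "((\<lambda>w. H (w + s)) has_field_derivative h (of_real x + s) * 1) (at (of_real x))"
          by (rule DERIV_chain2[OF H]) (auto intro!: derivative_eq_intros)
        then have "((\<lambda>w. H (w + s)) has_field_derivative h (of_real x + s)) (at (of_real x))"
          by simp
        from has_vector_derivative_real_field[OF this] show ?thesis
          by (rule has_vector_derivative_at_within)
      qed
    qed simp
    then show ?thesis by (simp add: integral_unique)
  qed
  have "((\<lambda>s. H (1 + s) - H s) has_field_derivative h (1 + s) * 1 - h s) (at s)" for s
    by (intro DERIV_diff DERIV_chain2[OF H] H) (auto intro!: derivative_eq_intros)
  moreover have "h (1 + s) = h s" for s
    using per[of s] by (simp only: add.commute)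
  ultimately have "((\<lambda>s. H (1 + s) - H s) has_field_derivative 0) (at s)" for s
    by simp
  then obtain c where c: "\<And>s. H (1 + s) - H s = c"
    using has_field_derivative_zero_constant[of UNIV "\<lambda>s. H (1 + s) - H s"] by auto
  show ?thesis
    using int[of s] int[of 0] c[of s] c[of 0] by simp
qed

text \<open>
  Shifting the segment of integration by \<open>\<tau>\<close> turns the quasi-periodicity into a recursion that
  determines all Fourier coefficients from the one of index 0.
\<close>

lemma quasi_periodic_eq_0:
  fixes f :: "complex \<Rightarrow> complex"
  assumes hol: "f holomorphic_on UNIV" and per: "\<And>z. f (z + 1) = f z"
    and qper: "\<And>z. f (z + \<tau>) = exp (- of_real pi * \<i> * (\<tau> + 2 * z)) * f z"
    and zero: "integral {0..1} (\<lambda>x. f (of_real x)) = 0"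
  shows "f z = 0"
proof (rule entire_periodic_eq_0[OF hol per])
  define a where "a k = integral {0..1} (\<lambda>x. f (of_real x)
        * exp (2 * of_real pi * \<i> * of_int k * of_real x))" for k :: int
  have rec: "a (k - 1) * exp (- of_real pi * \<i> * \<tau> + 2 * of_real pi * \<i> * of_int k * \<tau>) = a k" for k
  proof -
    define h where "h z = f z * exp (2 * of_real pi * \<i> * of_int k * z)" for z
    have 1: "h holomorphic_on UNIV"
      unfolding h_def by (intro holomorphic_intros hol)
    have 2: "h (z + 1) = h z" for z
      unfolding h_def per
      by (subst exp_eqI[where n = k]) (auto simp: algebra_simps)
    have 3: "h (of_real x + \<tau>)
      = (f (of_real x) * exp (2 * of_real pi * \<i> * of_int (k - 1) * of_real x))
        * exp (- of_real pi * \<i> * \<tau> + 2 * of_real pi * \<i> * of_int k * \<tau>)" for x :: real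
      unfolding h_def qper
      by (simp add: algebra_simps exp_add exp_diff exp_minus field_simps)
    have "a k = integral {0..1} (\<lambda>x. h (of_real x))" by (simp add: a_def h_def)
    also have "\<dots> = integral {0..1} (\<lambda>x. h (of_real x + \<tau>))"
      by (rule integral_entire_periodic_shift[OF 1 2, symmetric])
    also have "\<dots> = a (k - 1) * exp (- of_real pi * \<i> * \<tau> + 2 * of_real pi * \<i> * of_int k * \<tau>)"
      by (simp only: 3 a_def integral_mult_left)
    finally show ?thesis ..
  qed
  have "a k = 0" for k
  proof (induction k rule: int_induct[where k = 0])
    case base
    show ?case using zero by (simp add: a_def)
  next
    case (step1 i)
    then show ?case using rec[of "i + 1"] by simp
  next
    case (step2 i)
    then show ?case using rec[of i] by simp
  qed
  then show "integral {0..1} (\<lambda>x. f (of_real x)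
        * exp (2 * of_real pi * \<i> * of_int k * of_real x)) = 0" for k :: int
    by (simp add: a_def)
qed

text \<open>
  The space of functions with these quasi-periods has dimension one.  The mean of \<open>jtheta \<tau>\<close> does
  not vanish, since otherwise \<open>jtheta \<tau>\<close> itself would vanish identically; a suitable multiple can
  be subtracted from \<open>f\<close> to make the mean zero.
\<close>

lemma quasi_periodic_eq_jtheta:
  assumes tau: "Im \<tau> > 0" and nz: "jtheta \<tau> 0 \<noteq> 0"
    and hol: "f holomorphic_on UNIV" and per: "\<And>z. f (z + 1) = f z"
    and qper: "\<And>z. f (z + \<tau>) = exp (- of_real pi * \<i> * (\<tau> + 2 * z)) * f z"
  shows "f z = f 0 / jtheta \<tau> 0 * jtheta \<tau> z"
proof -
  define I where "I h = integral {0..1} (\<lambda>x. h (of_real x))" for h :: "complex \<Rightarrow> complex"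
  have int: "(\<lambda>x. h (of_real x)) integrable_on {0..1::real}" if "h holomorphic_on UNIV" for h
    by (intro integrable_continuous_real continuous_on_compose2[OF holomorphic_on_imp_continuous_on[OF that]]
        continuous_intros) auto
  have "I (jtheta \<tau>) \<noteq> 0"
    using quasi_periodic_eq_0[OF jtheta_holomorphic[OF tau] jtheta_add_1 jtheta_add_period] nz
    unfolding I_def by blast
  define c where "c = I f / I (jtheta \<tau>)"
  define D where "D z = f z - c * jtheta \<tau> z" for z
  have "I D = I f - c * I (jtheta \<tau>)"
    unfolding I_def D_def
    by (subst Henstock_Kurzweil_Integration.integral_diff)
       (auto intro!: int[OF hol] integrable_on_mult_right int[OF jtheta_holomorphic[OF tau]])
  also have "\<dots> = 0" using \<open>I (jtheta \<tau>) \<noteq> 0\<close> by (simp add: c_def)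
  finally have "I D = 0" .
  have "D z = 0" for z
  proof (rule quasi_periodic_eq_0[of D \<tau>])
    show "D holomorphic_on UNIV"
      unfolding D_def by (intro holomorphic_intros hol jtheta_holomorphic tau)
    show "D (z + 1) = D z" for z by (simp add: D_def per jtheta_add_1)
    show "D (z + \<tau>) = exp (- of_real pi * \<i> * (\<tau> + 2 * z)) * D z" for z
      unfolding D_def qper jtheta_add_period by (simp add: right_diff_distrib)
    show "integral {0..1} (\<lambda>x. D (of_real x)) = 0"
      using \<open>I D = 0\<close> by (simp add: I_def)
  qed
  then have "f z = c * jtheta \<tau> z" "f 0 = c * jtheta \<tau> 0" by (simp_all add: D_def)
  then show ?thesis using nz by simp
qed

section \<open>The Jacobi triple product\<close>

definition qpoch :: "complex \<Rightarrow> nat \<Rightarrow> complex" where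
  "qpoch \<tau> n = (\<Prod>k<n. 1 - qpow \<tau> 1 ^ Suc k)"

lemma norm_qpow_1: "norm (qpow \<tau> 1) = exp (- (2 * pi * Im \<tau>))"
  by (simp add: qpow_def)

lemma norm_qpow_less: "Im \<tau> > 0 \<Longrightarrow> norm (qpow \<tau> 1) < 1"
  by (simp add: norm_qpow_1)

lemma qpow_power: "qpow \<tau> 1 ^ n = exp (2 * of_real pi * \<i> * \<tau> * of_nat n)"
  by (simp add: qpow_def mult_ac flip: exp_of_nat_mult)

lemma qpow_factor_nz: "Im \<tau> > 0 \<Longrightarrow> 1 - qpow \<tau> 1 ^ Suc n \<noteq> 0"
proof
  assume tau: "Im \<tau> > 0" and "1 - qpow \<tau> 1 ^ Suc n = 0"
  then have "norm (qpow \<tau> 1 ^ Suc n) = 1" by simp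
  moreover have "norm (qpow \<tau> 1 ^ Suc n) < 1"
    using norm_qpow_less[OF tau] by (simp only: norm_power) (rule power_less_one_iff[THEN iffD2], auto)
  ultimately show False by simp
qed

lemma qpoch_nz: "Im \<tau> > 0 \<Longrightarrow> qpoch \<tau> n \<noteq> 0"
  unfolding qpoch_def using qpow_factor_nz by (auto simp del: power_Suc)

lemma qpoch_Suc: "qpoch \<tau> (Suc n) = qpoch \<tau> n * (1 - qpow \<tau> 1 ^ Suc n)"
  by (simp add: qpoch_def)

lemma qpoch_0: "qpoch \<tau> 0 = 1" by (simp add: qpoch_def)

lemma convergent_prod_geometric:
  assumes "Im \<tau> > 0"
  shows "convergent_prod (\<lambda>n. 1 + c * qpow \<tau> 1 ^ n)"
proof -
  have "summable (\<lambda>n. norm c * norm (qpow \<tau> 1) ^ n)"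
    using norm_qpow_less[OF assms] by (intro summable_mult summable_geometric) auto
  then have "summable (\<lambda>n. norm ((1 + c * qpow \<tau> 1 ^ n) - 1))"
    by (simp add: norm_mult norm_power)
  then show ?thesis
    by (simp add: abs_convergent_prod_imp_convergent_prod summable_imp_abs_convergent_prod)
qed

lemma convergent_prod_euler:
  assumes "Im \<tau> > 0"
  shows "convergent_prod (\<lambda>n. 1 - qpow \<tau> 1 ^ Suc n)"
  using convergent_prod_geometric[OF assms, of "- qpow \<tau> 1"] by simp

definition euler_prod :: "complex \<Rightarrow> complex" where
  "euler_prod \<tau> = (\<Prod>n. 1 - qpow \<tau> 1 ^ Suc n)"

lemma euler_prod_nz: "Im \<tau> > 0 \<Longrightarrow> euler_prod \<tau> \<noteq> 0"
  unfolding euler_prod_def using prodinf_nonzero[OF convergent_prod_euler] qpow_factor_nz by blast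

lemma LIMSEQ_prodinf:
  fixes f :: "nat \<Rightarrow> complex"
  assumes "convergent_prod f"
  shows "(\<lambda>n. \<Prod>k<n. f k) \<longlonglongrightarrow> prodinf f"
proof -
  have "(\<lambda>n. \<Prod>k<Suc n. f k) \<longlonglongrightarrow> prodinf f"
    using convergent_prod_LIMSEQ[OF assms] by (simp only: lessThan_Suc_atMost)
  then show ?thesis by (rule LIMSEQ_imp_Suc)
qed

lemma qpoch_LIMSEQ: "Im \<tau> > 0 \<Longrightarrow> qpoch \<tau> \<longlonglongrightarrow> euler_prod \<tau>"
  using LIMSEQ_prodinf[OF convergent_prod_euler] by (simp add: qpoch_def[abs_def] euler_prod_def)

text \<open>
  The \<open>q\<close>-binomial theorem.  The coefficients are written as quotients of finite products, because
  in this form their limit is visible.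
\<close>

lemma q_binomial:
  assumes "Im \<tau> > 0"
  shows "(\<Prod>k<M. 1 + exp (2 * of_real pi * \<i> * (v + of_nat k * \<tau>)))
    = (\<Sum>j\<le>M. exp (of_real pi * \<i> * (\<tau> * (of_nat j ^ 2 - of_nat j) + 2 * of_nat j * v))
        * qpoch \<tau> M / (qpoch \<tau> j * qpoch \<tau> (M - j)))"
proof (induction M)
  case 0
  show ?case by (simp add: qpoch_0)
next
  case (Suc M)
  define E where "E j = exp (of_real pi * \<i> * (\<tau> * (of_nat j ^ 2 - of_nat j) + 2 * of_nat j * v))"
    for j :: nat
  define P where "P = qpoch \<tau>"
  define q where "q = qpow \<tau> 1"
  define y where "y = exp (2 * of_real pi * \<i> * (v + of_nat M * \<tau>))"
  have nz: "P j \<noteq> 0" for j by (simp add: P_def qpoch_nz assms)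
  have PS: "P (Suc j) = P j * (1 - q ^ Suc j)" for j by (simp add: P_def q_def qpoch_Suc)
  have nzf: "1 - q ^ Suc j \<noteq> 0" for j unfolding q_def by (rule qpow_factor_nz[OF assms])
  have ES: "E j * y = E (Suc j) * q ^ (M - j)" if "j \<le> M" for j
    using that unfolding E_def y_def q_def qpow_power exp_add[symmetric]
    by (intro arg_cong[where f = exp]) (simp add: of_nat_diff algebra_simps power2_eq_square)
  \<comment> \<open>the \<open>q\<close>-analogue of Pascal's rule\<close>
  have pascal: "P (Suc M) / (P (Suc j) * P (M - j))
     = P M / (P (Suc j) * P (M - Suc j)) + q ^ (M - j) * (P M / (P j * P (M - j)))" if "j < M" for j
  proof -
    obtain i where M: "M = Suc (j + i)" using \<open>j < M\<close> by (auto dest: less_imp_Suc_add)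
    have Mj: "M - j = Suc i" "M - Suc j = i" using M by auto
    have q: "q ^ Suc M = q ^ Suc j * q ^ Suc i" by (simp add: M power_add)
    have frac: "x / (p * b * r) + c * (x / (p * (r * a))) = x * (a + c * b) / (p * b * (r * a))"
      if "p \<noteq> 0" "r \<noteq> 0" "a \<noteq> 0" "b \<noteq> 0" for x p r a b c :: complex
      using that by (simp add: field_simps)
    have "P M / (P (Suc j) * P i) + q ^ Suc i * (P M / (P j * P (Suc i)))
       = P M * ((1 - q ^ Suc i) + q ^ Suc i * (1 - q ^ Suc j)) / (P (Suc j) * P (Suc i))"
      unfolding PS by (rule frac[OF nz nz nzf nzf])
    also have "(1 - q ^ Suc i) + q ^ Suc i * (1 - q ^ Suc j) = 1 - q ^ Suc M"
      unfolding q by (simp add: algebra_simps)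
    finally show ?thesis unfolding Mj PS[of M] by simp
  qed
  have "(\<Sum>j\<le>Suc M. E j * P (Suc M) / (P j * P (Suc M - j)))
      = E 0 * P (Suc M) / (P 0 * P (Suc M)) + (\<Sum>j\<le>M. E (Suc j) * P (Suc M) / (P (Suc j) * P (M - j)))"
    by (subst sum.atMost_Suc_shift) simp
  also have "(\<Sum>j\<le>M. E (Suc j) * P (Suc M) / (P (Suc j) * P (M - j)))
      = (\<Sum>j<M. E (Suc j) * (P (Suc M) / (P (Suc j) * P (M - j)))) + E (Suc M)"
    using nz[of "Suc M"] by (simp add: lessThan_Suc_atMost[symmetric] P_def qpoch_0)
  also have "(\<Sum>j<M. E (Suc j) * (P (Suc M) / (P (Suc j) * P (M - j))))
      = (\<Sum>j<M. E (Suc j) * P M / (P (Suc j) * P (M - Suc j)))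
        + (\<Sum>j<M. y * (E j * P M / (P j * P (M - j))))"
    unfolding sum.distrib[symmetric]
  proof (rule sum.cong[OF refl])
    fix j assume "j \<in> {..<M}"
    then have j: "j < M" "j \<le> M" by auto
    have "E (Suc j) * (q ^ (M - j) * (P M / (P j * P (M - j)))) = y * (E j * P M / (P j * P (M - j)))"
      using ES[OF j(2)] by (simp add: mult_ac)
    then show "E (Suc j) * (P (Suc M) / (P (Suc j) * P (M - j)))
      = E (Suc j) * P M / (P (Suc j) * P (M - Suc j)) + y * (E j * P M / (P j * P (M - j)))"
      unfolding pascal[OF j(1)] by (simp add: distrib_left)
  qed
  also have "(\<Sum>j<M. E (Suc j) * P M / (P (Suc j) * P (M - Suc j)))
      = (\<Sum>j\<le>M. E j * P M / (P j * P (M - j))) - E 0 * P M / (P 0 * P M)"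
  proof -
    have "(\<Sum>j\<le>M. E j * P M / (P j * P (M - j))) = (\<Sum>j<Suc M. E j * P M / (P j * P (M - j)))"
      by (simp add: lessThan_Suc_atMost)
    also have "\<dots> = E 0 * P M / (P 0 * P M) + (\<Sum>j<M. E (Suc j) * P M / (P (Suc j) * P (M - Suc j)))"
      by (subst sum.lessThan_Suc_shift) simp
    finally show ?thesis by simp
  qed
  also have "(\<Sum>j<M. y * (E j * P M / (P j * P (M - j))))
      = y * (\<Sum>j\<le>M. E j * P M / (P j * P (M - j))) - E (Suc M)"
    using ES[of M] nz[of M]
    by (simp add: sum_distrib_left lessThan_Suc_atMost[symmetric] distrib_left
        P_def qpoch_0 mult.commute)
  finally have "(\<Sum>j\<le>Suc M. E j * P (Suc M) / (P j * P (Suc M - j)))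
      = (1 + y) * (\<Sum>j\<le>M. E j * P M / (P j * P (M - j)))"
    using nz[of M] nz[of "Suc M"] nz[of 0] by (simp add: algebra_simps)
  then show ?case
    using Suc.IH unfolding E_def P_def y_def by simp
qed

text \<open>
  Substituting \<open>v = z - n\<tau> + \<tau>/2\<close> and \<open>M = 2n\<close> makes the \<open>q\<close>-binomial theorem symmetric: half of
  the factors have negative powers of \<open>q\<close>, and reversing those turns them into the second family.
\<close>

lemma finite_jacobi_triple:
  assumes "Im \<tau> > 0"
  shows "(\<Prod>k<n. (1 + exp (2 * of_real pi * \<i> * (z + (of_nat k + 1/2) * \<tau>)))
               * (1 + exp (2 * of_real pi * \<i> * (- z + (of_nat k + 1/2) * \<tau>))))
    = (\<Sum>l\<in>{- int n..int n}. jterm \<tau> z l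
         * (qpoch \<tau> (2 * n) / (qpoch \<tau> (nat (int n + l)) * qpoch \<tau> (nat (int n - l)))))"
proof -
  define F where "F w = 1 + exp (2 * of_real pi * \<i> * w)" for w
  define v where "v = z - of_nat n * \<tau> + \<tau> / 2"
  have neg: "(\<Prod>k<n. F (z - (of_nat k + 1/2) * \<tau>))
     = exp (of_real pi * \<i> * (2 * of_nat n * z - (of_nat n)\<^sup>2 * \<tau>))
       * (\<Prod>k<n. F (- z + (of_nat k + 1/2) * \<tau>))"
  proof (induction n)
    case (Suc n)
    have "F (z - (of_nat n + 1/2) * \<tau>)
        = exp (2 * of_real pi * \<i> * (z - (of_nat n + 1/2) * \<tau>)) * F (- z + (of_nat n + 1/2) * \<tau>)"
      unfolding F_def by (simp add: distrib_left flip: exp_add) (simp add: algebra_simps)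
    moreover have "exp (of_real pi * \<i> * (2 * of_nat (Suc n) * z - (of_nat (Suc n))\<^sup>2 * \<tau>))
       = exp (of_real pi * \<i> * (2 * of_nat n * z - (of_nat n)\<^sup>2 * \<tau>))
         * exp (2 * of_real pi * \<i> * (z - (of_nat n + 1/2) * \<tau>))"
      unfolding exp_add[symmetric]
      by (intro arg_cong[where f = exp]) (simp add: algebra_simps power2_eq_square)
    ultimately show ?case using Suc by (simp only: prod.lessThan_Suc mult_ac)
  qed simp
  have "(\<Prod>k<2 * n. F (v + of_nat k * \<tau>))
      = (\<Prod>k<n. F (v + of_nat k * \<tau>)) * (\<Prod>k<n. F (v + of_nat (n + k) * \<tau>))"
  proof -
    have "(\<Prod>k<2 * n. G k) = (\<Prod>k<n. G k) * (\<Prod>k<n. G (n + k))" for G :: "nat \<Rightarrow> complex"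
      using prod.atLeastLessThan_concat[of 0 n "2 * n" G] prod.shift_bounds_nat_ivl[of G 0 n n]
      by (simp add: lessThan_atLeast0 mult_2 add.commute)
    then show ?thesis .
  qed
  also have "(\<Prod>k<n. F (v + of_nat k * \<tau>)) = (\<Prod>k<n. F (z - (of_nat k + 1/2) * \<tau>))"
    by (rule prod.reindex_bij_witness[of _ "\<lambda>k. n - Suc k" "\<lambda>k. n - Suc k"])
       (auto simp: v_def of_nat_diff algebra_simps)
  also have "(\<Prod>k<n. F (v + of_nat (n + k) * \<tau>)) = (\<Prod>k<n. F (z + (of_nat k + 1/2) * \<tau>))"
    by (simp add: v_def algebra_simps)
  finally have prod: "(\<Prod>k<2 * n. F (v + of_nat k * \<tau>))
     = exp (of_real pi * \<i> * (2 * of_nat n * z - (of_nat n)\<^sup>2 * \<tau>))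
       * (\<Prod>k<n. F (z + (of_nat k + 1/2) * \<tau>) * F (- z + (of_nat k + 1/2) * \<tau>))"
    unfolding neg by (simp add: prod.distrib mult_ac)
  have "(\<Prod>k<2 * n. F (v + of_nat k * \<tau>))
    = (\<Sum>j\<le>2 * n. exp (of_real pi * \<i> * (\<tau> * (of_nat j ^ 2 - of_nat j) + 2 * of_nat j * v))
        * qpoch \<tau> (2 * n) / (qpoch \<tau> j * qpoch \<tau> (2 * n - j)))"
    unfolding F_def by (rule q_binomial[OF assms])
  also have "\<dots> = (\<Sum>l\<in>{- int n..int n}.
      exp (of_real pi * \<i> * (2 * of_nat n * z - (of_nat n)\<^sup>2 * \<tau>)) * (jterm \<tau> z l
         * (qpoch \<tau> (2 * n) / (qpoch \<tau> (nat (int n + l)) * qpoch \<tau> (nat (int n - l))))))"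
  proof (rule sum.reindex_bij_witness[of _ "\<lambda>l. nat (int n + l)" "\<lambda>j. int j - int n"])
    fix j assume j: "j \<in> {..2 * n}"
    have e: "exp (of_real pi * \<i> * (2 * of_nat n * z - (of_nat n)\<^sup>2 * \<tau>)) * jterm \<tau> z (int j - int n)
      = exp (of_real pi * \<i> * (\<tau> * (of_nat j ^ 2 - of_nat j) + 2 * of_nat j * v))"
      unfolding jterm_def exp_add[symmetric] v_def
      by (intro arg_cong[where f = exp]) (simp add: algebra_simps power2_eq_square)
    have "nat (int n + (int j - int n)) = j" "nat (int n - (int j - int n)) = 2 * n - j"
      using j by auto
    then show "exp (of_real pi * \<i> * (2 * of_nat n * z - (of_nat n)\<^sup>2 * \<tau>)) * (jterm \<tau> z (int j - int n)
         * (qpoch \<tau> (2 * n) / (qpoch \<tau> (nat (int n + (int j - int n))) * qpoch \<tau> (nat (int n - (int j - int n))))))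
      = exp (of_real pi * \<i> * (\<tau> * (of_nat j ^ 2 - of_nat j) + 2 * of_nat j * v))
        * qpoch \<tau> (2 * n) / (qpoch \<tau> j * qpoch \<tau> (2 * n - j))"
      unfolding e[symmetric] by simp
  qed auto
  finally show ?thesis
    unfolding prod sum_distrib_left[symmetric] by (simp add: F_def)
qed

text \<open>
  The limit of the finite version: the quotients of finite products converge to the inverse of
  \<open>euler_prod \<tau>\<close> and are bounded uniformly, so Tannery's theorem applies.
\<close>

theorem jacobi_triple_product:
  assumes tau: "Im \<tau> > 0"
  shows "jtheta \<tau> z = euler_prod \<tau>
    * (\<Prod>k. 1 + exp (2 * of_real pi * \<i> * (z + (of_nat k + 1/2) * \<tau>)))
    * (\<Prod>k. 1 + exp (2 * of_real pi * \<i> * (- z + (of_nat k + 1/2) * \<tau>)))"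
proof -
  define P where "P = qpoch \<tau>"
  define r where "r n l = (if \<bar>l\<bar> \<le> int n
     then P (2 * n) / (P (nat (int n + l)) * P (nat (int n - l))) else 0)" for n l
  \<comment> \<open>the integers are enumerated by \<open>int_decode\<close>; the finite sum is extended by zero\<close>
  define a where "a k n = jterm \<tau> z (int_decode k) * r n (int_decode k)" for k n
  have lim: "P \<longlonglongrightarrow> euler_prod \<tau>" unfolding P_def by (rule qpoch_LIMSEQ[OF tau])
  have nz: "euler_prod \<tau> \<noteq> 0" by (rule euler_prod_nz[OF tau])
  obtain B1 where B1: "\<And>n. norm (P n) \<le> B1"
    using convergent_imp_Bseq[OF convergentI[OF lim]] by (auto simp: Bseq_def)
  have "(\<lambda>n. inverse (P n)) \<longlonglongrightarrow> inverse (euler_prod \<tau>)" using lim nz by (rule tendsto_inverse)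
  then obtain B2 where B2: "\<And>n. norm (inverse (P n)) \<le> B2"
    using convergent_imp_Bseq[OF convergentI] by (force simp: Bseq_def)
  have B0: "B1 \<ge> 0" "B2 \<ge> 0" using B1[of 0] B2[of 0] norm_ge_zero order_trans by blast+
  have rb: "norm (r n l) \<le> B1 * (B2 * B2)" for n l
  proof (cases "\<bar>l\<bar> \<le> int n")
    case True
    then have "norm (r n l) = norm (P (2 * n)) * (norm (inverse (P (nat (int n + l))))
        * norm (inverse (P (nat (int n - l)))))"
      by (simp add: r_def divide_inverse norm_mult)
    also have "\<dots> \<le> B1 * (B2 * B2)" by (intro mult_mono B1 B2 mult_nonneg_nonneg norm_ge_zero B0)
    finally show ?thesis .
  qed (use B0 in \<open>auto simp: r_def\<close>)
  have rlim: "(\<lambda>n. r n l) \<longlonglongrightarrow> inverse (euler_prod \<tau>)" for l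
  proof -
    have f1: "filterlim (\<lambda>n. 2 * n) at_top (at_top :: nat filter)"
      by (intro filterlim_subseq) (auto simp: strict_mono_def)
    have f2: "filterlim (\<lambda>n. nat (int n + i)) at_top at_top" for i
    proof (rule filterlim_at_top_mono)
      show "filterlim (\<lambda>n. n - nat \<bar>i\<bar>) at_top at_top" by (rule filterlim_minus_const_nat_at_top)
    qed (auto intro!: always_eventually)
    have "(\<lambda>n. P (2 * n) / (P (nat (int n + l)) * P (nat (int n + (- l)))))
       \<longlonglongrightarrow> euler_prod \<tau> / (euler_prod \<tau> * euler_prod \<tau>)"
      by (intro tendsto_intros filterlim_compose[OF lim] f1 f2) (use nz in auto)
    moreover have "euler_prod \<tau> / (euler_prod \<tau> * euler_prod \<tau>) = inverse (euler_prod \<tau>)"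
      using nz by (simp add: field_simps)
    moreover have "eventually (\<lambda>n. P (2 * n) / (P (nat (int n + l)) * P (nat (int n + (- l)))) = r n l) at_top"
      using eventually_ge_at_top[of "nat \<bar>l\<bar>"] by eventually_elim (auto simp: r_def)
    ultimately show ?thesis using Lim_transform_eventually by fastforce
  qed
  have js: "(\<lambda>k. norm (jterm \<tau> z (int_decode k))) summable_on UNIV"
    using jterm_abs_summable[OF tau, of z]
    by (subst (asm) summable_on_reindex_bij_betw[OF bij_int_decode, symmetric]) simp
  have M: "summable (\<lambda>k. norm (jterm \<tau> z (int_decode k)) * (B1 * (B2 * B2)))"
    by (intro summable_mult2 summable_on_imp_summable js)
  have "(\<lambda>n. suminf (\<lambda>k. a k n)) \<longlonglongrightarrow> (\<Sum>k. jterm \<tau> z (int_decode k) * inverse (euler_prod \<tau>))"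
  proof (rule tannerys_theorem[THEN conjunct2, THEN conjunct2, OF _ _ M])
    show "(\<lambda>n. a k n) \<longlonglongrightarrow> jterm \<tau> z (int_decode k) * inverse (euler_prod \<tau>)" for k
      unfolding a_def by (intro tendsto_intros rlim)
    show "\<forall>\<^sub>F (k, n) in at_top \<times>\<^sub>F sequentially.
        norm (a k n) \<le> norm (jterm \<tau> z (int_decode k)) * (B1 * (B2 * B2))"
      by (intro always_eventually) (auto simp: a_def norm_mult intro!: mult_left_mono rb)
  qed simp
  moreover have "(\<Sum>k. jterm \<tau> z (int_decode k) * inverse (euler_prod \<tau>)) = jtheta \<tau> z * inverse (euler_prod \<tau>)"
  proof -
    have "(jterm \<tau> z \<circ> int_decode has_sum jtheta \<tau> z) UNIV"
      using jtheta_has_sum[OF tau, of z] has_sum_reindex_bij_betw[OF bij_int_decode, of "jterm \<tau> z"]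
      by (simp add: o_def)
    then have "(\<lambda>k. jterm \<tau> z (int_decode k)) sums jtheta \<tau> z"
      by (simp add: has_sum_imp_sums o_def)
    from sums_unique[OF sums_mult2[OF this]] show ?thesis by simp
  qed
  moreover have "suminf (\<lambda>k. a k n) = (\<Prod>k<n. 1 + exp (2 * of_real pi * \<i> * (z + (of_nat k + 1/2) * \<tau>)))
      * (\<Prod>k<n. 1 + exp (2 * of_real pi * \<i> * (- z + (of_nat k + 1/2) * \<tau>)))" for n
  proof -
    have "suminf (\<lambda>k. a k n) = (\<Sum>k\<in>int_encode ` {- int n..int n}. a k n)"
    proof (rule suminf_finite)
      fix k assume "k \<notin> int_encode ` {- int n..int n}"
      then have "int_decode k \<notin> {- int n..int n}" by (metis image_eqI int_decode_inverse)
      then show "a k n = 0" by (auto simp: a_def r_def)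
    qed simp
    also have "\<dots> = (\<Sum>l\<in>{- int n..int n}. jterm \<tau> z l * r n l)"
      by (subst sum.reindex) (auto simp: a_def inj_on_def int_encode_eq)
    also have "\<dots> = (\<Sum>l\<in>{- int n..int n}. jterm \<tau> z l
         * (qpoch \<tau> (2 * n) / (qpoch \<tau> (nat (int n + l)) * qpoch \<tau> (nat (int n - l)))))"
      by (intro sum.cong refl) (auto simp: r_def P_def)
    finally show ?thesis
      unfolding finite_jacobi_triple[OF tau, symmetric] by (simp only: prod.distrib)
  qed
  ultimately have 1: "(\<lambda>n. (\<Prod>k<n. 1 + exp (2 * of_real pi * \<i> * (z + (of_nat k + 1/2) * \<tau>)))
      * (\<Prod>k<n. 1 + exp (2 * of_real pi * \<i> * (- z + (of_nat k + 1/2) * \<tau>))))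
      \<longlonglongrightarrow> jtheta \<tau> z * inverse (euler_prod \<tau>)" by simp
  have conv: "convergent_prod (\<lambda>k. 1 + exp (2 * of_real pi * \<i> * (w + (of_nat k + 1/2) * \<tau>)))" for w
  proof -
    have "exp (2 * of_real pi * \<i> * (w + (of_nat k + 1/2) * \<tau>))
      = exp (2 * of_real pi * \<i> * (w + \<tau> / 2)) * qpow \<tau> 1 ^ k" for k
      unfolding qpow_power exp_add[symmetric] by (simp add: algebra_simps)
    then show ?thesis using convergent_prod_geometric[OF tau] by simp
  qed
  from LIMSEQ_unique[OF 1 tendsto_mult[OF LIMSEQ_prodinf[OF conv] LIMSEQ_prodinf[OF conv]]]
  show ?thesis using nz by (simp add: field_simps)
qed

lemma jtheta_0_nz:
  assumes tau: "Im \<tau> > 0"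
  shows "jtheta \<tau> 0 \<noteq> 0"
proof -
  have nz: "1 + exp (2 * of_real pi * \<i> * (0 + (of_nat k + 1/2) * \<tau>)) \<noteq> 0" for k
  proof
    assume "1 + exp (2 * of_real pi * \<i> * (0 + (of_nat k + 1/2) * \<tau>)) = 0"
    then have "exp (2 * of_real pi * \<i> * (0 + (of_nat k + 1/2) * \<tau>)) = - 1"
      by (simp add: add_eq_0_iff)
    then have "norm (exp (2 * of_real pi * \<i> * (0 + (of_nat k + 1/2) * \<tau>))) = 1" by simp
    moreover have "norm (exp (2 * of_real pi * \<i> * (0 + (of_nat k + 1/2) * \<tau>)))
        = exp (- (2 * pi * ((real k + 1/2) * Im \<tau>)))"
      by simp
    ultimately show False using tau by simp
  qed
  have "convergent_prod (\<lambda>k. 1 + exp (2 * of_real pi * \<i> * (0 + (of_nat k + 1/2) * \<tau>)))"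
  proof -
    have "exp (2 * of_real pi * \<i> * (0 + (of_nat k + 1/2) * \<tau>))
      = exp (2 * of_real pi * \<i> * (\<tau> / 2)) * qpow \<tau> 1 ^ k" for k
      unfolding qpow_power exp_add[symmetric] by (simp add: algebra_simps)
    then show ?thesis using convergent_prod_geometric[OF tau] by simp
  qed
  from prodinf_nonzero[OF this nz] show ?thesis
    unfolding jacobi_triple_product[OF tau] using euler_prod_nz[OF tau] by simp
qed

section \<open>Inversion of the theta series\<close>

lemma infsum_int_residues:
  fixes f :: "int \<Rightarrow> complex"
  assumes f: "f summable_on UNIV" and m: "m > 0"
  shows "(\<Sum>\<^sub>\<infinity>n. f n) = (\<Sum>k\<in>{0..<m}. \<Sum>\<^sub>\<infinity>r. f (k + m * r))"
proof -
  have bij: "bij_betw (\<lambda>(k, r). k + m * r) ({0..<m} \<times> UNIV) UNIV"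
    by (rule bij_betwI[where g = "\<lambda>n. (n mod m, n div m)"]) (use m in auto)
  have "(\<lambda>(k, r). f (k + m * r)) summable_on ({0..<m} \<times> UNIV)"
    using summable_on_reindex_bij_betw[OF bij, of f] f by (simp add: case_prod_unfold)
  then have "(\<Sum>\<^sub>\<infinity>k\<in>{0..<m}. \<Sum>\<^sub>\<infinity>r. f (k + m * r))
      = (\<Sum>\<^sub>\<infinity>(k, r)\<in>{0..<m} \<times> UNIV. f (k + m * r))"
    by (rule infsum_Sigma'_banach)
  also have "\<dots> = (\<Sum>\<^sub>\<infinity>n. f n)"
    using infsum_reindex_bij_betw[OF bij, of f] by (simp add: case_prod_unfold)
  finally show ?thesis by simp
qed

lemma Im_inversion_pos: "Im \<tau> > 0 \<Longrightarrow> Im (- 1 / \<tau>) > 0"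
  by (simp add: Im_divide sum_power2_gt_zero_iff)

definition jfactor :: "complex \<Rightarrow> complex" where
  "jfactor \<tau> = jtheta (- 1 / \<tau>) 0 / jtheta \<tau> 0"

text \<open>
  The function \<open>z \<mapsto> exp (- \<pi>\<i>z\<^sup>2/\<tau>) jtheta (- 1/\<tau>) (z/\<tau>)\<close> has the same two quasi-periods as
  \<open>jtheta \<tau>\<close>: the inversion of \<open>\<tau>\<close> interchanges them, up to what the Gaussian factor repairs.
\<close>

theorem jtheta_inversion:
  assumes tau: "Im \<tau> > 0"
  shows "jtheta (- 1 / \<tau>) (z / \<tau>) = jfactor \<tau> * exp (of_real pi * \<i> * z\<^sup>2 / \<tau>) * jtheta \<tau> z"
proof -
  have nz: "\<tau> \<noteq> 0" using tau by auto
  define f where "f z = exp (- (of_real pi * \<i> * z\<^sup>2 / \<tau>)) * jtheta (- 1 / \<tau>) (z / \<tau>)" for z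
  have "f z = f 0 / jtheta \<tau> 0 * jtheta \<tau> z"
  proof (rule quasi_periodic_eq_jtheta[OF tau jtheta_0_nz[OF tau]])
    show "f holomorphic_on UNIV"
      unfolding f_def
      by (intro holomorphic_intros
          holomorphic_on_compose_gen[OF _ jtheta_holomorphic[OF Im_inversion_pos[OF tau]], unfolded o_def])
         (auto simp: nz)
    show "f (z + 1) = f z" for z
    proof -
      define s w where "s = - 1 / \<tau>" and "w = z / \<tau>"
      have w: "(z + 1) / \<tau> = w - s" by (simp add: w_def s_def add_divide_distrib)
      have "jtheta s w = jtheta s ((w - s) + s)" by simp
      also have "\<dots> = exp (- of_real pi * \<i> * (s + 2 * (w - s))) * jtheta s (w - s)"
        by (rule jtheta_add_period)
      finally have j: "jtheta s w = exp (- of_real pi * \<i> * (s + 2 * (w - s))) * jtheta s (w - s)" .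
      have e: "exp (- (of_real pi * \<i> * (z + 1)\<^sup>2 / \<tau>))
          = exp (- (of_real pi * \<i> * z\<^sup>2 / \<tau>)) * exp (- of_real pi * \<i> * (s + 2 * (w - s)))"
        unfolding exp_add[symmetric] s_def w_def
        by (intro arg_cong[where f = exp]) (use nz in \<open>simp add: field_simps power2_eq_square\<close>)
      show ?thesis
        unfolding f_def w e by (simp only: flip: s_def w_def) (simp add: j)
    qed
    show "f (z + \<tau>) = exp (- of_real pi * \<i> * (\<tau> + 2 * z)) * f z" for z
    proof -
      have "(z + \<tau>) / \<tau> = z / \<tau> + 1" using nz by (simp add: field_simps)
      moreover have "exp (- (of_real pi * \<i> * (z + \<tau>)\<^sup>2 / \<tau>))
          = exp (- of_real pi * \<i> * (\<tau> + 2 * z)) * exp (- (of_real pi * \<i> * z\<^sup>2 / \<tau>))"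
        unfolding exp_add[symmetric]
        by (intro arg_cong[where f = exp]) (use nz in \<open>simp add: field_simps power2_eq_square\<close>)
      ultimately show ?thesis by (simp add: f_def jtheta_add_1)
    qed
  qed
  then have "exp (- (of_real pi * \<i> * z\<^sup>2 / \<tau>)) * jtheta (- 1 / \<tau>) (z / \<tau>) = jfactor \<tau> * jtheta \<tau> z"
    by (simp add: f_def jfactor_def)
  then show ?thesis by (simp add: exp_minus field_simps)
qed

lemma sum_roots_of_unity:
  assumes M: "M > 0"
  shows "(\<Sum>j<M. exp (2 * of_real pi * \<i> * of_nat j * of_int k / of_nat M))
     = (if int M dvd k then of_nat M else (0::complex))"
proof -
  define w where "w = exp (2 * of_real pi * \<i> * of_int k / of_nat M)"
  have pow: "exp (2 * of_real pi * \<i> * of_nat j * of_int k / of_nat M) = w ^ j" for j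
    by (simp add: w_def mult_ac flip: exp_of_nat_mult)
  have wM: "w ^ M = 1"
    using M exp_2pi_int[of k] by (simp add: w_def flip: exp_of_nat_mult)
  have "w = 1 \<longleftrightarrow> int M dvd k"
  proof
    assume "w = 1"
    then obtain n :: int where "2 * of_real pi * \<i> * of_int k / of_nat M = of_int (2 * n) * of_real pi * \<i>"
      unfolding w_def exp_eq_1 by (auto simp: complex_eq_iff)
    then have "complex_of_int k = of_int (int M * n)" using M by (simp add: field_simps)
    then have "k = int M * n" by (simp only: of_int_eq_iff)
    then show "int M dvd k" by simp
  next
    assume "int M dvd k"
    then obtain n where "k = int M * n" ..
    then show "w = 1" using M exp_2pi_int[of n] by (simp add: w_def mult.assoc)
  qed
  then show ?thesis
    using wM by (simp add: pow geometric_sum[of w] sum_gp_strict)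
qed

text \<open>
  Both sides of the inversion formula are averaged over the \<open>M\<close>-torsion points \<open>z = j/M\<close>: on the
  right only the multiples of \<open>M\<close> survive, on the left the shifted lattices fit together to the
  lattice \<open>\<int>/M\<close>.
\<close>

lemma sum_jtheta_torsion:
  assumes tau: "Im \<tau> > 0" and M: "M > 0"
  shows "(\<Sum>j<M. jtheta \<tau> (of_nat j / of_nat M)) = of_nat M * jtheta (of_nat M ^ 2 * \<tau>) 0"
proof -
  define S where "S k = (\<Sum>\<^sub>\<infinity>r. jterm \<tau> 0 (k + int M * r))" for k
  have "jtheta \<tau> (of_nat j / of_nat M)
      = (\<Sum>k\<in>{0..<int M}. exp (2 * of_real pi * \<i> * of_nat j * of_int k / of_nat M) * S k)" for j
  proof -
    have "jterm \<tau> (of_nat j / of_nat M) (k + int M * r)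
       = exp (2 * of_real pi * \<i> * of_nat j * of_int k / of_nat M) * jterm \<tau> 0 (k + int M * r)" for k r
      unfolding jterm_def exp_add[symmetric]
      by (rule exp_eqI[where n = "int j * r"]) (use M in \<open>simp add: field_simps\<close>)
    then show ?thesis
      unfolding jtheta_def S_def
      using infsum_int_residues[OF jterm_summable[OF tau], of "int M" "of_nat j / of_nat M"] M
      by (simp only: infsum_cmult_right' of_nat_0_less_iff)
  qed
  then have "(\<Sum>j<M. jtheta \<tau> (of_nat j / of_nat M)) = (\<Sum>k\<in>{0..<int M}.
      (\<Sum>j<M. exp (2 * of_real pi * \<i> * of_nat j * of_int k / of_nat M)) * S k)"
    by (simp only: sum_distrib_right) (rule sum.swap)
  also have "\<dots> = (\<Sum>k\<in>{0..<int M}. if k = 0 then of_nat M * S 0 else 0)"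
    unfolding sum_roots_of_unity[OF M]
    by (intro sum.cong refl) (auto dest: zdvd_imp_le)
  also have "\<dots> = of_nat M * S 0" using M by simp
  also have "S 0 = jtheta (of_nat M ^ 2 * \<tau>) 0"
    unfolding S_def jtheta_def by (intro infsum_cong) (simp add: jterm_def power2_eq_square mult_ac)
  finally show ?thesis .
qed

lemma sum_jtheta_torsion_inverted:
  assumes tau: "Im \<tau> > 0" and M: "M > 0"
  shows "(\<Sum>j<M. exp (- (of_real pi * \<i> * (of_nat j / of_nat M)\<^sup>2 / \<tau>))
      * jtheta (- 1 / \<tau>) (of_nat j / of_nat M / \<tau>)) = jtheta (- 1 / (of_nat M ^ 2 * \<tau>)) 0"
proof -
  define s where "s = - 1 / (of_nat M ^ 2 * \<tau>)"
  have nz: "\<tau> \<noteq> 0" using tau by auto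
  have "Im (of_nat M ^ 2 * \<tau>) > 0" using tau M by (simp flip: of_nat_power)
  then have s: "Im s > 0" unfolding s_def by (rule Im_inversion_pos)
  have "jtheta s 0 = (\<Sum>j\<in>{0..<int M}. \<Sum>\<^sub>\<infinity>r. jterm s 0 (j + int M * r))"
    unfolding jtheta_def by (rule infsum_int_residues[OF jterm_summable[OF s]]) (use M in auto)
  also have "\<dots> = (\<Sum>j<M. \<Sum>\<^sub>\<infinity>r. jterm s 0 (int j + int M * r))"
    by (rule sum.reindex_bij_witness[of _ int nat]) auto
  also have "\<dots> = (\<Sum>j<M. exp (- (of_real pi * \<i> * (of_nat j / of_nat M)\<^sup>2 / \<tau>))
      * jtheta (- 1 / \<tau>) (of_nat j / of_nat M / \<tau>))"
  proof (rule sum.cong[OF refl])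
    fix j
    have "exp (- (of_real pi * \<i> * (of_nat j / of_nat M)\<^sup>2 / \<tau>))
        * jterm (- 1 / \<tau>) (- (of_nat j / of_nat M / \<tau>)) r = jterm s 0 (int j + int M * r)" for r
      unfolding jterm_def exp_add[symmetric] s_def
      by (intro arg_cong[where f = exp]) (use M nz in \<open>simp add: field_simps power2_eq_square\<close>)
    then show "(\<Sum>\<^sub>\<infinity>r. jterm s 0 (int j + int M * r))
      = exp (- (of_real pi * \<i> * (of_nat j / of_nat M)\<^sup>2 / \<tau>))
        * jtheta (- 1 / \<tau>) (of_nat j / of_nat M / \<tau>)"
      unfolding jtheta_minus[of _ "of_nat j / of_nat M / \<tau>", symmetric]
      unfolding jtheta_def infsum_cmult_right'[symmetric] by simp
  qed
  finally show ?thesis by (simp add: s_def)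
qed

lemma jfactor_scale:
  assumes tau: "Im \<tau> > 0" and M: "M > 0"
  shows "jfactor (of_nat M ^ 2 * \<tau>) = of_nat M * jfactor \<tau>"
proof -
  have "jtheta (- 1 / (of_nat M ^ 2 * \<tau>)) 0 = (\<Sum>j<M. jfactor \<tau> * jtheta \<tau> (of_nat j / of_nat M))"
    unfolding sum_jtheta_torsion_inverted[OF assms, symmetric] jtheta_inversion[OF tau]
    by (intro sum.cong refl) (simp add: exp_minus)
  also have "\<dots> = jfactor \<tau> * (of_nat M * jtheta (of_nat M ^ 2 * \<tau>) 0)"
    by (simp only: sum_distrib_left[symmetric] sum_jtheta_torsion[OF assms])
  finally show ?thesis
    using jtheta_0_nz[of "of_nat M ^ 2 * \<tau>"] tau M
    by (simp add: jfactor_def flip: of_nat_power)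
qed

text \<open>
  In the variable \<open>w = exp (\<pi>\<i>\<tau>)\<close> the series is a power series, with coefficients supported on the
  squares.
\<close>

lemma jtheta_0_holomorphic: "(\<lambda>\<tau>. jtheta \<tau> 0) holomorphic_on {\<tau>. Im \<tau> > 0}"
proof -
  define a :: "nat \<Rightarrow> complex" where "a k = (if k \<in> range (\<lambda>n. n ^ 2) then 1 else 0)" for k
  define G where "G w = (\<Sum>k. a k * w ^ k)" for w
  have sq: "((\<lambda>n. w ^ (n ^ 2)) has_sum G w) UNIV" if "norm w < 1" for w
  proof -
    have sm: "summable (\<lambda>k. norm (a k * w ^ k))"
    proof (rule summable_comparison_test'[where N = 0])
      show "summable (\<lambda>k. norm w ^ k)" using that by (simp add: summable_geometric)
    qed (auto simp: a_def norm_power)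
    then have "((\<lambda>k. a k * w ^ k) has_sum G w) UNIV"
      unfolding G_def by (rule norm_summable_imp_has_sum[OF _ summable_sums[OF summable_norm_cancel[OF sm]]])
    then have "((\<lambda>k. w ^ k) has_sum G w) (range (\<lambda>n. n ^ 2))"
      by (rule has_sum_cong_neutral[THEN iffD1, rotated -1]) (auto simp: a_def)
    then show ?thesis
      by (subst (asm) has_sum_reindex) (auto simp: inj_on_def o_def)
  qed
  have G: "G holomorphic_on ball 0 1"
  proof (rule power_series_holomorphic[of _ _ a])
    fix w :: complex assume "w \<in> ball 0 1"
    then have "summable (\<lambda>k. a k * w ^ k)"
      by (intro summable_comparison_test'[OF summable_geometric[of "norm w"], where N = 0])
         (auto simp: a_def norm_power)
    then show "(\<lambda>n. a n * (w - 0) ^ n) sums G w" by (simp add: G_def summable_sums)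
  qed
  define W where "W \<tau> = exp (of_real pi * \<i> * \<tau>)" for \<tau>
  have W: "norm (W \<tau>) < 1" if "Im \<tau> > 0" for \<tau>
    using that by (simp add: W_def)
  have eq: "jtheta \<tau> 0 = G (W \<tau>) + (G (W \<tau>) - 1)" if "Im \<tau> > 0" for \<tau>
  proof -
    have pw: "W \<tau> ^ (n ^ 2) = jterm \<tau> 0 (int n)" "W \<tau> ^ (n ^ 2) = jterm \<tau> 0 (- int n)" for n
      by (simp_all add: W_def jterm_def mult_ac flip: exp_of_nat_mult)
    have "(jterm \<tau> 0 has_sum G (W \<tau>) + (G (W \<tau>) - jterm \<tau> 0 0)) UNIV"
      by (rule has_sum_int_halves) (use sq[OF W[OF that]] in \<open>simp_all add: o_def flip: pw\<close>)
    from infsumI[OF this] have "jtheta \<tau> 0 = G (W \<tau>) + (G (W \<tau>) - jterm \<tau> 0 0)"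
      by (simp only: jtheta_def)
    then show ?thesis by (simp add: jterm_def)
  qed
  have "(\<lambda>\<tau>. G (W \<tau>)) holomorphic_on {\<tau>. Im \<tau> > 0}"
    by (rule holomorphic_on_compose_gen[OF _ G, unfolded o_def])
       (use W in \<open>auto simp: W_def[abs_def] intro!: holomorphic_intros\<close>)
  then have "(\<lambda>\<tau>. G (W \<tau>) + (G (W \<tau>) - 1)) holomorphic_on {\<tau>. Im \<tau> > 0}"
    by (intro holomorphic_intros)
  then show ?thesis
    by (rule holomorphic_transform) (simp add: eq)
qed

text \<open>
  The multiplier is determined by its scaling behaviour: \<open>jfactor \<tau>\<^sup>2/(- \<i>\<tau>)\<close> is holomorphic,
  invariant under \<open>\<tau> \<mapsto> r\<^sup>2\<tau>\<close> for rational \<open>r > 0\<close>, and equal to 1 at the fixed point \<open>\<i>\<close> of the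
  inversion.  The points \<open>r\<^sup>2\<i>\<close> accumulate at \<open>\<i>\<close>, so it is 1 everywhere.
\<close>

theorem jfactor_square:
  assumes tau: "Im \<tau> > 0"
  shows "(jfactor \<tau>)\<^sup>2 = - \<i> * \<tau>"
proof -
  define H where "H \<tau> = (jfactor \<tau>)\<^sup>2 / (- \<i> * \<tau>)" for \<tau>
  define U where "U = range (\<lambda>n. (of_nat (Suc (Suc n)) / of_nat (Suc n)) ^ 2 * \<i>)"
  have hol: "(\<lambda>\<tau>. H \<tau> - 1) holomorphic_on {\<tau>. Im \<tau> > 0}"
  proof -
    have "(\<lambda>\<tau>. jtheta (- 1 / \<tau>) 0) holomorphic_on {\<tau>. Im \<tau> > 0}"
      by (rule holomorphic_on_compose_gen[OF _ jtheta_0_holomorphic, unfolded o_def])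
         (auto intro!: holomorphic_intros dest: Im_inversion_pos)
    then show ?thesis
      unfolding H_def jfactor_def
      by (intro holomorphic_intros jtheta_0_holomorphic) (auto simp: jtheta_0_nz)
  qed
  have scale: "H (of_nat M ^ 2 * \<tau>) = H \<tau>" if "Im \<tau> > 0" "M > 0" for \<tau> M
    unfolding H_def jfactor_scale[OF that] using that by (simp add: power_mult_distrib)
  have "jfactor \<i> = 1"
    using jtheta_0_nz[of \<i>] by (simp add: jfactor_def)
  then have H1: "H \<i> = 1" by (simp add: H_def)
  have U: "H x = 1" "Im x > 0" if xU: "x \<in> U" for x
  proof -
    obtain n where x: "x = (of_nat (Suc (Suc n)) / of_nat (Suc n)) ^ 2 * \<i>"
      using xU unfolding U_def by blast
    have "x = of_real ((real (Suc (Suc n)) / real (Suc n)) ^ 2) * \<i>" by (simp add: x)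
    then have "Im x = (real (Suc (Suc n)) / real (Suc n)) ^ 2" by simp
    then show pos: "Im x > 0" by simp
    have "H x = H (of_nat (Suc n) ^ 2 * x)" using scale[OF pos, of "Suc n"] by simp
    also have "of_nat (Suc n) ^ 2 * x = of_nat (Suc (Suc n)) ^ 2 * \<i>"
      unfolding x power_divide by (simp del: of_nat_Suc)
    also have "H \<dots> = 1" using scale[of \<i> "Suc (Suc n)"] H1 by simp
    finally show "H x = 1" .
  qed
  have "H \<tau> - 1 = 0"
  proof (rule analytic_continuation[OF hol, where U = U and \<xi> = \<i>])
    show "open {\<tau>. Im \<tau> > 0}" by (rule open_halfspace_Im_gt)
    show "connected {\<tau>. Im \<tau> > 0}" by (intro convex_connected convex_halfspace_Im_gt)
    show "U \<subseteq> {\<tau>. Im \<tau> > 0}" using U by auto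
    have lim: "(\<lambda>n. (of_nat (Suc (Suc n)) / of_nat (Suc n)) ^ 2 * \<i>) \<longlonglongrightarrow> 1 ^ 2 * \<i>"
      by (intro tendsto_intros LIMSEQ_Suc_n_over_n[THEN LIMSEQ_Suc])
    have ne: "(of_nat (Suc (Suc n)) / of_nat (Suc n)) ^ 2 * \<i> \<noteq> \<i>" for n
    proof
      assume "(of_nat (Suc (Suc n)) / of_nat (Suc n)) ^ 2 * \<i> = \<i>"
      then have "of_nat (Suc (Suc n)) ^ 2 = (of_nat (Suc n) ^ 2 :: complex)"
        by (simp add: power_divide divide_eq_eq del: of_nat_Suc)
      then have "of_nat (Suc (Suc n) ^ 2) = (of_nat (Suc n ^ 2) :: complex)" by (simp only: of_nat_power)
      then have "Suc (Suc n) ^ 2 = Suc n ^ 2" by (simp only: of_nat_eq_iff)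
      then show False by (simp add: power2_eq_square)
    qed
    show "\<i> islimpt U"
      unfolding islimpt_sequential U_def using lim ne
      by (intro exI[of _ "\<lambda>n. (of_nat (Suc (Suc n)) / of_nat (Suc n)) ^ 2 * \<i>"]) auto
  qed (use U tau in auto)
  then have "(jfactor \<tau>)\<^sup>2 / (- \<i> * \<tau>) = 1" by (simp add: H_def)
  moreover have "- \<i> * \<tau> \<noteq> 0" using tau by auto
  ultimately show ?thesis by (simp only: divide_eq_1_iff)
qed

section \<open>Inversion of vartheta11 and of the square of eta\<close>

lemma exp_2pi_qpow:
  "exp (2 * of_real pi * \<i> * (z + of_nat n * \<tau>)) = exp (2 * of_real pi * \<i> * z) * qpow \<tau> 1 ^ n"
  by (simp add: qpow_power distrib_left exp_add mult_ac)

definition theta_prod :: "complex \<Rightarrow> complex \<Rightarrow> complex" where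
  "theta_prod \<tau> z = (\<Prod>n. (1 - exp (2 * of_real pi * \<i> * z) * qpow \<tau> 1 ^ n)
     * (1 - exp (- 2 * of_real pi * \<i> * z) * qpow \<tau> 1 ^ Suc n))"

lemma convergent_theta_prod:
  assumes "Im \<tau> > 0"
  shows "convergent_prod (\<lambda>n. 1 - c * qpow \<tau> 1 ^ n)"
    "convergent_prod (\<lambda>n. 1 - c * qpow \<tau> 1 ^ Suc n)"
    "convergent_prod (\<lambda>n. (1 - c * qpow \<tau> 1 ^ n) * (1 - d * qpow \<tau> 1 ^ Suc n))"
proof -
  show 1: "convergent_prod (\<lambda>n. 1 - c * qpow \<tau> 1 ^ n)" for c
    using convergent_prod_geometric[OF assms, of "- c"] by simp
  show 2: "convergent_prod (\<lambda>n. 1 - c * qpow \<tau> 1 ^ Suc n)" for c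
    using convergent_prod_geometric[OF assms, of "- c * qpow \<tau> 1"] by (simp add: mult_ac)
  show "convergent_prod (\<lambda>n. (1 - c * qpow \<tau> 1 ^ n) * (1 - d * qpow \<tau> 1 ^ Suc n))"
    by (intro convergent_prod_mult 1 2)
qed

lemma vartheta11_prod:
  assumes tau: "Im \<tau> > 0"
  shows "vartheta11_t \<tau> z t = exp (2 * of_real pi * \<i> * t) * qpow \<tau> (1/8)
     * exp (- of_real pi * \<i> * (z + 1/2)) * (euler_prod \<tau> * theta_prod \<tau> z)"
  unfolding vartheta11_t_def euler_prod_def theta_prod_def
    prodinf_mult[OF convergent_prod_euler[OF tau] convergent_theta_prod(3)[OF tau]]
  by (simp add: mult.assoc)

lemma vartheta11_jtheta:
  assumes tau: "Im \<tau> > 0"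
  shows "vartheta11_t \<tau> z t = exp (2 * of_real pi * \<i> * t)
    * exp (of_real pi * \<i> * (\<tau> / 4 - z - 1/2)) * jtheta \<tau> (1/2 + \<tau>/2 - z)"
proof -
  have half: "exp (2 * of_real pi * \<i> * (w + 1/2)) = - exp (2 * of_real pi * \<i> * w)" for w
    by (simp add: distrib_left exp_add)
  have 1: "exp (2 * of_real pi * \<i> * (- (1/2 + \<tau>/2 - z) + (of_nat k + 1/2) * \<tau>))
      = - (exp (2 * of_real pi * \<i> * z) * qpow \<tau> 1 ^ k)" for k
  proof -
    have "exp (2 * of_real pi * \<i> * (- (1/2 + \<tau>/2 - z) + (of_nat k + 1/2) * \<tau>))
      = exp (2 * of_real pi * \<i> * ((z + of_nat k * \<tau>) + 1/2))"
      by (rule exp_eqI[where n = "-1"]) (simp add: algebra_simps)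
    then show ?thesis by (simp only: half exp_2pi_qpow)
  qed
  have 2: "exp (2 * of_real pi * \<i> * ((1/2 + \<tau>/2 - z) + (of_nat k + 1/2) * \<tau>))
      = - (exp (- 2 * of_real pi * \<i> * z) * qpow \<tau> 1 ^ Suc k)" for k
  proof -
    have "exp (2 * of_real pi * \<i> * ((1/2 + \<tau>/2 - z) + (of_nat k + 1/2) * \<tau>))
      = exp (2 * of_real pi * \<i> * ((- z + of_nat (Suc k) * \<tau>) + 1/2))"
      by (intro arg_cong[where f = exp]) (simp add: algebra_simps)
    then show ?thesis by (simp only: half exp_2pi_qpow mult_minus_left mult_minus_right)
  qed
  have "jtheta \<tau> (1/2 + \<tau>/2 - z) = euler_prod \<tau>
     * (\<Prod>k. 1 - exp (- 2 * of_real pi * \<i> * z) * qpow \<tau> 1 ^ Suc k)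
     * (\<Prod>k. 1 - exp (2 * of_real pi * \<i> * z) * qpow \<tau> 1 ^ k)"
    unfolding jacobi_triple_product[OF tau] 1 2 by simp
  also have "\<dots> = euler_prod \<tau> * theta_prod \<tau> z"
    unfolding theta_prod_def
      prodinf_mult[OF convergent_theta_prod(1)[OF tau] convergent_theta_prod(2)[OF tau], symmetric]
    by (simp add: mult_ac)
  finally have j: "euler_prod \<tau> * theta_prod \<tau> z = jtheta \<tau> (1/2 + \<tau>/2 - z)" ..
  have "qpow \<tau> (1/8) * exp (- of_real pi * \<i> * (z + 1/2)) = exp (of_real pi * \<i> * (\<tau> / 4 - z - 1/2))"
    unfolding qpow_def exp_add[symmetric]
    by (intro arg_cong[where f = exp]) (simp add: algebra_simps)
  then show ?thesis unfolding vartheta11_prod[OF tau] j by (simp add: mult_ac)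
qed

lemma vartheta11_minus:
  assumes tau: "Im \<tau> > 0"
  shows "vartheta11_t \<tau> (- z) t = - vartheta11_t \<tau> z t"
proof -
  define w where "w = - (1/2 + \<tau>/2 + z)"
  have "jtheta \<tau> (1/2 + \<tau>/2 - z) = jtheta \<tau> ((w + \<tau>) + 1)"
    by (intro arg_cong[where f = "jtheta \<tau>"]) (simp add: w_def algebra_simps)
  also have "\<dots> = exp (- of_real pi * \<i> * (\<tau> + 2 * w)) * jtheta \<tau> w"
    by (simp only: jtheta_add_1 jtheta_add_period)
  also have "jtheta \<tau> w = jtheta \<tau> (1/2 + \<tau>/2 - (- z))"
    unfolding w_def jtheta_minus by simp
  finally have j: "jtheta \<tau> (1/2 + \<tau>/2 - z)
      = exp (- of_real pi * \<i> * (\<tau> + 2 * w)) * jtheta \<tau> (1/2 + \<tau>/2 - (- z))" .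
  have "exp (of_real pi * \<i> * (\<tau> / 4 - z - 1/2)) * exp (- of_real pi * \<i> * (\<tau> + 2 * w))
      = exp (of_real pi * \<i> * (\<tau> / 4 - (- z) - 1/2) + of_real pi * \<i>)"
    unfolding exp_add[symmetric] w_def
    by (intro arg_cong[where f = exp]) (simp add: algebra_simps)
  also have "\<dots> = - exp (of_real pi * \<i> * (\<tau> / 4 - (- z) - 1/2))"
    by (simp add: exp_add)
  finally have e: "exp (of_real pi * \<i> * (\<tau> / 4 - z - 1/2)) * exp (- of_real pi * \<i> * (\<tau> + 2 * w))
      = - exp (of_real pi * \<i> * (\<tau> / 4 - (- z) - 1/2))" .
  show ?thesis
    unfolding vartheta11_jtheta[OF tau] j
    unfolding mult.assoc[of "exp (2 * of_real pi * \<i> * t)"]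
      mult.assoc[of "exp (of_real pi * \<i> * (\<tau> / 4 - z - 1/2))", symmetric] e
    by simp
qed

text \<open>
  Multiplication by \<open>\<tau>\<close> takes the half period \<open>1/2 - 1/(2\<tau>)\<close> for the modulus \<open>- 1/\<tau>\<close> to
  \<open>\<tau>/2 - 1/2\<close>, which is the half period for \<open>\<tau>\<close> up to the period 1.
\<close>

lemma vartheta11_inversion:
  assumes tau: "Im \<tau> > 0"
  shows "vartheta11_t (- 1 / \<tau>) (z / \<tau>) t
    = - \<i> * jfactor \<tau> * exp (of_real pi * \<i> * z\<^sup>2 / \<tau>) * vartheta11_t \<tau> z t"
proof -
  have nz: "\<tau> \<noteq> 0" using tau by auto
  define y where "y = \<tau>/2 - 1/2 - z"
  have arg: "1/2 + (- 1 / \<tau>) / 2 - z / \<tau> = y / \<tau>"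
    using nz by (simp add: y_def field_simps)
  have per: "jtheta \<tau> y = jtheta \<tau> (1/2 + \<tau>/2 - z)"
    using jtheta_add_1[of \<tau> y] by (simp add: y_def algebra_simps)
  have "exp (of_real pi * \<i> * ((- 1 / \<tau>) / 4 - z / \<tau> - 1/2)) * exp (of_real pi * \<i> * y\<^sup>2 / \<tau>)
     = exp (- (of_real pi / 2 * \<i>) + (of_real pi * \<i> * z\<^sup>2 / \<tau> + of_real pi * \<i> * (\<tau> / 4 - z - 1/2)))"
    unfolding exp_add[symmetric] y_def
    by (intro arg_cong[where f = exp]) (use nz in \<open>simp add: field_simps power2_eq_square\<close>)
  also have "\<dots> = exp (- (of_real pi / 2 * \<i>))
      * (exp (of_real pi * \<i> * z\<^sup>2 / \<tau>) * exp (of_real pi * \<i> * (\<tau> / 4 - z - 1/2)))"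
    by (simp only: exp_add)
  also have "exp (- (of_real pi / 2 * \<i>)) = cis (- (pi / 2))"
    by (simp add: cis_conv_exp mult_ac)
  also have "\<dots> = - \<i>" by (simp add: complex_eq_iff)
  finally have e: "exp (of_real pi * \<i> * ((- 1 / \<tau>) / 4 - z / \<tau> - 1/2)) * exp (of_real pi * \<i> * y\<^sup>2 / \<tau>)
     = - \<i> * (exp (of_real pi * \<i> * z\<^sup>2 / \<tau>) * exp (of_real pi * \<i> * (\<tau> / 4 - z - 1/2)))" .
  have "vartheta11_t (- 1 / \<tau>) (z / \<tau>) t = exp (2 * of_real pi * \<i> * t)
     * (exp (of_real pi * \<i> * ((- 1 / \<tau>) / 4 - z / \<tau> - 1/2)) * exp (of_real pi * \<i> * y\<^sup>2 / \<tau>))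
     * jfactor \<tau> * jtheta \<tau> (1/2 + \<tau>/2 - z)"
    unfolding vartheta11_jtheta[OF Im_inversion_pos[OF tau]] arg jtheta_inversion[OF tau] per
    by (simp only: mult_ac)
  also have "\<dots> = - \<i> * jfactor \<tau> * exp (of_real pi * \<i> * z\<^sup>2 / \<tau>) * vartheta11_t \<tau> z t"
    unfolding e vartheta11_jtheta[OF tau] by (simp only: mult_ac)
  finally show ?thesis .
qed

lemma dedekind_eta_euler: "dedekind_eta \<tau> = qpow \<tau> (1/24) * euler_prod \<tau>"
  by (simp add: dedekind_eta_def euler_prod_def)

lemma dedekind_eta_nz: "Im \<tau> > 0 \<Longrightarrow> dedekind_eta \<tau> \<noteq> 0"
  by (simp add: dedekind_eta_euler euler_prod_nz qpow_def)

text \<open>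
  For the modulus \<open>3\<sigma>\<close> the three families of factors of \<open>vartheta11_t\<close> at \<open>z = \<sigma>\<close> are the
  factors of the eta product with \<open>n \<equiv> 0, 1, 2\<close> modulo 3.
\<close>

lemma eta_as_vartheta11_period:
  assumes tau: "Im \<sigma> > 0"
  shows "dedekind_eta \<sigma> = \<i> * qpow \<sigma> (1/6) * vartheta11_t (3 * \<sigma>) \<sigma> 0"
proof -
  have tau3: "Im (3 * \<sigma>) > 0" using tau by simp
  define q where "q = qpow \<sigma> 1"
  have q3: "qpow (3 * \<sigma>) 1 = q ^ 3"
    by (simp add: q_def qpow_power) (simp add: qpow_def mult_ac)
  have ex: "exp (2 * of_real pi * \<i> * \<sigma>) = q" "exp (- 2 * of_real pi * \<i> * \<sigma>) = inverse q"
    by (simp_all add: q_def qpow_def exp_minus)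
  have qnz: "q \<noteq> 0" by (simp add: q_def qpow_def)
  define f where "f n = (1 - q ^ (3 * n + 3)) * (1 - q ^ (3 * n + 1)) * (1 - q ^ (3 * n + 2))" for n
  have fac: "(1 - qpow (3 * \<sigma>) 1 ^ Suc n) * ((1 - exp (2 * of_real pi * \<i> * \<sigma>) * qpow (3 * \<sigma>) 1 ^ n)
     * (1 - exp (- 2 * of_real pi * \<i> * \<sigma>) * qpow (3 * \<sigma>) 1 ^ Suc n)) = f n" for n
  proof -
    have pm: "(q ^ 3) ^ k = q ^ (3 * k)" for k by (simp add: power_mult)
    have S: "3 * Suc n = Suc (3 * n + 2)" "3 * n + 3 = Suc (3 * n + 2)" by simp_all
    have "q * (q ^ 3) ^ n = q ^ (3 * n + 1)" "(q ^ 3) ^ Suc n = q ^ (3 * n + 3)"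
      "inverse q * (q ^ 3) ^ Suc n = q ^ (3 * n + 2)"
      unfolding pm S using qnz by simp_all
    then show ?thesis unfolding q3 ex f_def by simp
  qed
  have "convergent_prod f"
    using convergent_prod_mult[OF convergent_prod_euler[OF tau3] convergent_theta_prod(3)[OF tau3,
        of "exp (2 * of_real pi * \<i> * \<sigma>)" "exp (- 2 * of_real pi * \<i> * \<sigma>)"]]
    by (simp only: fac)
  then have lim: "(\<lambda>N. \<Prod>n<N. f n) \<longlonglongrightarrow> prodinf f" by (rule LIMSEQ_prodinf)
  have "(\<Prod>n<N. f n) = qpoch \<sigma> (3 * N)" for N
  proof (induction N)
    case (Suc N)
    have "3 * Suc N = Suc (Suc (Suc (3 * N)))" by simp
    then show ?case using Suc
      by (simp only: qpoch_Suc prod.lessThan_Suc) (simp add: f_def q_def mult_ac eval_nat_numeral)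
  qed (simp add: qpoch_0)
  moreover have "(\<lambda>N. qpoch \<sigma> (3 * N)) \<longlonglongrightarrow> euler_prod \<sigma>"
    by (rule filterlim_compose[OF qpoch_LIMSEQ[OF tau]])
       (intro filterlim_subseq, auto simp: strict_mono_def)
  ultimately have "prodinf f = euler_prod \<sigma>" using LIMSEQ_unique[OF lim] by simp
  then have "euler_prod (3 * \<sigma>) * theta_prod (3 * \<sigma>) \<sigma> = euler_prod \<sigma>"
    unfolding euler_prod_def[of "3 * \<sigma>"] theta_prod_def
      prodinf_mult[OF convergent_prod_euler[OF tau3] convergent_theta_prod(3)[OF tau3]] fac .
  then have v: "vartheta11_t (3 * \<sigma>) \<sigma> 0
     = qpow (3 * \<sigma>) (1/8) * exp (- of_real pi * \<i> * (\<sigma> + 1/2)) * euler_prod \<sigma>"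
    by (simp add: vartheta11_prod[OF tau3])
  have "exp (of_real pi / 2 * \<i>) = cis (pi / 2)"
    by (simp add: cis_conv_exp mult_ac)
  then have "\<i> = exp (of_real pi / 2 * \<i>)" by simp
  then have "\<i> * qpow \<sigma> (1/6) * (qpow (3 * \<sigma>) (1/8) * exp (- of_real pi * \<i> * (\<sigma> + 1/2)))
     = exp (of_real pi / 2 * \<i>) * qpow \<sigma> (1/6) * (qpow (3 * \<sigma>) (1/8) * exp (- of_real pi * \<i> * (\<sigma> + 1/2)))"
    by (simp only:)
  also have "\<dots> = qpow \<sigma> (1/24)"
    unfolding qpow_def exp_add[symmetric]
    by (intro arg_cong[where f = exp]) (simp add: field_simps)
  finally show ?thesis unfolding v dedekind_eta_euler by (simp add: mult_ac)
qed

text \<open>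
  At a 3-torsion point of the modulus \<open>\<tau>/3\<close> the factors combine by
  \<open>(1 - x) (1 - \<omega>x) (1 - \<omega>\<^sup>2x) = 1 - x\<^sup>3\<close>.
\<close>

lemma vartheta11_third_eq_eta:
  assumes tau: "Im \<tau> > 0"
  shows "vartheta11_t (\<tau> / 3) (- 1/3) 0 = sqrt 3 * dedekind_eta \<tau>"
proof -
  have tau3: "Im (\<tau> / 3) > 0" using tau by simp
  define p where "p = qpow (\<tau> / 3) 1"
  have p3: "p ^ 3 = qpow \<tau> 1"
    by (simp add: p_def qpow_power) (simp add: qpow_def mult_ac)
  define w w' where "w = exp (2 * of_real pi * \<i> * (- 1/3))" and "w' = exp (- 2 * of_real pi * \<i> * (- 1/3))"
  have "w = cis (- (2 * pi / 3))" "w' = cis (2 * pi / 3)"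
    by (simp_all add: w_def w'_def cis_conv_exp mult_ac)
  moreover have "cos (2 * pi / 3) = - 1/2" "sin (2 * pi / 3) = sqrt 3 / 2"
    using cos_120 sin_120 by (simp_all add: mult_ac)
  ultimately have ww: "w = Complex (- 1/2) (- sqrt 3 / 2)" "w' = Complex (- 1/2) (sqrt 3 / 2)"
    by (simp_all add: cis.code)
  have cube: "(1 - x) * (1 - w * x) * (1 - w' * x) = 1 - x ^ 3" for x
  proof -
    have s: "w + w' = - 1" "w * w' = 1" by (simp_all add: ww complex_eq_iff)
    have "(1 - x) * (1 - w * x) * (1 - w' * x) = (1 - x) * (1 - (w + w') * x + (w * w') * x\<^sup>2)"
      by (simp add: algebra_simps power2_eq_square)
    also have "\<dots> = 1 - x ^ 3" unfolding s by (simp add: algebra_simps power2_eq_square power3_eq_cube)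
    finally show ?thesis .
  qed
  define f where "f n = (1 - p ^ Suc n) * ((1 - w * p ^ n) * (1 - w' * p ^ Suc n))" for n
  have "convergent_prod f"
    unfolding f_def p_def
    by (rule convergent_prod_mult[OF convergent_prod_euler[OF tau3] convergent_theta_prod(3)[OF tau3]])
  then have lim: "(\<lambda>N. \<Prod>n<N. f n) \<longlonglongrightarrow> prodinf f" by (rule LIMSEQ_prodinf)
  have prodf: "(\<Prod>n<N. f n) * (1 - w * p ^ N) = (1 - w) * qpoch \<tau> N" for N
  proof (induction N)
    case (Suc N)
    have "(\<Prod>n<Suc N. f n) * (1 - w * p ^ Suc N)
      = ((\<Prod>n<N. f n) * (1 - w * p ^ N)) * ((1 - p ^ Suc N) * (1 - w * p ^ Suc N) * (1 - w' * p ^ Suc N))"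
      unfolding prod.lessThan_Suc f_def[of N] by (simp only: mult_ac)
    also have "\<dots> = (1 - w) * (qpoch \<tau> N * (1 - (p ^ 3) ^ Suc N))"
      unfolding Suc cube by (simp only: mult_ac power_mult[symmetric] mult.commute[of 3])
    finally show ?case by (simp only: p3 qpoch_Suc)
  qed (simp add: qpoch_0)
  have "(\<lambda>N. (\<Prod>n<N. f n) * (1 - w * p ^ N)) \<longlonglongrightarrow> prodinf f * (1 - w * 0)"
    by (intro tendsto_intros lim LIMSEQ_power_zero) (simp add: p_def norm_qpow_less[OF tau3])
  moreover have "(\<lambda>N. (1 - w) * qpoch \<tau> N) \<longlonglongrightarrow> (1 - w) * euler_prod \<tau>"
    by (intro tendsto_intros qpoch_LIMSEQ tau)
  ultimately have "prodinf f = (1 - w) * euler_prod \<tau>"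
    unfolding prodf using LIMSEQ_unique by fastforce
  then have "euler_prod (\<tau> / 3) * theta_prod (\<tau> / 3) (- 1/3) = (1 - w) * euler_prod \<tau>"
    unfolding euler_prod_def[of "\<tau> / 3"] theta_prod_def
      prodinf_mult[OF convergent_prod_euler[OF tau3] convergent_theta_prod(3)[OF tau3]]
      f_def p_def w_def w'_def .
  then have v: "vartheta11_t (\<tau> / 3) (- 1/3) 0
     = qpow (\<tau> / 3) (1/8) * (exp (- of_real pi * \<i> * (- 1/3 + 1/2)) * (1 - w)) * euler_prod \<tau>"
    by (simp add: vartheta11_prod[OF tau3])
  have "exp (- of_real pi * \<i> * (- 1/3 + 1/2)) = cis (- (pi / 6))"
    by (simp add: cis_conv_exp mult_ac)
  also have "\<dots> = Complex (sqrt 3 / 2) (- 1/2)"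
    by (simp add: cis.code cos_30 sin_30)
  finally have "exp (- of_real pi * \<i> * (- 1/3 + 1/2)) * (1 - w) = of_real (sqrt 3)"
    by (simp only: ww) (simp add: complex_eq_iff)
  moreover have "qpow (\<tau> / 3) (1/8) = qpow \<tau> (1/24)" by (simp add: qpow_def)
  ultimately show ?thesis unfolding v dedekind_eta_euler by (simp only: mult_ac)
qed

text \<open>
  Inverting \<open>vartheta11_t\<close> with modulus \<open>\<tau>/3\<close> connects the two preceding evaluations: it turns the
  point \<open>z = - 1/3\<close> into the period \<open>\<sigma> = - 1/\<tau>\<close> for the modulus \<open>3\<sigma>\<close>.  This gives
  \<open>dedekind_eta (- 1/\<tau>) = sqrt 3 * jfactor (\<tau>/3) * dedekind_eta \<tau>\<close>.
\<close>

theorem dedekind_eta_inversion_square: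
  assumes tau: "Im \<tau> > 0"
  shows "(dedekind_eta (- 1 / \<tau>))\<^sup>2 = - \<i> * \<tau> * (dedekind_eta \<tau>)\<^sup>2"
proof -
  have nz: "\<tau> \<noteq> 0" using tau by auto
  have tau3: "Im (\<tau> / 3) > 0" using tau by simp
  define s where "s = - 1 / \<tau>"
  have arg: "3 * s = - 1 / (\<tau> / 3)" "s = (- 1/3) / (\<tau> / 3)" by (simp_all add: s_def)
  have "dedekind_eta s = \<i> * qpow s (1/6) * vartheta11_t (- 1 / (\<tau> / 3)) ((- 1/3) / (\<tau> / 3)) 0"
    using eta_as_vartheta11_period[OF Im_inversion_pos[OF tau], folded s_def]
    unfolding arg(1) arg(2)[symmetric] .
  also have "\<dots> = qpow s (1/6) * exp (of_real pi * \<i> * (- 1/3)\<^sup>2 / (\<tau> / 3)) * jfactor (\<tau> / 3)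
      * (sqrt 3 * dedekind_eta \<tau>)"
    unfolding vartheta11_inversion[OF tau3] vartheta11_third_eq_eta[OF tau] by (simp only: minus_mult_left[symmetric] mult_minus_right mult_ac) simp
  also have "qpow s (1/6) * exp (of_real pi * \<i> * (- 1/3)\<^sup>2 / (\<tau> / 3)) = 1"
    unfolding qpow_def exp_add[symmetric] s_def
    by (simp add: field_simps power2_eq_square nz)
  finally have "(dedekind_eta s)\<^sup>2 = (jfactor (\<tau> / 3))\<^sup>2 * ((of_real (sqrt 3))\<^sup>2 * (dedekind_eta \<tau>)\<^sup>2)"
    by (simp add: power_mult_distrib)
  also have "(complex_of_real (sqrt 3))\<^sup>2 = 3"
    by (simp flip: of_real_power)
  finally show ?thesis unfolding jfactor_square[OF tau3] s_def by simp
qed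

section \<open>The denominator\<close>

lemma basis_nth [simp]:
  "Lambda0 $ 1 = 1" "Lambda0 $ 2 = 0" "Lambda0 $ 3 = 0" "Lambda0 $ 4 = 0"
  "alpha1 $ 1 = 0" "alpha1 $ 2 = 1" "alpha1 $ 3 = 0" "alpha1 $ 4 = 0"
  "alpha2 $ 1 = 0" "alpha2 $ 2 = 0" "alpha2 $ 3 = 1" "alpha2 $ 4 = 0"
  "delta $ 1 = 0" "delta $ 2 = 0" "delta $ 3 = 0" "delta $ 4 = 1"
  by (simp_all add: Lambda0_def alpha1_def alpha2_def delta_def vector_def)

lemma vector_4 [simp]:
  "(vector [x, y, z, w] :: 'a :: zero ^ 4) $ 1 = x"
  "(vector [x, y, z, w] :: 'a :: zero ^ 4) $ 2 = y"
  "(vector [x, y, z, w] :: 'a :: zero ^ 4) $ 3 = z"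
  "(vector [x, y, z, w] :: 'a :: zero ^ 4) $ 4 = w"
  by (simp_all add: vector_def)

lemma form_coord:
  "form u (coord \<tau> z1 z2 t)
    = 2 * of_real pi * \<i> * (u$1 * t - u$4 * \<tau> + (u$2 - u$3) * z1 + u$3 * z2)"
  by (simp add: form_def coord_def algebra_simps)

lemma prod_finite_pos_roots:
  "(\<Prod>\<alpha>\<in>finite_pos_roots. f \<alpha>) = f alpha1 * f alpha2 * f (alpha1 + alpha2) * f (2 *s alpha1 + alpha2)"
proof -
  have "distinct [alpha1, alpha2, alpha1 + alpha2, 2 *s alpha1 + alpha2]"
    by (simp add: vec_eq_iff forall_4)
  then show ?thesis
    by (simp add: finite_pos_roots_def mult_ac)
qed

lemma denom_eq_theta_prod:
  assumes tau: "Im \<tau> > 0"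
  shows "denom \<tau> z1 z2 t = qpow \<tau> (5/12) * exp (of_real pi * \<i> * (6 * t + z1 + 3 * z2))
    * ((euler_prod \<tau>)\<^sup>2 * (theta_prod \<tau> (- z1) * theta_prod \<tau> (z1 - z2) * theta_prod \<tau> (- z2)
        * theta_prod \<tau> (- (z1 + z2))))"
proof -
  have rho: "form rho rho / (2 * dual_coxeter) = 5/12"
    by (simp add: form_def rho_def dual_coxeter_def)
  have rho_h: "expw rho (coord \<tau> z1 z2 t) = exp (of_real pi * \<i> * (6 * t + z1 + 3 * z2))"
    unfolding expw_def form_coord
    by (intro arg_cong[where f = exp]) (simp add: rho_def algebra_simps)
  define g where "g z n = (1 - exp (2 * of_real pi * \<i> * z) * qpow \<tau> 1 ^ n)
     * (1 - exp (- 2 * of_real pi * \<i> * z) * qpow \<tau> 1 ^ Suc n)" for z n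
  have root: "(1 - qpow \<tau> 1 ^ n * expw (- \<alpha>) (coord \<tau> z1 z2 t))
      * (1 - qpow \<tau> 1 ^ Suc n * expw \<alpha> (coord \<tau> z1 z2 t)) = g z n"
    if "form \<alpha> (coord \<tau> z1 z2 t) = - 2 * of_real pi * \<i> * z" for \<alpha> z n
  proof -
    have "form (- \<alpha>) (coord \<tau> z1 z2 t) = - form \<alpha> (coord \<tau> z1 z2 t)"
      by (simp add: form_def)
    then show ?thesis by (simp add: expw_def g_def that mult.commute)
  qed
  have g: "g z has_prod theta_prod \<tau> z" for z
    unfolding g_def theta_prod_def by (rule convergent_prod_has_prod[OF convergent_theta_prod(3)[OF tau]])
  have "(\<lambda>n. (1 - qpow \<tau> 1 ^ Suc n)\<^sup>2 * (g (- z1) n * g (z1 - z2) n * g (- z2) n * g (- (z1 + z2)) n))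
    has_prod ((euler_prod \<tau>)\<^sup>2 * (theta_prod \<tau> (- z1) * theta_prod \<tau> (z1 - z2) * theta_prod \<tau> (- z2)
        * theta_prod \<tau> (- (z1 + z2))))"
    unfolding euler_prod_def
    by (intro has_prod_mult has_prod_power g convergent_prod_has_prod convergent_prod_euler tau)
  moreover have "(\<Prod>\<alpha>\<in>finite_pos_roots. (1 - qpow \<tau> 1 ^ n * expw (- \<alpha>) (coord \<tau> z1 z2 t))
      * (1 - qpow \<tau> 1 ^ Suc n * expw \<alpha> (coord \<tau> z1 z2 t)))
     = g (- z1) n * g (z1 - z2) n * g (- z2) n * g (- (z1 + z2)) n" for n
    unfolding prod_finite_pos_roots
    by (intro arg_cong2[where f = "(*)"] root) (simp_all add: form_coord algebra_simps)
  ultimately have "(\<Prod>n. (1 - qpow \<tau> 1 ^ Suc n)\<^sup>2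
      * (\<Prod>\<alpha>\<in>finite_pos_roots. (1 - qpow \<tau> 1 ^ n * expw (- \<alpha>) (coord \<tau> z1 z2 t))
          * (1 - qpow \<tau> 1 ^ Suc n * expw \<alpha> (coord \<tau> z1 z2 t))))
    = (euler_prod \<tau>)\<^sup>2 * (theta_prod \<tau> (- z1) * theta_prod \<tau> (z1 - z2) * theta_prod \<tau> (- z2)
        * theta_prod \<tau> (- (z1 + z2)))"
    by (simp only: has_prod_unique[symmetric])
  then show ?thesis
    unfolding denom_def Let_def rho rho_h by (simp only:)
qed

text \<open>The value of \<open>\<alpha>\<^sub>2\<close> is \<open>z2 - z1\<close>; the sign comes from the oddness of \<open>vartheta11_t\<close>.\<close>

lemma vartheta11_product_eq_denom:
  assumes tau: "Im \<tau> > 0"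
  shows "vartheta11_t \<tau> z1 t * vartheta11_t \<tau> z2 t * vartheta11_t \<tau> (z1 - z2) t * vartheta11_t \<tau> (z1 + z2) t
    = - ((eta_t \<tau> t)\<^sup>2 * denom \<tau> z1 z2 t)"
proof -
  define c where "c z = exp (2 * of_real pi * \<i> * t) * qpow \<tau> (1/8) * exp (- of_real pi * \<i> * (z + 1/2))" for z
  have "c (- z1) * c (- z2) * c (z1 - z2) * c (- (z1 + z2)) =
     (exp (of_real pi * \<i> * t) * qpow \<tau> (1/24))\<^sup>2
       * (qpow \<tau> (5/12) * exp (of_real pi * \<i> * (6 * t + z1 + 3 * z2)))"
    unfolding c_def qpow_def power2_eq_square exp_add[symmetric]
    by (rule exp_eqI[where n = "-1"]) (simp add: field_simps)
  then have c: "c (- z1) * c (- z2) * c (z1 - z2) * c (- (z1 + z2)) * euler_prod \<tau> ^ 4 =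
     (eta_t \<tau> t)\<^sup>2 * (qpow \<tau> (5/12) * exp (of_real pi * \<i> * (6 * t + z1 + 3 * z2))) * (euler_prod \<tau>)\<^sup>2"
    by (simp add: eta_t_def dedekind_eta_euler power_mult_distrib power4_eq_xxxx power2_eq_square mult_ac)
  have v: "vartheta11_t \<tau> z t = c z * (euler_prod \<tau> * theta_prod \<tau> z)" for z
    unfolding c_def by (rule vartheta11_prod[OF tau])
  have "vartheta11_t \<tau> z1 t * vartheta11_t \<tau> z2 t * vartheta11_t \<tau> (z1 - z2) t * vartheta11_t \<tau> (z1 + z2) t
    = - (vartheta11_t \<tau> (- z1) t * vartheta11_t \<tau> (- z2) t * vartheta11_t \<tau> (z1 - z2) t
        * vartheta11_t \<tau> (- (z1 + z2)) t)"
    unfolding vartheta11_minus[OF tau] by simp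
  also have "\<dots> = - (c (- z1) * c (- z2) * c (z1 - z2) * c (- (z1 + z2)) * euler_prod \<tau> ^ 4
      * (theta_prod \<tau> (- z1) * theta_prod \<tau> (z1 - z2) * theta_prod \<tau> (- z2) * theta_prod \<tau> (- (z1 + z2))))"
    unfolding v by (simp add: power4_eq_xxxx mult_ac)
  also have "\<dots> = - ((eta_t \<tau> t)\<^sup>2 * denom \<tau> z1 z2 t)"
    unfolding c denom_eq_theta_prod[OF tau] by (simp only: mult_ac)
  finally show ?thesis .
qed

lemma eta_t_nz: "Im \<tau> > 0 \<Longrightarrow> eta_t \<tau> t \<noteq> 0"
  by (simp add: eta_t_def dedekind_eta_nz)

text \<open>
  The four multipliers of \<open>vartheta11_t\<close> contribute \<open>(jfactor \<tau>)\<^sup>4 = - \<tau>\<^sup>2\<close>, and the square of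
  \<open>dedekind_eta\<close> contributes \<open>- \<i>\<tau>\<close>.  The Gaussian factors match the shift of \<open>t\<close> because
  \<open>z1\<^sup>2 + z2\<^sup>2 + (z1 - z2)\<^sup>2 + (z1 + z2)\<^sup>2 = 3 (z1\<^sup>2 + z2\<^sup>2)\<close>.
\<close>

theorem denom_inversion:
  assumes tau: "Im \<tau> > 0"
  shows "denom (- 1 / \<tau>) (z1 / \<tau>) (z2 / \<tau>) (t - (z1\<^sup>2 + z2\<^sup>2) / (2 * \<tau>)) = - \<i> * \<tau> * denom \<tau> z1 z2 t"
proof -
  have nz: "\<tau> \<noteq> 0" using tau by auto
  define X where "X = (z1\<^sup>2 + z2\<^sup>2) / (2 * \<tau>)"
  define s where "s = t - X"
  define e where "e = exp (2 * of_real pi * \<i> * (- X))"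
  define v where "v z = exp (of_real pi * \<i> * z\<^sup>2 / \<tau>)" for z
  have shift: "vartheta11_t \<sigma> z s = e * vartheta11_t \<sigma> z t" for \<sigma> z
  proof -
    have "exp (2 * of_real pi * \<i> * s) = e * exp (2 * of_real pi * \<i> * t)"
      unfolding e_def s_def exp_add[symmetric] by (simp add: algebra_simps)
    then show ?thesis by (simp add: vartheta11_t_def)
  qed
  have eta: "(eta_t (- 1 / \<tau>) s)\<^sup>2 = e * (- \<i> * \<tau>) * (eta_t \<tau> t)\<^sup>2"
  proof -
    have "(exp (of_real pi * \<i> * s))\<^sup>2 = e * (exp (of_real pi * \<i> * t))\<^sup>2"
      unfolding e_def s_def power2_eq_square exp_add[symmetric] by (simp add: algebra_simps)
    then show ?thesis
      unfolding eta_t_def power_mult_distrib dedekind_eta_inversion_square[OF tau] by simp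
  qed
  have ev: "e ^ 4 * (v z1 * v z2 * v (z1 - z2) * v (z1 + z2)) = e"
    unfolding e_def v_def X_def exp_of_nat_mult[symmetric] exp_add[symmetric]
    by (intro arg_cong[where f = exp]) (use nz in \<open>simp add: field_simps power2_eq_square\<close>)
  have "jfactor \<tau> ^ 4 = ((jfactor \<tau>)\<^sup>2)\<^sup>2" by simp
  also have "\<dots> = - (\<tau>\<^sup>2)" unfolding jfactor_square[OF tau] by (simp add: power_mult_distrib)
  finally have j4: "jfactor \<tau> ^ 4 = - (\<tau>\<^sup>2)" .
  have "(eta_t (- 1 / \<tau>) s)\<^sup>2 * denom (- 1 / \<tau>) (z1 / \<tau>) (z2 / \<tau>) s
     = - (vartheta11_t (- 1 / \<tau>) (z1 / \<tau>) s * vartheta11_t (- 1 / \<tau>) (z2 / \<tau>) s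
         * vartheta11_t (- 1 / \<tau>) ((z1 - z2) / \<tau>) s * vartheta11_t (- 1 / \<tau>) ((z1 + z2) / \<tau>) s)"
    unfolding diff_divide_distrib add_divide_distrib
      vartheta11_product_eq_denom[OF Im_inversion_pos[OF tau]] by simp
  also have "\<dots> = - ((e ^ 4 * (v z1 * v z2 * v (z1 - z2) * v (z1 + z2))) * (\<i> ^ 4 * jfactor \<tau> ^ 4)
      * (vartheta11_t \<tau> z1 t * vartheta11_t \<tau> z2 t * vartheta11_t \<tau> (z1 - z2) t * vartheta11_t \<tau> (z1 + z2) t))"
    unfolding shift vartheta11_inversion[OF tau] v_def[symmetric] power4_eq_xxxx
    by (simp only: mult_minus_left mult_minus_right minus_minus mult_ac)
  also have "\<dots> = - (e * \<tau>\<^sup>2 * (eta_t \<tau> t)\<^sup>2 * denom \<tau> z1 z2 t)"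
    unfolding ev j4 vartheta11_product_eq_denom[OF tau] by simp
  also have "\<dots> = (eta_t (- 1 / \<tau>) s)\<^sup>2 * (- \<i> * \<tau> * denom \<tau> z1 z2 t)"
    unfolding eta by (simp add: power2_eq_square mult_ac)
  finally have "(eta_t (- 1 / \<tau>) s)\<^sup>2 * denom (- 1 / \<tau>) (z1 / \<tau>) (z2 / \<tau>) s
     = (eta_t (- 1 / \<tau>) s)\<^sup>2 * (- \<i> * \<tau> * denom \<tau> z1 z2 t)" .
  moreover have "(eta_t (- 1 / \<tau>) s)\<^sup>2 \<noteq> 0"
    using eta_t_nz[OF Im_inversion_pos[OF tau], of s] by (simp only: power_eq_0_iff not_False_eq_True simp_thms)
  ultimately show ?thesis
    unfolding s_def X_def by (metis mult_left_cancel)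
qed

lemma denom_add_1: "denom (\<tau> + 1) z1 z2 t = exp (5 * of_real pi * \<i> / 6) * denom \<tau> z1 z2 t"
proof -
  have q: "qpow (\<tau> + 1) 1 = qpow \<tau> 1"
    unfolding qpow_def by (rule exp_eqI[where n = 1]) (simp add: algebra_simps)
  have r: "qpow (\<tau> + 1) (form rho rho / (2 * dual_coxeter))
      = exp (5 * of_real pi * \<i> / 6) * qpow \<tau> (form rho rho / (2 * dual_coxeter))"
    unfolding qpow_def exp_add[symmetric]
    by (simp add: form_def rho_def dual_coxeter_def algebra_simps)
  have e: "expw u (coord (\<tau> + 1) z1 z2 t) = expw u (coord \<tau> z1 z2 t)" if "u$4 = 0" for u
    by (simp add: expw_def form_coord that)
  have "rho $ 4 = 0" by (simp add: rho_def)
  moreover have "\<alpha> $ 4 = 0" "(- \<alpha>) $ 4 = 0" if "\<alpha> \<in> finite_pos_roots" for \<alpha>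
    using that by (auto simp: finite_pos_roots_def)
  ultimately show ?thesis
    unfolding denom_def Let_def q r by (simp add: e mult.assoc cong: prod.cong)
qed

section \<open>The numerator as a product of theta functions\<close>

lemma infsum_product:
  fixes f :: "'a \<Rightarrow> complex" and g :: "'b \<Rightarrow> complex"
  assumes f: "(\<lambda>x. norm (f x)) summable_on A" and g: "(\<lambda>y. norm (g y)) summable_on B"
  shows "(\<Sum>\<^sub>\<infinity>(x, y)\<in>A \<times> B. f x * g y) = (\<Sum>\<^sub>\<infinity>x\<in>A. f x) * (\<Sum>\<^sub>\<infinity>y\<in>B. g y)"
proof -
  have "(\<lambda>p. norm (case p of (x, y) \<Rightarrow> f x * g y)) summable_on (A \<times> B)"
  proof (rule Infinite_Sum.abs_summable_on_Sigma_iff[THEN iffD2], intro conjI ballI)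
    show "(\<lambda>y. norm (case (x, y) of (x, y) \<Rightarrow> f x * g y)) summable_on B" for x
      unfolding prod.case norm_mult by (intro summable_on_cmult_right g)
    have "(\<lambda>x. norm (f x) * norm (\<Sum>\<^sub>\<infinity>y\<in>B. norm (g y))) summable_on A"
      by (intro summable_on_cmult_left f)
    then show "(\<lambda>x. norm (\<Sum>\<^sub>\<infinity>y\<in>B. norm (case (x, y) of (x, y) \<Rightarrow> f x * g y))) summable_on A"
      unfolding prod.case norm_mult infsum_cmult_right' by (simp add: abs_mult)
  qed
  then have "(\<lambda>(x, y). f x * g y) summable_on (A \<times> B)"
    by (rule abs_summable_summable)
  from infsum_Sigma'_banach[OF this] show ?thesis
    by (simp add: infsum_cmult_right' infsum_cmult_left')
qed

lemma det_4:
  "det (A :: 'a :: comm_ring_1 ^ 4 ^ 4) =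
    A$1$1 * (A$2$2 * (A$3$3 * A$4$4 - A$3$4 * A$4$3)
           - A$2$3 * (A$3$2 * A$4$4 - A$3$4 * A$4$2)
           + A$2$4 * (A$3$2 * A$4$3 - A$3$3 * A$4$2))
  - A$1$2 * (A$2$1 * (A$3$3 * A$4$4 - A$3$4 * A$4$3)
           - A$2$3 * (A$3$1 * A$4$4 - A$3$4 * A$4$1)
           + A$2$4 * (A$3$1 * A$4$3 - A$3$3 * A$4$1))
  + A$1$3 * (A$2$1 * (A$3$2 * A$4$4 - A$3$4 * A$4$2)
           - A$2$2 * (A$3$1 * A$4$4 - A$3$4 * A$4$1)
           + A$2$4 * (A$3$1 * A$4$2 - A$3$2 * A$4$1))
  - A$1$4 * (A$2$1 * (A$3$2 * A$4$3 - A$3$3 * A$4$2)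
           - A$2$2 * (A$3$1 * A$4$3 - A$3$3 * A$4$1)
           + A$2$3 * (A$3$1 * A$4$2 - A$3$2 * A$4$1))"
proof -
  have 1: "finite {2::4, 3, 4}" "1 \<notin> {2::4, 3, 4}" by auto
  have 2: "finite {3::4, 4}" "2 \<notin> {3::4, 4}" by auto
  have 3: "finite {4::4}" "3 \<notin> {4::4}" by auto
  show ?thesis
    unfolding det_def UNIV_4
    unfolding sum_over_permutations_insert[OF 1]
    unfolding sum_over_permutations_insert[OF 2]
    unfolding sum_over_permutations_insert[OF 3]
    unfolding permutes_sing
    by (simp add: sign_swap_id permutation_swap_id permutation_compose sign_compose sign_id swap_id_eq
        algebra_simps)
qed

text \<open>
  The element of \<open>W1\<close> that translates by \<open>2j\<alpha>\<^sub>1 + 2k(\<alpha>\<^sub>1 + \<alpha>\<^sub>2)\<close> and then multiplies the coordinates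
  with respect to the orthonormal vectors \<open>\<alpha>\<^sub>1\<close> and \<open>\<alpha>\<^sub>1 + \<alpha>\<^sub>2\<close> by the signs \<open>s\<close> and \<open>s'\<close>.
\<close>

definition w1_map :: "complex \<Rightarrow> complex \<Rightarrow> complex \<Rightarrow> complex \<Rightarrow> cartan \<Rightarrow> cartan" where
  "w1_map s s' j k u = vector
     [u$1,
      s * (u$2 - u$3 + 2 * j * u$1) + s' * (u$3 + 2 * k * u$1),
      s' * (u$3 + 2 * k * u$1),
      u$4 - 2 * ((j\<^sup>2 + k\<^sup>2) * u$1 + j * (u$2 - u$3) + k * u$3)]"

lemma transl_eq_w1_map:
  "transl ((2 * j) *s alpha1 + (2 * k) *s (alpha1 + alpha2)) = w1_map 1 1 j k"
  by (simp add: fun_eq_iff vec_eq_iff forall_4 transl_def w1_map_def form_def algebra_simps power2_eq_square)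

lemma root_refl_w1_map:
  "root_refl alpha1 \<circ> w1_map s s' j k = w1_map (- s) s' j k"
  "root_refl (alpha1 + alpha2) \<circ> w1_map s s' j k = w1_map s (- s') j k"
  by (simp_all add: fun_eq_iff vec_eq_iff forall_4 root_refl_def w1_map_def form_def algebra_simps)

lemma id_eq_w1_map: "id = w1_map 1 1 0 0"
  by (simp add: fun_eq_iff vec_eq_iff forall_4 w1_map_def)

lemma finite_W1_eq: "finite_W1 = {w1_map s s' 0 0 | s s'. s \<in> {1, -1} \<and> s' \<in> {1, -1}}"
proof (intro set_eqI iffI)
  fix w assume "w \<in> finite_W1"
  then show "w \<in> {w1_map s s' 0 0 | s s'. s \<in> {1, -1} \<and> s' \<in> {1, -1}}"
  proof induction
    case finite_W1_id
    show ?case using id_eq_w1_map by blast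
  next
    case (finite_W1_refl1 w)
    then obtain s s' where "w = w1_map s s' 0 0" "s \<in> {1, -1}" "s' \<in> {1, -1}" by blast
    then show ?case
      by (intro CollectI exI[of _ "- s"] exI[of _ s']) (auto simp: root_refl_w1_map)
  next
    case (finite_W1_refl2 w)
    then obtain s s' where "w = w1_map s s' 0 0" "s \<in> {1, -1}" "s' \<in> {1, -1}" by blast
    then show ?case
      by (intro CollectI exI[of _ s] exI[of _ "- s'"]) (auto simp: root_refl_w1_map)
  qed
next
  fix w assume "w \<in> {w1_map s s' 0 0 | s s'. s \<in> {1, -1} \<and> s' \<in> {1, -1}}"
  then obtain s s' where w: "w = w1_map s s' 0 0" "s \<in> {1, -1}" "s' \<in> {1, -1}" by blast
  have 1: "w1_map 1 1 0 0 \<in> finite_W1" using finite_W1.finite_W1_id by (simp add: id_eq_w1_map)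
  have 2: "w1_map (- 1) 1 0 0 \<in> finite_W1"
    using finite_W1.finite_W1_refl1[OF 1] by (simp add: root_refl_w1_map)
  have 3: "w1_map 1 (- 1) 0 0 \<in> finite_W1" "w1_map (- 1) (- 1) 0 0 \<in> finite_W1"
    using finite_W1.finite_W1_refl2[OF 1] finite_W1.finite_W1_refl2[OF 2]
    by (simp_all add: root_refl_w1_map)
  show "w \<in> finite_W1" using w 1 2 3 by auto
qed

definition signs :: "complex set" where "signs = {1, -1}"

text \<open>
  Each sign is paired with the translation along the same coordinate, so that the index set is the
  product along which the sum factorises.
\<close>

lemma W1_bij:
  "bij_betw (\<lambda>((s, j), (s', k)). w1_map s s' (of_int j) (of_int k))
     ((signs \<times> UNIV) \<times> (signs \<times> UNIV)) W1"
proof -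
  have comp: "w1_map s s' 0 0 \<circ> w1_map 1 1 j k = w1_map s s' j k" for s s' j k
    by (simp add: fun_eq_iff vec_eq_iff forall_4 w1_map_def algebra_simps)
  have "W1 = (\<lambda>((s, j), (s', k)). w1_map s s' (of_int j) (of_int k))
     ` ((signs \<times> UNIV) \<times> (signs \<times> UNIV))" (is "_ = ?f ` ?A")
  proof (intro set_eqI iffI)
    fix w assume "w \<in> W1"
    then obtain s s' j k where "w = w1_map s s' 0 0 \<circ> transl ((2 * of_int j) *s alpha1 + (2 * of_int k) *s (alpha1 + alpha2))"
      "s \<in> signs" "s' \<in> signs"
      unfolding W1_def lattice_W1_def finite_W1_eq signs_def by blast
    then have "w = ?f ((s, j), (s', k))" "((s, j), (s', k)) \<in> ?A"
      by (simp_all only: transl_eq_w1_map comp) auto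
    then show "w \<in> ?f ` ?A" by blast
  next
    fix w assume "w \<in> ?f ` ?A"
    then obtain s s' j k where "w = w1_map s s' (of_int j) (of_int k)" "s \<in> signs" "s' \<in> signs"
      by auto
    then have "w = w1_map s s' 0 0 \<circ> transl ((2 * of_int j) *s alpha1 + (2 * of_int k) *s (alpha1 + alpha2))"
      "w1_map s s' 0 0 \<in> finite_W1"
      by (simp_all only: transl_eq_w1_map comp finite_W1_eq signs_def) blast
    then show "w \<in> W1" unfolding W1_def lattice_W1_def by blast
  qed
  moreover have "inj_on ?f ?A"
  proof (rule inj_onI)
    fix x y assume xy: "?f x = ?f y"
    obtain s j s' k where x: "x = ((s, j), (s', k))" by (metis prod.exhaust)
    obtain r i r' l where y: "y = ((r, i), (r', l))" by (metis prod.exhaust)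
    have eq: "w1_map s s' (of_int j) (of_int k) = w1_map r r' (of_int i) (of_int l)"
      using xy by (simp add: x y)
    from fun_cong[OF eq, of alpha1] have "s = r" "j = i"
      by (simp_all add: w1_map_def vec_eq_iff forall_4)
    moreover from fun_cong[OF eq, of "alpha1 + alpha2"] have "s' = r'" "k = l"
      by (simp_all add: w1_map_def vec_eq_iff forall_4)
    ultimately show "x = y" by (simp add: x y)
  qed
  ultimately show ?thesis by (simp add: bij_betw_def)
qed

lemma weyl_sign_w1_map: "weyl_sign (w1_map s s' j k) = s * s'"
  by (simp add: weyl_sign_def det_4 matrix_def w1_map_def axis_def algebra_simps)

definition theta_term :: "int \<Rightarrow> int \<Rightarrow> complex \<Rightarrow> complex \<Rightarrow> int \<Rightarrow> complex" where
  "theta_term n m \<tau> z r = exp (2 * of_real pi * \<i> * of_int m * (of_int r + of_int n / (2 * of_int m)) * z)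
     * qpow \<tau> (of_int m * (of_int r + of_int n / (2 * of_int m))\<^sup>2)"

lemma theta_t_term:
  "theta_t n m \<tau> z t = exp (of_real pi * \<i> * of_int m * t) * (\<Sum>\<^sub>\<infinity>r. theta_term n m \<tau> z r)"
  by (simp add: theta_t_def theta_term_def)

lemma theta_term_jterm:
  assumes "m > 0"
  shows "theta_term n m \<tau> z r = exp (of_real pi * \<i> * (\<tau> * (of_int n)\<^sup>2 / (2 * of_int m) + of_int n * z))
     * jterm (2 * of_int m * \<tau>) (of_int n * \<tau> + of_int m * z) r"
  unfolding theta_term_def jterm_def qpow_def exp_add[symmetric]
  by (intro arg_cong[where f = exp]) (use assms in \<open>simp add: field_simps power2_eq_square\<close>)

lemma theta_t_jtheta:
  assumes "m > 0"
  shows "theta_t n m \<tau> z t = exp (of_real pi * \<i> * of_int m * t)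
     * (exp (of_real pi * \<i> * (\<tau> * (of_int n)\<^sup>2 / (2 * of_int m) + of_int n * z))
     * jtheta (2 * of_int m * \<tau>) (of_int n * \<tau> + of_int m * z))"
  unfolding theta_t_term theta_term_jterm[OF assms] jtheta_def infsum_cmult_right' ..

lemma theta_term_abs_summable:
  assumes "Im \<tau> > 0" "m > 0"
  shows "(\<lambda>r. norm (theta_term n m \<tau> z r)) summable_on UNIV"
  unfolding theta_term_jterm[OF assms(2)] norm_mult
  by (intro summable_on_cmult_right jterm_abs_summable) (use assms in simp)

lemma theta_term_uminus: "theta_term n m \<tau> (- z) r = theta_term (- n) m \<tau> z (- r)"
proof -
  have "of_int (- r) + of_int (- n) / (2 * of_int m) = - (of_int r + of_int n / (2 * of_int m) :: complex)"
    by simp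
  then show ?thesis unfolding theta_term_def by (simp only: power2_minus mult_minus_left mult_minus_right)
qed

text \<open>
  The variable \<open>t\<close> only contributes an exponential factor, which is kept outside.
\<close>

definition theta_diff :: "int \<Rightarrow> int \<Rightarrow> complex \<Rightarrow> complex \<Rightarrow> complex" where
  "theta_diff n m \<tau> z = theta_t n m \<tau> z 0 - theta_t (- n) m \<tau> z 0"

text \<open>
  The contribution of one coordinate direction: reflecting the coordinate replaces \<open>z\<close> by \<open>- z\<close>,
  that is, \<open>n\<close> by \<open>- n\<close>.
\<close>

lemma infsum_signed_theta_term:
  fixes n m :: int and \<tau> z :: complex
  defines "f \<equiv> (\<lambda>(s, r). s * theta_term n m \<tau> (s * z) r)"
  assumes "Im \<tau> > 0" "m > 0"
  shows "(\<lambda>x. norm (f x)) summable_on (signs \<times> UNIV)"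
    and "(\<Sum>\<^sub>\<infinity>x\<in>signs \<times> UNIV. f x) = theta_diff n m \<tau> z"
proof -
  have fin: "finite signs" by (simp add: signs_def)
  show s: "(\<lambda>x. norm (f x)) summable_on (signs \<times> UNIV)"
  proof (rule Infinite_Sum.abs_summable_on_Sigma_iff[THEN iffD2], intro conjI ballI)
    show "(\<lambda>r. norm (f (x, r))) summable_on UNIV" for x
      unfolding f_def prod.case norm_mult
      by (intro summable_on_cmult_right theta_term_abs_summable assms)
  qed (use fin in simp)
  have "(\<lambda>(s, r). s * theta_term n m \<tau> (s * z) r) summable_on (signs \<times> UNIV)"
    using abs_summable_summable[OF s] by (simp add: f_def)
  from infsum_Sigma'_banach[OF this]
  have "(\<Sum>\<^sub>\<infinity>x\<in>signs \<times> UNIV. f x) = (\<Sum>s\<in>signs. s * (\<Sum>\<^sub>\<infinity>r. theta_term n m \<tau> (s * z) r))"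
    using fin by (simp add: f_def infsum_cmult_right')
  also have "\<dots> = (\<Sum>\<^sub>\<infinity>r. theta_term n m \<tau> z r) - (\<Sum>\<^sub>\<infinity>r. theta_term n m \<tau> (- z) r)"
    by (simp add: signs_def)
  also have "(\<Sum>\<^sub>\<infinity>r. theta_term n m \<tau> (- z) r) = (\<Sum>\<^sub>\<infinity>r. theta_term (- n) m \<tau> z r)"
    by (rule infsum_reindex_bij_witness[of _ uminus uminus]) (auto simp: theta_term_uminus)
  finally show "(\<Sum>\<^sub>\<infinity>x\<in>signs \<times> UNIV. f x) = theta_diff n m \<tau> z"
    by (simp add: theta_diff_def theta_t_term)
qed

text \<open>
  In orthonormal coordinates the group, and with it the alternating sum, is a product of two copies
  of the affine Weyl group of rank one.
\<close>

theorem numer_eq_theta_diff: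
  assumes tau: "Im \<tau> > 0" and K: "K > -3"
  shows "numer K n1 n2 \<tau> z1 z2 t = exp (2 * of_real pi * \<i> * (of_int K + 3) * t)
    * (theta_diff n1 (2 * (K + 3)) \<tau> z1 * theta_diff n2 (2 * (K + 3)) \<tau> z2)"
proof -
  define \<mu> where "\<mu> = weight K n1 n2 + rho"
  define m where "m = 2 * (K + 3)"
  have m: "m > 0" using K by (simp add: m_def)
  define N where "N = complex_of_int K + 3"
  have "of_int (K + 3) \<noteq> (0 :: complex)" using K by (simp only: of_int_eq_0_iff)
  then have nzN: "N \<noteq> 0" by (simp add: N_def)
  have mN: "of_int m = 2 * N" by (simp add: m_def N_def)
  have mu: "\<mu>$1 = N" "\<mu>$2 = (of_int n1 + of_int n2) / 2" "\<mu>$3 = of_int n2 / 2" "\<mu>$4 = 0"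
    by (simp_all add: \<mu>_def N_def weight_def rho_def field_simps)
  define Q where "Q = qpow \<tau> (form (finite_part \<mu>) (finite_part \<mu>) / (2 * (of_int K + 3)))"
  define E where "E = exp (2 * of_real pi * \<i> * (of_int K + 3) * t)"
  define f where "f n z = (\<lambda>(s, r). s * theta_term n m \<tau> (s * z) r)" for n z
  have ff: "form (finite_part \<mu>) (finite_part \<mu>) = ((of_int n1)\<^sup>2 + (of_int n2)\<^sup>2) / 4"
    by (simp add: form_def finite_part_def mu field_simps power2_eq_square)
  have summand: "Q * (weyl_sign w * expw (w \<mu>) (coord \<tau> z1 z2 t)) = E * (f n1 z1 (s, j) * f n2 z2 (s', k))"
    if w: "w = w1_map s s' (of_int j) (of_int k)" for w s s' j k
  proof -
    have "Q * expw (w \<mu>) (coord \<tau> z1 z2 t)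
        = E * (theta_term n1 m \<tau> (s * z1) j * theta_term n2 m \<tau> (s' * z2) k)"
      unfolding Q_def E_def ff expw_def form_coord theta_term_def qpow_def mN N_def[symmetric]
        exp_add[symmetric]
      by (intro arg_cong[where f = exp])
         (use nzN in \<open>simp add: w w1_map_def mu field_simps power2_eq_square\<close>)
    moreover have "weyl_sign w = s * s'" by (simp add: w weyl_sign_w1_map)
    ultimately show ?thesis by (simp add: f_def mult_ac)
  qed
  have "numer K n1 n2 \<tau> z1 z2 t = (\<Sum>\<^sub>\<infinity>w\<in>W1. Q * (weyl_sign w * expw (w \<mu>) (coord \<tau> z1 z2 t)))"
    by (simp add: numer_def Let_def \<mu>_def Q_def infsum_cmult_right')
  also have "\<dots> = (\<Sum>\<^sub>\<infinity>(x, y)\<in>(signs \<times> UNIV) \<times> (signs \<times> UNIV). E * (f n1 z1 x * f n2 z2 y))"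
    unfolding infsum_reindex_bij_betw[OF W1_bij, symmetric]
    by (intro infsum_cong) (auto simp: summand)
  also have "\<dots> = E * (\<Sum>\<^sub>\<infinity>(x, y)\<in>(signs \<times> UNIV) \<times> (signs \<times> UNIV). f n1 z1 x * f n2 z2 y)"
    unfolding infsum_cmult_right'[symmetric] by (intro infsum_cong) auto
  also have "\<dots> = E * (theta_diff n1 m \<tau> z1 * theta_diff n2 m \<tau> z2)"
    unfolding f_def infsum_signed_theta_term(2)[OF tau m, symmetric]
    by (subst infsum_product[OF infsum_signed_theta_term(1)[OF tau m] infsum_signed_theta_term(1)[OF tau m]]) simp
  finally show ?thesis by (simp add: E_def m_def)
qed

section \<open>Modular transformations of the theta functions\<close>

lemma Im_double_shift: "Im \<tau> > 0 \<Longrightarrow> Im (- 1 / \<tau> + 1 + 1) > 0"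
  using Im_inversion_pos by simp

text \<open>
  Up to a factor, \<open>theta_t n m \<tau>\<close> is \<open>jtheta\<close> with modulus \<open>2m\<tau>\<close>.  Inversion leads to the modulus
  \<open>\<tau>/(2m)\<close>, and splitting that series by the residues of its index modulo \<open>2m\<close> gives all the
  \<open>theta_t k m \<tau>\<close>.
\<close>

lemma theta_t_inversion:
  assumes tau: "Im \<tau> > 0" and m: "m > 0"
  shows "theta_t n m (- 1 / \<tau>) (z / \<tau>) 0
     = jfactor (\<tau> / (2 * of_int m)) * exp (of_real pi * \<i> * of_int m * z\<^sup>2 / (2 * \<tau>))
       * (\<Sum>k\<in>{0..<2 * m}. exp (- of_real pi * \<i> * of_int (n * k) / of_int m) * theta_t k m \<tau> z 0)"
proof -
  have nz: "\<tau> \<noteq> 0" using tau by auto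
  have m2: "2 * m > 0" using m by simp
  define M where "M = complex_of_int m"
  have M: "M \<noteq> 0" using m by (simp add: M_def)
  define s where "s = \<tau> / (2 * M)"
  define y where "y = z / 2 - of_int n / (2 * M)"
  have "Im s = Im \<tau> / (2 * of_int m)"
    using Im_divide_of_real[of \<tau> "2 * of_int m"] by (simp add: s_def M_def)
  then have s: "Im s > 0" using tau m by simp
  have arg: "2 * M * (- 1 / \<tau>) = - 1 / s" "of_int n * (- 1 / \<tau>) + M * (z / \<tau>) = y / s"
    using nz M by (simp_all add: s_def y_def field_simps)
  have e: "exp (of_real pi * \<i> * ((- 1 / \<tau>) * (of_int n)\<^sup>2 / (2 * M) + of_int n * (z / \<tau>)))
      * exp (of_real pi * \<i> * y\<^sup>2 / s) = exp (of_real pi * \<i> * M * z\<^sup>2 / (2 * \<tau>))"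
    unfolding exp_add[symmetric] s_def y_def
    by (intro arg_cong[where f = exp]) (use nz M in \<open>simp add: field_simps power2_eq_square\<close>)
  have "jterm s y (k + 2 * m * r) = exp (- of_real pi * \<i> * of_int (n * k) / M) * theta_term k m \<tau> z r"
    for k r
    unfolding jterm_def theta_term_def qpow_def M_def[symmetric] s_def y_def exp_add[symmetric]
    by (rule exp_eqI[where n = "- n * r"])
       (use M in \<open>simp add: M_def[symmetric] field_simps power2_eq_square\<close>)
  then have "jtheta s y
     = (\<Sum>k\<in>{0..<2 * m}. exp (- of_real pi * \<i> * of_int (n * k) / M) * theta_t k m \<tau> z 0)"
    unfolding jtheta_def infsum_int_residues[OF jterm_summable[OF s] m2]
    by (simp add: infsum_cmult_right' theta_t_term)
  then show ?thesis
    using e unfolding theta_t_jtheta[OF m] M_def[symmetric] arg jtheta_inversion[OF s] s_def[symmetric]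
    by (simp add: mult.assoc mult.left_commute[of "jfactor s"])
qed

lemma theta_t_add_1:
  assumes m: "m > 0"
  shows "theta_t k m (\<tau> + 1) z t = exp (of_real pi * \<i> * (of_int k)\<^sup>2 / (2 * of_int m)) * theta_t k m \<tau> z t"
proof -
  have *: "theta_term k m (\<tau> + 1) z r
      = exp (of_real pi * \<i> * (of_int k)\<^sup>2 / (2 * of_int m)) * theta_term k m \<tau> z r" for r
    unfolding theta_term_def qpow_def exp_add[symmetric]
    by (rule exp_eqI[where n = "m * r\<^sup>2 + r * k"])
       (use m in \<open>simp add: field_simps power2_eq_square\<close>)
  show ?thesis unfolding theta_t_term * infsum_cmult_right' by (simp only: mult_ac)
qed

lemma theta_t_periodic:
  assumes m: "m > 0"
  shows "theta_t (k + 2 * m) m \<tau> z t = theta_t k m \<tau> z t"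
proof -
  have "of_int r + of_int (k + 2 * m) / (2 * of_int m) = of_int (r + 1) + (of_int k / (2 * of_int m) :: complex)" for r
    using m by (simp add: field_simps)
  then have "theta_term (k + 2 * m) m \<tau> z r = theta_term k m \<tau> z (r + 1)" for r
    unfolding theta_term_def by (simp only:)
  then have "(\<Sum>\<^sub>\<infinity>r. theta_term (k + 2 * m) m \<tau> z r) = (\<Sum>\<^sub>\<infinity>r. theta_term k m \<tau> z r)"
    by (intro infsum_reindex_bij_witness[of _ "\<lambda>r. r - 1" "\<lambda>r. r + 1"]) auto
  then show ?thesis by (simp add: theta_t_term)
qed

lemma sum_periodic_shift:
  fixes f :: "int \<Rightarrow> 'a :: comm_monoid_add"
  assumes M: "M > 0" and per: "\<And>k. f (k + M) = f k"
  shows "(\<Sum>k\<in>{0..<M}. f (k + h)) = (\<Sum>k\<in>{0..<M}. f k)"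
proof -
  have mult: "f (k + M * n) = f k" for k n
  proof (induction n rule: int_induct[where k = 0])
    case (step1 i)
    then show ?case using per[of "k + M * i"] by (simp add: algebra_simps)
  next
    case (step2 i)
    then show ?case using per[of "k + M * (i - 1)"] by (simp add: algebra_simps)
  qed simp
  have "f (k mod M) = f k" for k
    using mult[of "k mod M" "k div M"] by simp
  then show ?thesis
    by (intro sum.reindex_bij_witness[of _ "\<lambda>k. (k - h) mod M" "\<lambda>k. (k + h) mod M"])
       (use M in \<open>auto simp: mod_simps\<close>)
qed

text \<open>
  The Gauss sums produced by the middle factor \<open>T\<^sup>2\<close> of \<open>ST\<^sup>2S\<close>: completing the square reduces them
  to \<open>gauss_gamma\<close>, and for odd \<open>a\<close> the shift by \<open>m\<close> changes the sign of the summands.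
\<close>

lemma gauss_sum_linear:
  assumes m: "m > 0" and even: "even m"
  shows "(\<Sum>k\<in>{0..<2 * m}. exp (of_real pi * \<i> * of_int (k\<^sup>2 - a * k) / of_int m))
     = (if even a then exp (- of_real pi * \<i> * (of_int a)\<^sup>2 / (4 * of_int m)) * gauss_gamma m else 0)"
proof -
  have nz: "of_int m \<noteq> (0 :: complex)" using m by simp
  define g where "g k = exp (of_real pi * \<i> * of_int (k\<^sup>2 - a * k) / of_int m)" for k
  have m2: "2 * m > 0" using m by simp
  have per: "g (k + 2 * m) = g k" for k
    unfolding g_def
    by (rule exp_eqI[where n = "2 * k + 2 * m - a"]) (use nz in \<open>simp add: field_simps power2_eq_square\<close>)
  show ?thesis
  proof (cases "even a")
    case True
    then obtain h where a: "a = 2 * h" by (elim evenE)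
    have "g (k + h) = exp (- of_real pi * \<i> * (of_int a)\<^sup>2 / (4 * of_int m))
        * exp (of_real pi * \<i> / of_int m * (of_int k)\<^sup>2)" for k
      unfolding g_def a exp_add[symmetric]
      by (intro arg_cong[where f = exp]) (use nz in \<open>simp add: field_simps power2_eq_square\<close>)
    with sum_periodic_shift[of "2 * m" g h, OF m2 per] True show ?thesis
      by (simp add: g_def gauss_gamma_def sum_distrib_left)
  next
    case False
    then have "odd (m - a)" using even by simp
    then obtain c where c: "m - a = 2 * c + 1" by (elim oddE)
    have "g (k + m) = - g k" for k
    proof -
      have "g (k + m) = exp (of_real pi * \<i> * of_int (k\<^sup>2 - a * k) / of_int m + of_real pi * \<i> * of_int (m - a))"
        unfolding g_def
        by (rule exp_eqI[where n = k]) (use nz in \<open>simp add: field_simps power2_eq_square\<close>)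
      also have "of_real pi * \<i> * of_int (m - a) = of_real pi * \<i> + 2 * of_real pi * \<i> * of_int c"
        unfolding c by (simp add: algebra_simps)
      also have "exp (of_real pi * \<i> * of_int (k\<^sup>2 - a * k) / of_int m + \<dots>) = - g k"
        unfolding add.assoc[symmetric] exp_add_2pi_int by (simp add: exp_add g_def)
      finally show ?thesis .
    qed
    with sum_periodic_shift[of "2 * m" g m, OF m2 per] have "(\<Sum>k\<in>{0..<2 * m}. g k) = 0"
      by (simp add: sum_negf)
    with False show ?thesis by (simp add: g_def)
  qed
qed

text \<open>
  Here \<open>- \<tau>/(2\<tau> - 1) = - 1/\<sigma>\<close> for \<open>\<sigma> = - 1/\<tau> + 2\<close>: an inversion, the square of \<open>T\<close>, and another
  inversion, applied one after the other.
\<close>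

lemma theta_t_STTS:
  assumes tau: "Im \<tau> > 0" and m: "m > 0" and even: "even m"
  shows "theta_t n m (- \<tau> / (2 * \<tau> - 1)) (z / (2 * \<tau> - 1)) 0
    = jfactor ((- 1 / \<tau> + 1 + 1) / (2 * of_int m)) * jfactor (\<tau> / (2 * of_int m)) * gauss_gamma m
      * exp (of_real pi * \<i> * of_int m * z\<^sup>2 / (2 * \<tau> - 1))
      * (\<Sum>l\<in>{0..<2 * m}. (if even (n + l) then exp (- of_real pi * \<i> * (of_int (n + l))\<^sup>2 / (4 * of_int m)) else 0)
          * theta_t l m \<tau> z 0)"
proof -
  have nz: "\<tau> \<noteq> 0" using tau by auto
  have jnz: "2 * \<tau> - 1 \<noteq> 0" using tau by (auto simp: complex_eq_iff)
  define \<sigma> where "\<sigma> = - 1 / \<tau> + 1 + 1"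
  have sig: "Im \<sigma> > 0" unfolding \<sigma>_def by (rule Im_double_shift[OF tau])
  have sv: "\<sigma> = (2 * \<tau> - 1) / \<tau>" using nz by (simp add: \<sigma>_def field_simps)
  have arg: "- \<tau> / (2 * \<tau> - 1) = - 1 / \<sigma>" "z / (2 * \<tau> - 1) = z / \<tau> / \<sigma>"
    using nz jnz by (simp_all add: sv)
  define d d1 where "d = jfactor (\<tau> / (2 * of_int m))" and "d1 = jfactor (\<sigma> / (2 * of_int m))"
  define E E1 where "E = exp (of_real pi * \<i> * of_int m * z\<^sup>2 / (2 * \<tau>))"
    and "E1 = exp (of_real pi * \<i> * of_int m * (z / \<tau>)\<^sup>2 / (2 * \<sigma>))"
  have EE: "E1 * E = exp (of_real pi * \<i> * of_int m * z\<^sup>2 / (2 * \<tau> - 1))"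
  proof -
    have "of_real pi * \<i> * of_int m * (z / \<tau>)\<^sup>2 / (2 * \<sigma>) + of_real pi * \<i> * of_int m * z\<^sup>2 / (2 * \<tau>)
       = of_real pi * \<i> * of_int m * z\<^sup>2 * (1 / (\<tau> * (2 * (2 * \<tau> - 1))) + 1 / (2 * \<tau>))"
      using nz jnz by (simp add: sv power2_eq_square distrib_left)
    also have "1 / (\<tau> * (2 * (2 * \<tau> - 1))) + 1 / (2 * \<tau>) = 1 / (2 * \<tau> - 1)"
      using nz jnz by (simp add: divide_simps)
    finally show ?thesis by (simp add: E_def E1_def flip: exp_add)
  qed
  define w where "w k l = exp (- of_real pi * \<i> * of_int (k * l) / of_int m)" for k l
  have two: "theta_t k m \<sigma> (z / \<tau>) 0
      = exp (of_real pi * \<i> * (of_int k)\<^sup>2 / of_int m) * (d * E * (\<Sum>l\<in>{0..<2 * m}. w k l * theta_t l m \<tau> z 0))" for k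
  proof -
    have "theta_t k m \<sigma> (z / \<tau>) 0 = (exp (of_real pi * \<i> * (of_int k)\<^sup>2 / (2 * of_int m))
        * exp (of_real pi * \<i> * (of_int k)\<^sup>2 / (2 * of_int m))) * theta_t k m (- 1 / \<tau>) (z / \<tau>) 0"
      unfolding \<sigma>_def theta_t_add_1[OF m] by (simp only: mult.assoc)
    also have "exp (of_real pi * \<i> * (of_int k)\<^sup>2 / (2 * of_int m)) * exp (of_real pi * \<i> * (of_int k)\<^sup>2 / (2 * of_int m))
        = exp (of_real pi * \<i> * (of_int k)\<^sup>2 / of_int m)"
      unfolding exp_add[symmetric] by (intro arg_cong[where f = exp]) (use m in \<open>simp add: field_simps\<close>)
    finally show ?thesis
      unfolding theta_t_inversion[OF tau m] d_def E_def w_def .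
  qed
  have "theta_t n m (- \<tau> / (2 * \<tau> - 1)) (z / (2 * \<tau> - 1)) 0
      = d1 * E1 * (\<Sum>k\<in>{0..<2 * m}. w n k * theta_t k m \<sigma> (z / \<tau>) 0)"
    unfolding arg theta_t_inversion[OF sig m] d1_def E1_def w_def ..
  also have "(\<Sum>k\<in>{0..<2 * m}. w n k * theta_t k m \<sigma> (z / \<tau>) 0)
     = d * E * (\<Sum>k\<in>{0..<2 * m}. \<Sum>l\<in>{0..<2 * m}.
         (w n k * exp (of_real pi * \<i> * (of_int k)\<^sup>2 / of_int m) * w k l) * theta_t l m \<tau> z 0)"
    unfolding two sum_distrib_left by (intro sum.cong refl) (simp only: mult_ac)
  also have "(\<Sum>k\<in>{0..<2 * m}. \<Sum>l\<in>{0..<2 * m}.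
         (w n k * exp (of_real pi * \<i> * (of_int k)\<^sup>2 / of_int m) * w k l) * theta_t l m \<tau> z 0)
     = (\<Sum>l\<in>{0..<2 * m}. (\<Sum>k\<in>{0..<2 * m}.
         exp (of_real pi * \<i> * of_int (k\<^sup>2 - (n + l) * k) / of_int m)) * theta_t l m \<tau> z 0)"
  proof -
    have "w n k * exp (of_real pi * \<i> * (of_int k)\<^sup>2 / of_int m) * w k l
        = exp (of_real pi * \<i> * of_int (k\<^sup>2 - (n + l) * k) / of_int m)" for k l
      unfolding w_def exp_add[symmetric]
      by (intro arg_cong[where f = exp]) (use m in \<open>simp add: field_simps\<close>)
    then show ?thesis by (simp only: sum_distrib_right) (rule sum.swap)
  qed
  also have "\<dots> = gauss_gamma m * (\<Sum>l\<in>{0..<2 * m}.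
      (if even (n + l) then exp (- of_real pi * \<i> * (of_int (n + l))\<^sup>2 / (4 * of_int m)) else 0)
          * theta_t l m \<tau> z 0)"
    unfolding gauss_sum_linear[OF m even] sum_distrib_left
    by (intro sum.cong refl) (auto simp: mult_ac)
  finally show ?thesis
    unfolding EE[symmetric] \<sigma>_def[symmetric] d_def[symmetric] d1_def[symmetric] by (simp only: mult_ac)
qed

lemma sum_periodic_fold:
  fixes f :: "int \<Rightarrow> complex"
  assumes m: "m > 0" and per: "\<And>l. f (l + 2 * m) = f l" and zero: "f 0 = 0" "f m = 0"
  shows "(\<Sum>l\<in>{0..<2 * m}. f l) = (\<Sum>l\<in>{0<..<m}. f l + f (- l))"
proof -
  have "{0..<2 * m} = insert 0 (insert m ({0<..<m} \<union> {m<..<2 * m}))" using m by auto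
  then have "(\<Sum>l\<in>{0..<2 * m}. f l) = (\<Sum>l\<in>{0<..<m} \<union> {m<..<2 * m}. f l)"
    using zero m by simp
  also have "\<dots> = (\<Sum>l\<in>{0<..<m}. f l) + (\<Sum>l\<in>{m<..<2 * m}. f l)"
    by (rule sum.union_disjoint) auto
  also have "(\<Sum>l\<in>{m<..<2 * m}. f l) = (\<Sum>l\<in>{0<..<m}. f (- l))"
  proof (rule sum.reindex_bij_witness[of _ "\<lambda>l. 2 * m - l" "\<lambda>l. 2 * m - l"])
    show "f (- (2 * m - l)) = f l" for l
      using per[of "l - 2 * m"] by simp
  qed auto
  finally show ?thesis by (simp add: sum.distrib)
qed

text \<open>
  The coefficients of the antisymmetrised functions are odd in \<open>l\<close> and have period \<open>2m\<close>.  They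
  therefore vanish at \<open>0\<close> and \<open>m\<close>, and the sum over all residues modulo \<open>2m\<close> can be folded into
  one over \<open>0 < l < m\<close> in which the theta functions are again antisymmetrised.
\<close>

lemma theta_diff_STTS:
  assumes tau: "Im \<tau> > 0" and m: "m > 0" and even: "even m"
  shows "theta_diff n m (- \<tau> / (2 * \<tau> - 1)) (z / (2 * \<tau> - 1))
    = jfactor ((- 1 / \<tau> + 1 + 1) / (2 * of_int m)) * jfactor (\<tau> / (2 * of_int m)) * gauss_gamma m
      * exp (of_real pi * \<i> * of_int m * z\<^sup>2 / (2 * \<tau> - 1)) * (- 2 * \<i>)
      * (\<Sum>l | 0 < l \<and> l < m \<and> [l = n] (mod 2). exp (- (of_real pi * \<i> * of_int (n\<^sup>2 + l\<^sup>2) / (4 * of_int m)))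
          * of_real (sin (pi * of_int (n * l) / (2 * of_int m))) * theta_diff l m \<tau> z)"
proof -
  have nz: "of_int m \<noteq> (0 :: complex)" using m by simp
  define b where "b l = (if even (n + l) then exp (- of_real pi * \<i> * (of_int (n + l))\<^sup>2 / (4 * of_int m)) else 0)
    - (if even (- n + l) then exp (- of_real pi * \<i> * (of_int (- n + l))\<^sup>2 / (4 * of_int m)) else 0)" for l
  define f where "f l = b l * theta_t l m \<tau> z 0" for l
  have odd: "b (- l) = - b l" for l
  proof -
    have "of_int (n + - l) = - (complex_of_int (- n + l))" "of_int (- n + - l) = - (complex_of_int (n + l))" by simp_all
    moreover have "even (n + - l) \<longleftrightarrow> even (n + l)" "even (- n + - l) \<longleftrightarrow> even (n + l)" "even (- n + l) \<longleftrightarrow> even (n + l)"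
      by auto
    ultimately show ?thesis unfolding b_def by (simp only: power2_minus) simp
  qed
  have bper: "b (l + 2 * m) = b l" for l
  proof -
    have *: "exp (- of_real pi * \<i> * (of_int (a + 2 * m))\<^sup>2 / (4 * of_int m))
       = exp (- of_real pi * \<i> * (of_int a)\<^sup>2 / (4 * of_int m))" if "even a" for a
    proof -
      from \<open>even a\<close> even obtain h c where "a = 2 * h" "m = 2 * c" by (elim evenE)
      then show ?thesis
        by (intro exp_eqI[where n = "- h - c"]) (use nz in \<open>simp add: field_simps power2_eq_square\<close>)
    qed
    show ?thesis
      using *[of "n + l"] *[of "- n + l"] unfolding b_def add.assoc[symmetric] by auto
  qed
  have b0: "b 0 = 0" using odd[of 0] by simp
  have bm: "b m = 0" using odd[of m] bper[of "- m"] by simp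
  have bval: "b l = (if even (n + l) then - 2 * \<i> * (exp (- (of_real pi * \<i> * of_int (n\<^sup>2 + l\<^sup>2) / (4 * of_int m)))
          * of_real (sin (pi * of_int (n * l) / (2 * of_int m)))) else 0)" for l
  proof (cases "even (n + l)")
    case True
    define E where "E = exp (- (of_real pi * \<i> * of_int (n\<^sup>2 + l\<^sup>2) / (4 * of_int m)))"
    define x where "x = complex_of_real (pi * of_int (n * l) / (2 * of_int m))"
    have "even (- n + l)" using True by simp
    then have "b l = exp (- of_real pi * \<i> * (of_int (n + l))\<^sup>2 / (4 * of_int m))
        - exp (- of_real pi * \<i> * (of_int (- n + l))\<^sup>2 / (4 * of_int m))"
      using True by (simp add: b_def)
    also have "exp (- of_real pi * \<i> * (of_int (n + l))\<^sup>2 / (4 * of_int m)) = E * exp (- (\<i> * x))"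
      unfolding E_def x_def exp_add[symmetric]
      by (intro arg_cong[where f = exp]) (use nz in \<open>simp add: field_simps power2_eq_square\<close>)
    also have "exp (- of_real pi * \<i> * (of_int (- n + l))\<^sup>2 / (4 * of_int m)) = E * exp (\<i> * x)"
      unfolding E_def x_def exp_add[symmetric]
      by (intro arg_cong[where f = exp]) (use nz in \<open>simp add: field_simps power2_eq_square\<close>)
    also have "E * exp (- (\<i> * x)) - E * exp (\<i> * x) = - 2 * \<i> * (E * sin x)"
      by (simp add: sin_exp_eq field_simps)
    also have "sin x = of_real (sin (pi * of_int (n * l) / (2 * of_int m)))"
      by (simp only: x_def sin_of_real)
    finally show ?thesis using True by (simp only: E_def if_True)
  qed (simp add: b_def)
  define C where "C = jfactor ((- 1 / \<tau> + 1 + 1) / (2 * of_int m)) * jfactor (\<tau> / (2 * of_int m)) * gauss_gamma m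
      * exp (of_real pi * \<i> * of_int m * z\<^sup>2 / (2 * \<tau> - 1))"
  have "theta_diff n m (- \<tau> / (2 * \<tau> - 1)) (z / (2 * \<tau> - 1)) = C * (\<Sum>l\<in>{0..<2 * m}. f l)"
    unfolding theta_diff_def theta_t_STTS[OF assms] C_def[symmetric] right_diff_distrib[symmetric]
      sum_subtractf[symmetric] left_diff_distrib[symmetric] f_def b_def ..
  also have "(\<Sum>l\<in>{0..<2 * m}. f l) = (\<Sum>l\<in>{0<..<m}. f l + f (- l))"
    by (rule sum_periodic_fold[OF m])
       (simp_all add: f_def bper theta_t_periodic[OF m] b0 bm)
  also have "\<dots> = (\<Sum>l\<in>{0<..<m}. b l * theta_diff l m \<tau> z)"
    by (simp add: f_def odd theta_diff_def right_diff_distrib)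
  also have "\<dots> = (\<Sum>l\<in>{0<..<m}. if [l = n] (mod 2) then
         - 2 * \<i> * (exp (- (of_real pi * \<i> * of_int (n\<^sup>2 + l\<^sup>2) / (4 * of_int m)))
          * of_real (sin (pi * of_int (n * l) / (2 * of_int m))) * theta_diff l m \<tau> z) else 0)"
  proof (intro sum.cong refl)
    fix l
    have "[l = n] (mod 2) \<longleftrightarrow> even (n + l)"
      by (simp add: cong_iff_dvd_diff) presburger
    then show "b l * theta_diff l m \<tau> z = (if [l = n] (mod 2) then
         - 2 * \<i> * (exp (- (of_real pi * \<i> * of_int (n\<^sup>2 + l\<^sup>2) / (4 * of_int m)))
          * of_real (sin (pi * of_int (n * l) / (2 * of_int m))) * theta_diff l m \<tau> z) else 0)"
      unfolding bval by simp
  qed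
  also have "\<dots> = - 2 * \<i> * (\<Sum>l | 0 < l \<and> l < m \<and> [l = n] (mod 2).
       exp (- (of_real pi * \<i> * of_int (n\<^sup>2 + l\<^sup>2) / (4 * of_int m)))
          * of_real (sin (pi * of_int (n * l) / (2 * of_int m))) * theta_diff l m \<tau> z)"
  proof -
    have "{l. 0 < l \<and> l < m \<and> [l = n] (mod 2)} = {l \<in> {0<..<m}. [l = n] (mod 2)}" by auto
    then show ?thesis unfolding sum_distrib_left by (simp only: sum.inter_filter[OF finite_greaterThanLessThan_int])
  qed
  finally show ?thesis unfolding C_def[symmetric] by (simp only: mult.assoc)
qed

section \<open>The character\<close>

lemma denom_STTS:
  assumes tau: "Im \<tau> > 0"
  shows "denom (- \<tau> / (2 * \<tau> - 1)) (z1 / (2 * \<tau> - 1)) (z2 / (2 * \<tau> - 1))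
      (t - (z1\<^sup>2 + z2\<^sup>2) / (2 * \<tau> - 1))
    = - (2 * \<tau> - 1) * exp (- (of_real pi * \<i> / 3)) * denom \<tau> z1 z2 t"
proof -
  have nz: "\<tau> \<noteq> 0" using tau by auto
  have jnz: "2 * \<tau> - 1 \<noteq> 0" using tau by (auto simp: complex_eq_iff)
  define \<sigma> where "\<sigma> = - 1 / \<tau> + 1 + 1"
  have sig: "Im \<sigma> > 0" unfolding \<sigma>_def by (rule Im_double_shift[OF tau])
  have sv: "\<sigma> = (2 * \<tau> - 1) / \<tau>" using nz by (simp add: \<sigma>_def field_simps)
  define s where "s = t - (z1\<^sup>2 + z2\<^sup>2) / (2 * \<tau>)"
  have arg: "- \<tau> / (2 * \<tau> - 1) = - 1 / \<sigma>" "z / (2 * \<tau> - 1) = z / \<tau> / \<sigma>" for z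
    using nz jnz by (simp_all add: sv)
  have "(z1\<^sup>2 + z2\<^sup>2) / (2 * \<tau> - 1) = (z1\<^sup>2 + z2\<^sup>2) / (2 * \<tau>) + ((z1 / \<tau>)\<^sup>2 + (z2 / \<tau>)\<^sup>2) / (2 * \<sigma>)"
  proof -
    have frac: "(a / x)\<^sup>2 / (2 * (y / x)) = a\<^sup>2 * (1 / (x * (2 * y)))" if "x \<noteq> 0" "y \<noteq> 0" for a x y :: complex
      using that by (simp add: field_simps power2_eq_square)
    define c where "c = 1 / (\<tau> * (2 * (2 * \<tau> - 1)))"
    have "(z1\<^sup>2 + z2\<^sup>2) / (2 * \<tau>) + ((z1 / \<tau>)\<^sup>2 + (z2 / \<tau>)\<^sup>2) / (2 * \<sigma>)
        = (z1\<^sup>2 + z2\<^sup>2) * (1 / (2 * \<tau>) + c)"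
      unfolding sv add_divide_distrib[of "(z1 / \<tau>)\<^sup>2"] frac[OF nz jnz] c_def[symmetric]
      by (simp add: distrib_left distrib_right add_divide_distrib)
    also have "1 / (2 * \<tau>) + c = 1 / (2 * \<tau> - 1)"
      using nz jnz by (simp add: c_def divide_simps)
    finally show ?thesis by simp
  qed
  then have t: "t - (z1\<^sup>2 + z2\<^sup>2) / (2 * \<tau> - 1) = s - ((z1 / \<tau>)\<^sup>2 + (z2 / \<tau>)\<^sup>2) / (2 * \<sigma>)"
    by (simp add: s_def)
  have "denom (- \<tau> / (2 * \<tau> - 1)) (z1 / (2 * \<tau> - 1)) (z2 / (2 * \<tau> - 1))
      (t - (z1\<^sup>2 + z2\<^sup>2) / (2 * \<tau> - 1)) = - \<i> * \<sigma> * denom \<sigma> (z1 / \<tau>) (z2 / \<tau>) s"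
    unfolding arg(1) arg(2)[of z1] arg(2)[of z2] t by (rule denom_inversion[OF sig])
  also have "\<dots> = (- \<i> * \<sigma>) * (- \<i> * \<tau>)
      * (exp (5 * of_real pi * \<i> / 6) * exp (5 * of_real pi * \<i> / 6)) * denom \<tau> z1 z2 t"
    unfolding \<sigma>_def denom_add_1 s_def denom_inversion[OF tau] by (simp only: mult_ac)
  also have "(- \<i> * \<sigma>) * (- \<i> * \<tau>) = - (2 * \<tau> - 1)"
  proof -
    have "(- \<i> * a) * (- \<i> * b) = - (a * b)" for a b :: complex
      by (simp add: complex_eq_iff algebra_simps)
    then show ?thesis using nz by (simp only:) (simp add: sv)
  qed
  also have "exp (5 * of_real pi * \<i> / 6) * exp (5 * of_real pi * \<i> / 6) = exp (- (of_real pi * \<i> / 3))"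
    unfolding exp_add[symmetric] by (rule exp_eqI[where n = 1]) (simp add: field_simps)
  finally show ?thesis .
qed

text \<open>
  The multipliers of the two inversions occur once for each of \<open>z1\<close> and \<open>z2\<close>, so only the square of
  their product matters; it equals \<open>- (2\<tau> - 1)/(4m\<^sup>2)\<close> for \<open>m = 2(K + 3)\<close>.
\<close>

lemma numer_STTS:
  assumes tau: "Im \<tau> > 0" and K: "K > -3"
  shows "numer K n1 n2 (- \<tau> / (2 * \<tau> - 1)) (z1 / (2 * \<tau> - 1)) (z2 / (2 * \<tau> - 1))
      (t - (z1\<^sup>2 + z2\<^sup>2) / (2 * \<tau> - 1))
    = (2 * \<tau> - 1) * ((gauss_gamma (2 * (K + 3)))\<^sup>2 / (4 * (of_int K + 3)\<^sup>2))
      * exp (- (of_real pi * \<i> / (8 * (of_int K + 3))) * of_int (n1\<^sup>2 + n2\<^sup>2))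
      * (\<Sum>k1 | 0 < k1 \<and> k1 < 2 * (K + 3) \<and> [k1 = n1] (mod 2).
          \<Sum>k2 | 0 < k2 \<and> k2 < 2 * (K + 3) \<and> [k2 = n2] (mod 2).
            exp (- (of_real pi * \<i> / (8 * (of_int K + 3))) * of_int (k1\<^sup>2 + k2\<^sup>2))
            * of_real (sin (pi * of_int (n1 * k1) / (4 * (of_int K + 3))))
            * of_real (sin (pi * of_int (n2 * k2) / (4 * (of_int K + 3))))
            * numer K k1 k2 \<tau> z1 z2 t)"
proof -
  define m where "m = 2 * (K + 3)"
  define N where "N = complex_of_int K + 3"
  have m: "m > 0" "even m" using K by (simp_all add: m_def)
  have "of_int (K + 3) \<noteq> (0 :: complex)" using K by (simp only: of_int_eq_0_iff)
  then have nzN: "N \<noteq> 0" by (simp add: N_def)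
  have mN: "of_int m = 2 * N" by (simp add: m_def N_def)
  have nz: "\<tau> \<noteq> 0" using tau by auto
  define j where "j = 2 * \<tau> - 1"
  have jnz: "j \<noteq> 0" using tau by (auto simp: j_def complex_eq_iff)
  define \<sigma> where "\<sigma> = - 1 / \<tau> + 1 + 1"
  have sig: "Im \<sigma> > 0" unfolding \<sigma>_def by (rule Im_double_shift[OF tau])
  have sv: "\<sigma> * \<tau> = j" using nz by (simp add: \<sigma>_def j_def field_simps)
  define C where "C = jfactor (\<sigma> / (2 * of_int m)) * jfactor (\<tau> / (2 * of_int m)) * gauss_gamma m"
  define V where "V z = exp (of_real pi * \<i> * of_int m * z\<^sup>2 / j)" for z
  define E where "E s = exp (2 * of_real pi * \<i> * N * s)" for s
  define u where "u k = exp (- (of_real pi * \<i> * (of_int k)\<^sup>2 / (8 * N)))" for k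
  define S where "S n k = complex_of_real (sin (pi * of_int (n * k) / (4 * (of_int K + 3))))" for n k
  define L where "L n = {k. 0 < k \<and> k < m \<and> [k = n] (mod 2)}" for n
  have upper: "Im (\<tau>' / (2 * of_int m)) > 0" if "Im \<tau>' > 0" for \<tau>'
    using that m Im_divide_of_real[of \<tau>' "2 * of_int m"] by simp
  have C2: "C\<^sup>2 = - j / (4 * (of_int m)\<^sup>2) * (gauss_gamma m)\<^sup>2"
  proof -
    have "C\<^sup>2 = (- \<i> * (\<sigma> / (2 * of_int m))) * (- \<i> * (\<tau> / (2 * of_int m))) * (gauss_gamma m)\<^sup>2"
      unfolding C_def power_mult_distrib by (simp only: jfactor_square upper sig tau)
    also have "(- \<i> * (\<sigma> / (2 * of_int m))) * (- \<i> * (\<tau> / (2 * of_int m))) = - (\<sigma> * \<tau>) / (4 * (of_int m)\<^sup>2)"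
    proof -
      have "(- \<i> * a) * (- \<i> * b) = - (a * b)" for a b :: complex
        by (simp add: complex_eq_iff algebra_simps)
      then show ?thesis by (simp only:) (simp add: power2_eq_square)
    qed
    finally show ?thesis by (simp only: sv)
  qed
  have D: "theta_diff n m (- \<tau> / j) (z / j)
      = C * V z * (- 2 * \<i>) * (u n * (\<Sum>k\<in>L n. u k * S n k * theta_diff k m \<tau> z))" for n z
  proof -
    have ex: "exp (- (of_real pi * \<i> * of_int (n\<^sup>2 + k\<^sup>2) / (4 * of_int m))) = u n * u k" for k
      unfolding u_def exp_add[symmetric] mN
      by (intro arg_cong[where f = exp]) (use nzN in \<open>simp add: field_simps\<close>)
    have "pi * of_int (n * k) / (2 * of_int m) = pi * of_int (n * k) / (4 * (of_int K + 3))" for k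
      by (simp add: m_def algebra_simps)
    then show ?thesis
      unfolding j_def theta_diff_STTS[OF tau m] ex C_def V_def S_def \<sigma>_def L_def sum_distrib_left
      by (simp only: mult_ac)
  qed
  have E: "E (t - (z1\<^sup>2 + z2\<^sup>2) / j) * (V z1 * V z2) = E t"
    unfolding E_def V_def exp_add[symmetric] mN
    by (intro arg_cong[where f = exp]) (use jnz in \<open>simp add: field_simps\<close>)
  have numer: "numer K k1 k2 \<tau>' z1 z2 t = E t * (theta_diff k1 m \<tau>' z1 * theta_diff k2 m \<tau>' z2)"
    if "Im \<tau>' > 0" for k1 k2 \<tau>' z1 z2 t
    unfolding E_def N_def m_def by (rule numer_eq_theta_diff[OF that K])
  have uu: "u k1 * u k2 = exp (- (of_real pi * \<i> / (8 * N)) * of_int (k1\<^sup>2 + k2\<^sup>2))" for k1 k2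
    unfolding u_def exp_add[symmetric]
    by (intro arg_cong[where f = exp]) (use nzN in \<open>simp add: field_simps\<close>)
  have "- \<tau> / j = - 1 / \<sigma>" using nz jnz by (simp add: sv[symmetric])
  then have upper': "Im (- \<tau> / j) > 0" using Im_inversion_pos[OF sig] by (simp only:)
  have "numer K n1 n2 (- \<tau> / j) (z1 / j) (z2 / j) (t - (z1\<^sup>2 + z2\<^sup>2) / j)
      = (E (t - (z1\<^sup>2 + z2\<^sup>2) / j) * (V z1 * V z2)) * C\<^sup>2 * (- 2 * \<i>)\<^sup>2 * (u n1 * u n2)
        * ((\<Sum>k\<in>L n1. u k * S n1 k * theta_diff k m \<tau> z1) * (\<Sum>k\<in>L n2. u k * S n2 k * theta_diff k m \<tau> z2))"
    unfolding numer[OF upper'] D power2_eq_square[of C] power2_eq_square[of "- 2 * \<i>"]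
    by (simp only: mult_ac)
  also have "\<dots> = (C\<^sup>2 * (- 2 * \<i>)\<^sup>2) * (u n1 * u n2)
        * (E t * ((\<Sum>k\<in>L n1. u k * S n1 k * theta_diff k m \<tau> z1) * (\<Sum>k\<in>L n2. u k * S n2 k * theta_diff k m \<tau> z2)))"
    unfolding E by (simp only: mult_ac)
  also have "C\<^sup>2 * (- 2 * \<i>)\<^sup>2 = j * ((gauss_gamma m)\<^sup>2 / (4 * N\<^sup>2))"
    unfolding C2 mN using nzN by (simp add: field_simps)
  also have "E t * ((\<Sum>k\<in>L n1. u k * S n1 k * theta_diff k m \<tau> z1) * (\<Sum>k\<in>L n2. u k * S n2 k * theta_diff k m \<tau> z2))
      = (\<Sum>k1\<in>L n1. \<Sum>k2\<in>L n2. (u k1 * u k2) * S n1 k1 * S n2 k2 * numer K k1 k2 \<tau> z1 z2 t)"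
    unfolding numer[OF tau] sum_product
    unfolding sum_distrib_left by (intro sum.cong refl) (simp only: mult_ac)
  finally show ?thesis
    unfolding uu unfolding j_def N_def S_def L_def m_def .
qed

lemma form_zvec: "form (zvec z1 z2) (zvec z1 z2) = z1\<^sup>2 + z2\<^sup>2"
  by (simp add: form_def zvec_def algebra_simps power2_eq_square)

theorem proposition3p3:
  fixes K n1 n2 :: int and \<tau> z1 z2 t :: complex
  assumes "K \<ge> -1"
    and "0 < n1" "n1 < 2 * (K + 3)"
    and "0 < n2" "n2 < 2 * (K + 3)"
    and "\<not> [n1 = n2] (mod 2)"
    and "Im \<tau> > 0"
  shows "ch K n1 n2 \<tau> z1 z2 t =
      - ((eta_t \<tau> t)\<^sup>2
         * (theta_t n1 (2 * (K + 3)) \<tau> z1 t - theta_t (- n1) (2 * (K + 3)) \<tau> z1 t)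
         * (theta_t n2 (2 * (K + 3)) \<tau> z2 t - theta_t (- n2) (2 * (K + 3)) \<tau> z2 t)
         / (vartheta11_t \<tau> z1 t * vartheta11_t \<tau> z2 t
            * vartheta11_t \<tau> (z1 - z2) t * vartheta11_t \<tau> (z1 + z2) t))
    \<and> ch_slash K n1 n2 (S_mat ** T_mat ** T_mat ** S_mat) \<tau> z1 z2 t =
      - ((gauss_gamma (2 * (K + 3)))\<^sup>2 / (4 * (of_int K + 3)\<^sup>2))
      * exp (of_real pi * \<i> / 3)
      * exp (- (of_real pi * \<i> / (8 * (of_int K + 3))) * of_int (n1\<^sup>2 + n2\<^sup>2))
      * (\<Sum>k1 | 0 < k1 \<and> k1 < 2 * (K + 3) \<and> [k1 = n1] (mod 2).
          \<Sum>k2 | 0 < k2 \<and> k2 < 2 * (K + 3) \<and> [k2 = n2] (mod 2).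
            exp (- (of_real pi * \<i> / (8 * (of_int K + 3))) * of_int (k1\<^sup>2 + k2\<^sup>2))
            * of_real (sin (pi * of_int (n1 * k1) / (4 * (of_int K + 3))))
            * of_real (sin (pi * of_int (n2 * k2) / (4 * (of_int K + 3))))
            * ch K k1 k2 \<tau> z1 z2 t)
    \<and> ch_slash K n1 n2 T_mat \<tau> z1 z2 t =
      - exp (of_real pi * \<i> / 6)
      * exp (of_real pi * \<i> / (4 * (of_int K + 3)) * of_int (n1\<^sup>2 + n2\<^sup>2))
      * ch K n1 n2 \<tau> z1 z2 t"
proof (intro conjI)
  have tau: "Im \<tau> > 0" by fact
  have K: "K > -3" using assms(1) by simp
  define m where "m = 2 * (K + 3)"
  define N where "N = complex_of_int K + 3"
  have m: "m > 0" using K by (simp add: m_def)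
  have "of_int (K + 3) \<noteq> (0 :: complex)" using K by (simp only: of_int_eq_0_iff)
  then have nzN: "N \<noteq> 0" by (simp add: N_def)
  have mN: "of_int m = 2 * N" by (simp add: m_def N_def)
  show "ch K n1 n2 \<tau> z1 z2 t =
      - ((eta_t \<tau> t)\<^sup>2
         * (theta_t n1 (2 * (K + 3)) \<tau> z1 t - theta_t (- n1) (2 * (K + 3)) \<tau> z1 t)
         * (theta_t n2 (2 * (K + 3)) \<tau> z2 t - theta_t (- n2) (2 * (K + 3)) \<tau> z2 t)
         / (vartheta11_t \<tau> z1 t * vartheta11_t \<tau> z2 t
            * vartheta11_t \<tau> (z1 - z2) t * vartheta11_t \<tau> (z1 + z2) t))"
  proof -
    have d: "theta_t n m \<tau> z t - theta_t (- n) m \<tau> z t = exp (of_real pi * \<i> * of_int m * t) * theta_diff n m \<tau> z" for n z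
      by (simp add: theta_diff_def theta_t_term right_diff_distrib)
    have "exp (2 * of_real pi * \<i> * N * (2 * t)) = exp (of_real pi * \<i> * of_int m * t) * exp (of_real pi * \<i> * of_int m * t)"
      unfolding mN exp_add[symmetric] by (intro arg_cong[where f = exp]) (simp add: algebra_simps)
    then have "numer' K n1 n2 \<tau> z1 z2 t = (theta_t n1 m \<tau> z1 t - theta_t (- n1) m \<tau> z1 t)
        * (theta_t n2 m \<tau> z2 t - theta_t (- n2) m \<tau> z2 t)"
      unfolding numer'_def numer_eq_theta_diff[OF tau K] d m_def[symmetric] N_def[symmetric] by (simp only: mult_ac)
    then show ?thesis
      unfolding ch_def vartheta11_product_eq_denom[OF tau] m_def[symmetric]
      using eta_t_nz[OF tau, of t] by (simp add: mult.assoc)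
  qed
  show "ch_slash K n1 n2 (S_mat ** T_mat ** T_mat ** S_mat) \<tau> z1 z2 t =
      - ((gauss_gamma (2 * (K + 3)))\<^sup>2 / (4 * (of_int K + 3)\<^sup>2))
      * exp (of_real pi * \<i> / 3)
      * exp (- (of_real pi * \<i> / (8 * (of_int K + 3))) * of_int (n1\<^sup>2 + n2\<^sup>2))
      * (\<Sum>k1 | 0 < k1 \<and> k1 < 2 * (K + 3) \<and> [k1 = n1] (mod 2).
          \<Sum>k2 | 0 < k2 \<and> k2 < 2 * (K + 3) \<and> [k2 = n2] (mod 2).
            exp (- (of_real pi * \<i> / (8 * (of_int K + 3))) * of_int (k1\<^sup>2 + k2\<^sup>2))
            * of_real (sin (pi * of_int (n1 * k1) / (4 * (of_int K + 3))))
            * of_real (sin (pi * of_int (n2 * k2) / (4 * (of_int K + 3))))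
            * ch K k1 k2 \<tau> z1 z2 t)"
  proof -
    define j where "j = 2 * \<tau> - 1"
    have jnz: "j \<noteq> 0" using tau by (auto simp: j_def complex_eq_iff)
    have slash: "slash F (S_mat ** T_mat ** T_mat ** S_mat) \<tau> z1 z2 s
        = inverse j * F (- \<tau> / j) (z1 / j) (z2 / j) (s - (z1\<^sup>2 + z2\<^sup>2) / j)" for F s
      unfolding slash_def STTS form_zvec by (simp add: Let_def j_def del: distrib_left_numeral right_diff_distrib_numeral)
    define G where "G = (gauss_gamma (2 * (K + 3)))\<^sup>2 / (4 * (of_int K + 3)\<^sup>2)"
    define U where "U = exp (- (of_real pi * \<i> / (8 * (of_int K + 3))) * of_int (n1\<^sup>2 + n2\<^sup>2))"
    define L where "L n = {k. 0 < k \<and> k < 2 * (K + 3) \<and> [k = n] (mod 2)}" for n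
    define c where "c k1 k2 = exp (- (of_real pi * \<i> / (8 * (of_int K + 3))) * of_int (k1\<^sup>2 + k2\<^sup>2))
            * of_real (sin (pi * of_int (n1 * k1) / (4 * (of_int K + 3))))
            * of_real (sin (pi * of_int (n2 * k2) / (4 * (of_int K + 3))))" for k1 k2
    define X where "X = (\<Sum>k1\<in>L n1. \<Sum>k2\<in>L n2. c k1 k2 * numer K k1 k2 \<tau> z1 z2 (2 * t))"
    define D where "D = denom \<tau> z1 z2 t"
    have frac: "inverse j * (j * G * U * X) / (inverse j * (- j * e * D)) = - G * inverse e * U * (X / D)" for e
      using jnz by (simp add: field_simps)
    have "ch_slash K n1 n2 (S_mat ** T_mat ** T_mat ** S_mat) \<tau> z1 z2 t
        = inverse j * (j * G * U * X) / (inverse j * (- j * exp (- (of_real pi * \<i> / 3)) * D))"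
      unfolding ch_slash_def slash j_def numer_STTS[OF tau K] denom_STTS[OF tau] G_def U_def X_def L_def c_def D_def ..
    also have "\<dots> = - G * exp (of_real pi * \<i> / 3) * U * (X / D)"
      unfolding frac by (simp add: exp_minus)
    also have "X / D = (\<Sum>k1\<in>L n1. \<Sum>k2\<in>L n2. c k1 k2 * ch K k1 k2 \<tau> z1 z2 t)"
      unfolding X_def D_def ch_def numer'_def sum_divide_distrib times_divide_eq_right ..
    finally show ?thesis unfolding G_def U_def L_def c_def .
  qed
  show "ch_slash K n1 n2 T_mat \<tau> z1 z2 t =
      - exp (of_real pi * \<i> / 6)
      * exp (of_real pi * \<i> / (4 * (of_int K + 3)) * of_int (n1\<^sup>2 + n2\<^sup>2))
      * ch K n1 n2 \<tau> z1 z2 t"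
  proof -
    have slash: "slash F T_mat \<tau> z1 z2 s = F (\<tau> + 1) z1 z2 s" for F s
      unfolding slash_def form_zvec by (simp add: Let_def T_mat_def)
    have tau1: "Im (\<tau> + 1) > 0" using tau by simp
    have d: "theta_diff n m (\<tau> + 1) z = exp (of_real pi * \<i> * (of_int n)\<^sup>2 / (2 * of_int m)) * theta_diff n m \<tau> z" for n z
      unfolding theta_diff_def theta_t_add_1[OF m] by (simp add: right_diff_distrib)
    have "exp (of_real pi * \<i> * (of_int n1)\<^sup>2 / (2 * of_int m)) * exp (of_real pi * \<i> * (of_int n2)\<^sup>2 / (2 * of_int m))
        = exp (of_real pi * \<i> / (4 * N) * of_int (n1\<^sup>2 + n2\<^sup>2))"
      unfolding exp_add[symmetric] mN
      by (intro arg_cong[where f = exp]) (use nzN in \<open>simp add: field_simps\<close>)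
    then have n: "numer K n1 n2 (\<tau> + 1) z1 z2 s
        = exp (of_real pi * \<i> / (4 * N) * of_int (n1\<^sup>2 + n2\<^sup>2)) * numer K n1 n2 \<tau> z1 z2 s" for s
      unfolding numer_eq_theta_diff[OF tau K] numer_eq_theta_diff[OF tau1 K] m_def[symmetric] d
      by (simp only: mult_ac)
    have "exp (5 * of_real pi * \<i> / 6) = exp (of_real pi * \<i> + - (of_real pi * \<i> / 6))"
      by (intro arg_cong[where f = exp]) (simp add: field_simps)
    also have "\<dots> = - inverse (exp (of_real pi * \<i> / 6))"
      by (simp only: exp_add exp_minus exp_pi_i mult_minus_left mult_1_left)
    finally have "inverse (exp (5 * of_real pi * \<i> / 6)) = - exp (of_real pi * \<i> / 6)"
      by simp
    moreover have "(e * x) / (f * y) = inverse f * e * (x / y)" for e f x y :: complex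
      by (simp add: divide_inverse)
    ultimately show ?thesis
      unfolding ch_slash_def slash n denom_add_1 ch_def numer'_def N_def[symmetric] by (simp only:)
  qed
qed

end
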